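(* Let $\mathcal{X}$ be a countable set equipped with the metric $d=d_{\mathcal T}$ generated by a rooted weighted tree $\mathcal T=(\mathcal{X},E)$, let $p\ge1$, and let $\mathbf r\in\mathcal{P}_p(\mathcal{X})$ be a probability distribution with full support on $\mathcal X$ such that, with $x_0=\mathrm{root}(\mathcal T)$, $$\sum_{x\in\mathcal{X}}d_{\mathcal T}(x,x_0)^p\sqrt{r_x}<\infty .$$ Let the empirical measures $\hat{\mathbf r}_n$ and $\hat{\mathbf s}_m$ be generated by independent random variables $X_1,\dots,X_n$ and $Y_1,\dots,Y_m$, respectively, all drawn from $\mathbf r=\mathbf s$. Then, with $\mathbf G\sim\mathcal{N}(0,\Sigma(\mathbf r))$, the following hold. (a) (One sample) As $n\to\infty$, $$n^{\frac1{2p}}\,W_p(\hat{\mathbf r}_n,\mathbf r)\ \xrightarrow{\mathscr{D}}\ Z_{\mathcal T,p}(\mathbf G).$$ (b) (Two sample) If $n\wedge m\to\infty$ and $n/(n+m)\to\alpha\in[0,1]$, then $$\Big(\frac{nm}{n+m}\Big)^{\frac1{2p}}W_p(\hat{\mathbf r}_n,\hat{\mathbf s}_m)\ \xrightarrow{\mathscr{D}}\ Z_{\mathcal T,p}(\mathbf G).$$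
   Context: Tree: $\mathcal T=(\mathcal{X},E)$ is an undirected connected graph without cycles on the countable vertex set $\mathcal{X}$, with edges weighted by $w:E\to\mathbb{R}_+$ (positive weights) and a chosen root $\mathrm{root}(\mathcal T)\in\mathcal{X}$ (vertices may have infinitely many neighbours). For $x\ne\mathrm{root}(\mathcal T)$, $\mathrm{parent}(x)$ is the immediate neighbour of $x$ on the unique path connecting $x$ and the root; $\mathrm{parent}(\mathrm{root}(\mathcal T))=\mathrm{root}(\mathcal T)$. $\mathrm{children}(x)$ is the set of $x'\in\mathcal{X}$ for which there is a sequence $x'=x_1,\dots,x_k=x$ with $\mathrm{parent}(x_j)=x_{j+1}$ for $j=1,\dots,k-1$ (all descendants of $x$, including $x$ itself). If $e_1,\dots,e_k$ are the edges of the unique path joining $x$ and $x'$, then $d_{\mathcal T}(x,x')=\sum_{j=1}^k w(e_j)$, a metric on $\mathcal{X}$. For $\mathbf u\in\mathbb{R}^{\mathcal{X}}$: $(S_{\mathcal T}\mathbf u)_x=\sum_{x'\in\mathrm{children}(x)}u_{x'}$ and $Z_{\mathcal T,p}(\mathbf u)=\big\{\sum_{x\in\mathcal{X}}|(S_{\mathcal T}\mathbf u)_x|\,d_{\mathcal T}(x,\mathrm{parent}(x))^p\big\}^{1/p}$. Probability measures are vectors $\mathbf r=(r_x)_{x\in\mathcal{X}}$, $r_x\ge0$, $\sum_xr_x=1$; full support means $r_x>0$ for all $x$; $\mathcal{P}_p(\mathcal{X})$ is the set of those with $\sum_xd(x,x_0)^pr_x<\infty$. $W_p(\mathbf r,\mathbf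 s)=\{\min_{\mathbf w}\sum_{x,x'}d(x,x')^pw_{x,x'}\}^{1/p}$, the minimum over probability measures $\mathbf w$ on $\mathcal{X}\times\mathcal{X}$ with marginals $\mathbf r$ and $\mathbf s$. Empirical measure: $\hat r_{n,x}=\frac1n\sum_{k=1}^n\mathbf 1_{\{X_k=x\}}$, and $\hat{\mathbf s}_m$ analogously from the $Y_k$. $\Sigma(\mathbf r)_{x,x'}=r_x(1-r_x)$ if $x=x'$, $-r_xr_{x'}$ if $x\ne x'$; $\mathbf G=(G_x)_{x\in\mathcal{X}}$ is a centred Gaussian process with this covariance, regarded as a random element of the space of $a\in\mathbb{R}^{\mathcal X}$ with $\sum_x d(x,x_0)^p|a_x|+|a_{x_0}|<\infty$. $\xrightarrow{\mathscr{D}}$ denotes convergence in distribution. *)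

theory Defs
  imports "HOL-Probability.Probability"
begin

section \<open>Rooted weighted trees\<close>

text \<open>The vertex set is the whole (countable) type \<open>'a\<close>; vertices may have infinite degree.\<close>

definition is_path :: "'a set set \<Rightarrow> 'a \<Rightarrow> 'a list \<Rightarrow> 'a \<Rightarrow> bool" where
  "is_path E x ps y \<longleftrightarrow>
     ps \<noteq> [] \<and> hd ps = x \<and> last ps = y \<and> distinct ps \<and> successively (\<lambda>u v. {u, v} \<in> E) ps"

definition is_cycle :: "'a set set \<Rightarrow> 'a list \<Rightarrow> bool" where
  "is_cycle E ps \<longleftrightarrow>
     3 \<le> length ps \<and> distinct ps \<and> successively (\<lambda>u v. {u, v} \<in> E) ps \<and> {last ps, hd ps} \<in> E"

definition weighted_tree :: "'a set set \<Rightarrow> ('a set \<Rightarrow> real) \<Rightarrow> bool" where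
  "weighted_tree E w \<longleftrightarrow>
     (\<forall>e\<in>E. card e = 2) \<and>
     (\<forall>x y. \<exists>ps. is_path E x ps y) \<and>
     (\<nexists>ps. is_cycle E ps) \<and>
     (\<forall>e\<in>E. 0 < w e)"

definition tree_path :: "'a set set \<Rightarrow> 'a \<Rightarrow> 'a \<Rightarrow> 'a list" where
  "tree_path E x y = (THE ps. is_path E x ps y)"

definition tree_dist :: "'a set set \<Rightarrow> ('a set \<Rightarrow> real) \<Rightarrow> 'a \<Rightarrow> 'a \<Rightarrow> real" where
  "tree_dist E w x y =
     (\<Sum>(u, v) \<leftarrow> zip (tree_path E x y) (tl (tree_path E x y)). w {u, v})"

definition parent :: "'a set set \<Rightarrow> 'a \<Rightarrow> 'a \<Rightarrow> 'a" where
  "parent E rt x = (if x = rt then rt else tree_path E x rt ! 1)"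

text \<open>All descendants of \<open>x\<close>, including \<open>x\<close> itself.\<close>

definition children :: "'a set set \<Rightarrow> 'a \<Rightarrow> 'a \<Rightarrow> 'a set" where
  "children E rt x =
     {x'. \<exists>xs. xs \<noteq> [] \<and> hd xs = x' \<and> last xs = x \<and>
            successively (\<lambda>u v. parent E rt u = v) xs}"

section \<open>The weighted \<open>\<ell>\<^sup>1\<close> space and the functionals \<open>S\<close> and \<open>Z\<close>\<close>

text \<open>The norm is \<open>\<Sum>x. d x x0 powr p * \<bar>a x\<bar> + \<bar>a x0\<bar>\<close>; the last summand does not affect
  finiteness.\<close>

definition weighted_l1 :: "('a \<Rightarrow> 'a \<Rightarrow> real) \<Rightarrow> real \<Rightarrow> 'a \<Rightarrow> ('a \<Rightarrow> real) set" where
  "weighted_l1 d p x0 = {a. (\<lambda>x. d x x0 powr p * \<bar>a x\<bar>) summable_on UNIV}"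

text \<open>For \<open>u\<close> in the weighted \<open>\<ell>\<^sup>1\<close> space of the tree metric with \<open>x0 = rt\<close> (the root), the series for
  \<open>tree_S E rt u x\<close> converges absolutely whenever \<open>x \<noteq> rt\<close>, and so does the outer series in
  \<open>tree_Z\<close>. The term at \<open>x = rt\<close>, where the inner series may diverge, has the factor
  \<open>tree_dist E w rt rt powr p = 0\<close>.\<close>

definition tree_S :: "'a set set \<Rightarrow> 'a \<Rightarrow> ('a \<Rightarrow> real) \<Rightarrow> 'a \<Rightarrow> real" where
  "tree_S E rt u x = (\<Sum>\<^sub>\<infinity>x'\<in>children E rt x. u x')"

definition tree_Z ::
    "'a set set \<Rightarrow> ('a set \<Rightarrow> real) \<Rightarrow> 'a \<Rightarrow> real \<Rightarrow> ('a \<Rightarrow> real) \<Rightarrow> real" where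
  "tree_Z E w rt p u =
     (\<Sum>\<^sub>\<infinity>x. \<bar>tree_S E rt u x\<bar> * tree_dist E w x (parent E rt x) powr p) powr (1 / p)"

section \<open>Probability vectors and Wasserstein distance\<close>

text \<open>A probability vector \<open>(r\<^sub>x)\<close> is a \<open>pmf\<close> \<open>r\<close>, with entries \<open>pmf r x\<close>.\<close>

definition pmf_moment :: "('a \<Rightarrow> 'a \<Rightarrow> real) \<Rightarrow> real \<Rightarrow> 'a \<Rightarrow> 'a pmf set" where
  "pmf_moment d p x0 = {r. (\<lambda>x. d x x0 powr p * pmf r x) summable_on UNIV}"

definition couplings :: "'a pmf \<Rightarrow> 'a pmf \<Rightarrow> ('a \<times> 'a) pmf set" where
  "couplings r s = {w. map_pmf fst w = r \<and> map_pmf snd w = s}"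

text \<open>The transport cost is taken in \<open>ennreal\<close>, so that couplings of infinite cost do not get a
  junk value; the infimum is finite for \<open>r\<close>, \<open>s\<close> with finite \<open>p\<close>-th moment.\<close>

definition wasserstein :: "('a \<Rightarrow> 'a \<Rightarrow> real) \<Rightarrow> real \<Rightarrow> 'a pmf \<Rightarrow> 'a pmf \<Rightarrow> real" where
  "wasserstein d p r s =
     enn2real (INF w\<in>couplings r s. \<integral>\<^sup>+(x, x'). ennreal (d x x' powr p) \<partial>measure_pmf w) powr (1 / p)"

text \<open>Observations are indexed from \<open>0\<close>. For \<open>n = 0\<close> the empirical measure is unspecified.\<close>

definition empirical :: "nat \<Rightarrow> (nat \<Rightarrow> 'a) \<Rightarrow> 'a pmf" where
  "empirical n xs = embed_pmf (\<lambda>x. (\<Sum>k<n. indicator {xs k} x) / real n)"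

lemma pmf_empirical:
  assumes "0 < n"
  shows "pmf (empirical n xs) x = (\<Sum>k<n. indicator {xs k} x) / real n"
  unfolding empirical_def
proof (rule pmf_embed_pmf)
  show "0 \<le> (\<Sum>k<n. indicator {xs k} y) / real n" for y
    by (intro divide_nonneg_nonneg sum_nonneg) auto
  have "(\<integral>\<^sup>+y. ennreal ((\<Sum>k<n. indicator {xs k} y) / real n) \<partial>count_space UNIV)
      = (\<integral>\<^sup>+y. (\<Sum>k<n. ennreal (1 / real n) * indicator {xs k} y) \<partial>count_space UNIV)"
  proof (rule nn_integral_cong)
    fix y
    have "ennreal ((\<Sum>k<n. indicator {xs k} y) / real n)
        = ennreal (\<Sum>k<n. 1 / real n * indicator {xs k} y)"
      by (subst sum_divide_distrib) (rule arg_cong[where f = ennreal], rule sum.cong, auto)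
    also have "\<dots> = (\<Sum>k<n. ennreal (1 / real n * indicator {xs k} y))"
      by (rule sum_ennreal[symmetric]) auto
    also have "\<dots> = (\<Sum>k<n. ennreal (1 / real n) * indicator {xs k} y)"
      by (rule sum.cong) (auto simp: indicator_def)
    finally show "ennreal ((\<Sum>k<n. indicator {xs k} y) / real n)
        = (\<Sum>k<n. ennreal (1 / real n) * indicator {xs k} y)" .
  qed
  also have "\<dots> = (\<Sum>k<n. ennreal (1 / real n))"
    by (subst nn_integral_sum) (auto simp: nn_integral_cmult)
  also have "\<dots> = 1"
    using assms by (simp add: ennreal_of_nat_eq_real_of_nat ennreal_mult[symmetric])
  finally show "(\<integral>\<^sup>+y. ennreal ((\<Sum>k<n. indicator {xs k} y) / real n) \<partial>count_space UNIV) = 1" .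
qed

section \<open>Gaussian limit\<close>

definition multinomial_cov :: "'a pmf \<Rightarrow> 'a \<Rightarrow> 'a \<Rightarrow> real" where
  "multinomial_cov r x x' =
     (if x = x' then pmf r x * (1 - pmf r x) else - pmf r x * pmf r x')"

text \<open>Degenerate normal laws (\<open>\<sigma> = 0\<close>) are point masses; they do occur, since
  \<open>multinomial_cov r\<close> may be singular.\<close>

definition normal_law :: "real \<Rightarrow> real \<Rightarrow> real measure" where
  "normal_law \<mu> \<sigma> =
     (if \<sigma> = 0 then return borel \<mu> else density lborel (\<lambda>t. ennreal (normal_density \<mu> \<sigma> t)))"

text \<open>A process is Gaussian if all finite linear combinations of its coordinates are normal.\<close>

definition centred_gaussian_process ::
    "'v measure \<Rightarrow> ('a \<Rightarrow> 'v \<Rightarrow> real) \<Rightarrow> ('a \<Rightarrow> 'a \<Rightarrow> real) \<Rightarrow> bool" where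
  "centred_gaussian_process N G C \<longleftrightarrow>
     prob_space N \<and>
     (\<forall>x. G x \<in> borel_measurable N) \<and>
     (\<forall>F c. finite F \<longrightarrow>
        (\<exists>\<mu> \<sigma>. 0 \<le> \<sigma> \<and> distr N borel (\<lambda>\<omega>. \<Sum>x\<in>F. c x * G x \<omega>) = normal_law \<mu> \<sigma>)) \<and>
     (\<forall>x. (\<integral>\<omega>. G x \<omega> \<partial>N) = 0) \<and>
     (\<forall>x x'. (\<integral>\<omega>. G x \<omega> * G x' \<omega> \<partial>N) = C x x')"

end

theory Submission
  imports Defs
begin

text \<open>On a tree the cost \<open>d powr p\<close> is superadditive along paths, so a cut at the edge above \<open>z\<close>
  is crossed at cost at least \<open>d(z, parent z) powr p\<close>. Duality with the potential built from the signs of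
  \<open>S(\<eta> - \<theta>)\<close> therefore bounds the optimal transport cost of \<open>\<eta>\<close> and \<open>\<theta>\<close> below by the \<open>p\<close>-th power of
  \<open>Z(\<eta> - \<theta>)\<close>. Conversely, when \<open>\<eta> - \<theta>\<close> is small compared with the masses on a finite subtree \<open>A\<close>,
  all the flows along the edges of \<open>A\<close> can be realised at the same time by one coupling, and the mass outside \<open>A\<close>
  is exchanged with the root; this matches the lower bound up to the weighted \<open>\<ell>\<^sup>1\<close> norm of
  \<open>\<eta> - \<theta>\<close> outside \<open>A\<close>. The condition \<open>\<Sum> d powr p * sqrt r < \<infinity>\<close> makes that tail
  uniformly small in mean after rescaling, so only finitely many coordinates matter. Their joint
  convergence is used through characteristic functions: \<open>exp (i \<tau> \<Sum> c \<bar>L\<bar>)\<close> with linear forms \<open>L\<close> is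
  approximated by trigonometric polynomials, whose expectations converge by the central limit theorem.\<close>

section \<open>Paths and distances in a tree\<close>

text \<open>The two bounds need different things. The dual bound holds for all pairs of measures,
  while the coupling requires enough mass at every node of \<open>A\<close>, and full support gives
  a positive lower bound on the masses only over a finite set. So \<open>A\<close> is fixed first
  and the sample sizes grow afterwards; the threshold for closeness depends on \<open>A\<close>, but
  the mean l1 distance of the empirical measures from \<open>r\<close> tends to 0. Exchanging the
  outside mass with the root, instead of along infinitely many branches, makes the errors of the
  dual bound, of the coupling and of truncating \<open>tree_Z\<close> one and the same quantity,
  \<open>tail\<close>. Its mean is bounded coordinate by coordinate: the mean deviation of a
  frequency is at most \<open>sqrt (pmf r x / n)\<close>, and that of \<open>G x\<close> at most
  \<open>sqrt (pmf r x)\<close>, which is where the square root in the hypothesis comes from. All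
  limits are taken for the p-th power of the distance: on this scale the functional is homogeneous
  of degree one and the normalisation is \<open>sqrt n\<close>. The p-th root is applied last, as a
  continuous map.\<close>

locale wtree =
  fixes E :: "'a set set" and w :: "'a set \<Rightarrow> real" and rt :: 'a
  assumes tree: "weighted_tree E w"
begin

abbreviation "adj \<equiv> \<lambda>u v. {u, v} \<in> E"

lemma adj_neq: "{u, v} \<in> E \<Longrightarrow> u \<noteq> v"
  using tree unfolding weighted_tree_def by fastforce

lemma adj_commute: "{u, v} \<in> E \<Longrightarrow> {v, u} \<in> E"
  by (simp add: insert_commute)

lemma weight_pos: "e \<in> E \<Longrightarrow> 0 < w e"
  using tree unfolding weighted_tree_def by blast

lemma no_cycle: "\<not> is_cycle E ps"
  using tree unfolding weighted_tree_def by blast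

lemma successively_adj_commute: "successively (\<lambda>u v. adj v u) ps = successively adj ps"
  by (simp add: insert_commute)

lemma successively_adj_rev: "successively adj (rev ps) = successively adj ps"
  by (simp only: successively_rev successively_adj_commute)

text \<open>Two paths that leave \<open>x\<close> through different neighbours meet again, at the
  latest at \<open>y\<close>, and the pieces up to the first meeting point form a cycle. Hence they
  leave through the same neighbour, and induction applies to the rest.\<close>

lemma path_unique:
  assumes "is_path E x ps y" "is_path E x qs y"
  shows "ps = qs"
  using assms
proof (induction ps arbitrary: x qs)
  case Nil
  then show ?case by (simp add: is_path_def)
next
  case (Cons a ps')
  from Cons.prems(1) have a: "a = x" by (simp add: is_path_def)
  from Cons.prems(2) obtain qs' where qs: "qs = x # qs'"
    by (cases qs) (auto simp: is_path_def)
  show ?case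
  proof (cases "ps' = [] \<or> qs' = []")
    case True
    then have "x = y"
      using Cons.prems qs a by (auto simp: is_path_def)
    then show ?thesis
      using Cons.prems qs a by (auto simp: is_path_def split: if_splits)
  next
    case False
    have p: "is_path E (hd ps') ps' y" "x \<notin> set ps'" "adj x (hd ps')"
      using Cons.prems(1) False a by (auto simp: is_path_def successively_Cons)
    have q: "is_path E (hd qs') qs' y" "x \<notin> set qs'" "adj x (hd qs')"
      using Cons.prems(2) False qs by (auto simp: is_path_def successively_Cons)
    have "hd ps' = hd qs'"
    proof (rule ccontr)
      assume ne: "hd ps' \<noteq> hd qs'"
      have "\<exists>v\<in>set ps'. v \<in> set qs'"
        using p(1) q(1) unfolding is_path_def by (metis last_in_set)
      then obtain P1 v P2 where P: "ps' = P1 @ v # P2" "v \<in> set qs'" "\<forall>u\<in>set P1. u \<notin> set qs'"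
        using split_list_first_prop[of ps' "\<lambda>v. v \<in> set qs'"] by blast
      from P(2) obtain Q1 Q2 where Q: "qs' = Q1 @ v # Q2"
        by (meson split_list)
      \<comment> \<open>Out along the first path to \<open>v\<close>, its first vertex on the second
        path, and back along the second. The closing edge joins \<open>x\<close> to its neighbour on
        the second path.\<close>
      let ?c = "(x # P1 @ [v]) @ rev Q1"
      \<comment> \<open>If both pieces were empty, \<open>v\<close> would be the next vertex on both
        paths. So the cycle has at least three vertices.\<close>
      have nonempty: "P1 \<noteq> [] \<or> Q1 \<noteq> []"
        using ne P(1) Q by auto
      have "successively adj (x # ps')"
        using Cons.prems(1) a by (simp add: is_path_def)
      then have "successively adj ((x # P1 @ [v]) @ P2)"
        by (simp add: P(1))
      then have s1: "successively adj (x # P1 @ [v])"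
        by (simp only: successively_append_iff)
      have "successively adj ((Q1 @ [v]) @ Q2)"
        using q(1) Q by (simp add: is_path_def)
      then have "successively adj (Q1 @ [v])"
        by (simp only: successively_append_iff)
      then have "successively adj (rev (Q1 @ [v]))"
        by (simp only: successively_adj_rev)
      then have s2: "successively adj (v # rev Q1)"
        by (simp only: rev_append rev.simps append_Nil append_Cons)
      have "successively adj ((x # P1 @ [v]) @ rev Q1)"
        using s1 s2 by (simp only: successively_append_iff successively_Cons) auto
      then      have "successively adj ?c" .
      moreover have "distinct ?c"
        using p(1,2) q(1,2) P Q unfolding is_path_def by auto
      moreover have "3 \<le> length ?c"
        using nonempty by (cases P1; cases Q1) auto
      moreover have "{last ?c, hd ?c} \<in> E"
        using q(3) Q by (cases Q1) (auto simp: insert_commute)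
      ultimately have "is_cycle E ?c"
        unfolding is_cycle_def by blast
      then show False using no_cycle by blast
    qed
    then show ?thesis
      using Cons.IH[OF p(1)] q(1) a qs by simp
  qed
qed

lemma tree_path_eqI: "is_path E x ps y \<Longrightarrow> tree_path E x y = ps"
  unfolding tree_path_def using path_unique by blast

lemma is_path_tree_path: "is_path E x (tree_path E x y) y"
  using tree tree_path_eqI unfolding weighted_tree_def by metis

lemma tree_path_same: "tree_path E x x = [x]"
  by (rule tree_path_eqI) (simp add: is_path_def)

lemma tree_path_rev: "tree_path E y x = rev (tree_path E x y)"
  using is_path_tree_path[of x y]
  by (intro tree_path_eqI) (auto simp: is_path_def successively_adj_commute hd_rev last_rev)

lemma adj_tree_path: "{u, v} \<in> E \<Longrightarrow> tree_path E u v = [u, v]"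
  using adj_neq by (intro tree_path_eqI) (auto simp: is_path_def)

fun plen :: "'a list \<Rightarrow> real" where
  "plen (x # y # ps) = w {x, y} + plen (y # ps)"
| "plen _ = 0"

lemma tree_dist_plen: "tree_dist E w x y = plen (tree_path E x y)"
proof -
  have "(\<Sum>(u, v) \<leftarrow> zip ps (tl ps). w {u, v}) = plen ps" for ps
    by (induction ps rule: plen.induct) auto
  then show ?thesis by (simp add: tree_dist_def)
qed

lemma plen_append: "plen (ps @ [x, y]) = plen (ps @ [x]) + w {x, y}"
  by (induction ps rule: plen.induct) auto

lemma plen_rev: "plen (rev ps) = plen ps"
  by (induction ps rule: plen.induct) (auto simp: plen_append insert_commute)

lemma tdist_commute: "tree_dist E w x y = tree_dist E w y x"
  by (simp add: tree_dist_plen tree_path_rev[of y x] plen_rev)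

lemma tdist_self [simp]: "tree_dist E w x x = 0"
  by (simp add: tree_dist_plen tree_path_same)

lemma dist_adj: "{u, v} \<in> E \<Longrightarrow> tree_dist E w u v = w {u, v}"
  by (simp add: tree_dist_plen adj_tree_path)

lemma plen_nonneg: "successively adj ps \<Longrightarrow> 0 \<le> plen ps"
  by (induction ps rule: plen.induct) (auto intro!: add_nonneg_nonneg less_imp_le[OF weight_pos])

lemma tdist_nonneg [simp]: "0 \<le> tree_dist E w x y"
  using is_path_tree_path[of x y] by (auto simp: tree_dist_plen is_path_def intro: plen_nonneg)

section \<open>Parents, ancestors and descendants\<close>

abbreviation "par \<equiv> parent E rt"
abbreviation "ch \<equiv> children E rt"

lemma parent_root [simp]: "par rt = rt"
  by (simp add: parent_def)

text \<open>The tail of a path is a path, so uniqueness identifies it with the path of the parent.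
  All inductions towards the root rest on this recursion.\<close>

lemma tree_path_parent:
  assumes "x \<noteq> rt"
  shows "tree_path E x rt = x # tree_path E (par x) rt"
proof -
  let ?p = "tree_path E x rt"
  have p: "is_path E x ?p rt" by (rule is_path_tree_path)
  then obtain ps where ps: "?p = x # ps" by (cases ?p) (auto simp: is_path_def)
  with p assms have ne: "ps \<noteq> []" by (auto simp: is_path_def)
  then have "par x = hd ps" using assms ps by (simp add: parent_def hd_conv_nth)
  moreover have "is_path E (hd ps) ps rt"
    using p ne ps by (auto simp: is_path_def successively_Cons)
  ultimately show ?thesis using ps tree_path_eqI by metis
qed

lemma hd_tree_path: "hd (tree_path E x y) = x" "tree_path E x y \<noteq> []"
  using is_path_tree_path[of x y] by (auto simp: is_path_def)

lemma parent_adj: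
  assumes "x \<noteq> rt"
  shows "{x, par x} \<in> E"
  using is_path_tree_path[of x rt] hd_tree_path[of "par x" rt]
  by (auto simp: tree_path_parent[OF assms] is_path_def successively_Cons)

text \<open>If \<open>v\<close> lies on the path from \<open>u\<close> to the root, the piece up to
  \<open>v\<close> is the edge itself by uniqueness; otherwise prepending \<open>v\<close> to that
  path gives the path of \<open>v\<close>. So edges can be indexed by their lower endpoint.\<close>

lemma adj_cases:
  assumes "{u, v} \<in> E"
  shows "(u \<noteq> rt \<and> v = par u) \<or> (v \<noteq> rt \<and> u = par v)"
proof (cases "v \<in> set (tree_path E u rt)")
  case False
  have "v \<noteq> rt"
    using False is_path_tree_path[of u rt] last_in_set by (fastforce simp: is_path_def)
  have "is_path E v (v # tree_path E u rt) rt"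
    using False is_path_tree_path[of u rt] adj_commute[OF assms]
    by (auto simp: is_path_def successively_Cons)
  then have "tree_path E v rt = v # tree_path E u rt"
    by (rule tree_path_eqI)
  then have "tree_path E (par v) rt = tree_path E u rt"
    using tree_path_parent[OF \<open>v \<noteq> rt\<close>] by simp
  then have "par v = u" by (metis hd_tree_path(1))
  then show ?thesis using \<open>v \<noteq> rt\<close> by auto
next
  case True
  then obtain P Q where PQ: "tree_path E u rt = P @ v # Q" by (meson split_list)
  have uv: "u \<noteq> v" using adj_neq assms by blast
  have "successively adj ((P @ [v]) @ Q)" "distinct ((P @ [v]) @ Q)" "hd (P @ [v]) = u"
    using is_path_tree_path[of u rt] PQ by (auto simp: is_path_def hd_append)
  then have "is_path E u (P @ [v]) v"
    unfolding is_path_def by (simp only: successively_append_iff distinct_append) simp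
  then have "P @ [v] = [u, v]" using adj_tree_path[OF assms] tree_path_eqI by metis
  then have P: "P = [u]" by simp
  then have "u \<noteq> rt" using PQ tree_path_same[of rt] by auto
  moreover from this have "tree_path E (par u) rt = v # Q"
    using PQ P tree_path_parent[of u] by simp
  then have "par u = v" by (metis hd_tree_path(1) list.sel(1))
  ultimately show ?thesis by auto
qed

lemma tree_path_induct [case_names root step]:
  assumes "P rt" "\<And>x. x \<noteq> rt \<Longrightarrow> P (par x) \<Longrightarrow> P x"
  shows "P x"
proof (induction "length (tree_path E x rt)" arbitrary: x rule: less_induct)
  case less
  then show ?case
    using assms tree_path_parent[of x] by (cases "x = rt") auto
qed

text \<open>Removing or prepending the first entry of the sequence in \<open>children\<close>. From
  here on this recursion replaces the sequences, except at the root.\<close>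

lemma children_rec: "x \<in> ch z \<longleftrightarrow> x = z \<or> par x \<in> ch z"
proof
  assume "x \<in> ch z"
  then obtain xs where xs: "xs \<noteq> []" "hd xs = x" "last xs = z" "successively (\<lambda>u v. par u = v) xs"
    by (auto simp: children_def)
  then obtain ys where ys: "xs = x # ys" by (cases xs) auto
  show "x = z \<or> par x \<in> ch z"
  proof (cases "ys = []")
    case True
    then show ?thesis using xs ys by simp
  next
    case False
    then have "ys \<noteq> [] \<and> hd ys = par x \<and> last ys = z \<and> successively (\<lambda>u v. par u = v) ys"
      using xs ys by (auto simp: successively_Cons)
    then show ?thesis unfolding children_def by blast
  qed
next
  assume "x = z \<or> par x \<in> ch z"
  then show "x \<in> ch z"
  proof
    assume "x = z"
    then have "[x] \<noteq> [] \<and> hd [x] = x \<and> last [x] = z \<and> successively (\<lambda>u v. par u = v) [x]"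
      by simp
    then show ?thesis unfolding children_def by blast
  next
    assume "par x \<in> ch z"
    then obtain xs where xs: "xs \<noteq> []" "hd xs = par x" "last xs = z" "successively (\<lambda>u v. par u = v) xs"
      by (auto simp: children_def)
    then have "x # xs \<noteq> [] \<and> hd (x # xs) = x \<and> last (x # xs) = z \<and>
        successively (\<lambda>u v. par u = v) (x # xs)"
      by (auto simp: successively_Cons)
    then show ?thesis unfolding children_def by blast
  qed
qed

lemma children_self [simp]: "z \<in> ch z"
  using children_rec by blast

text \<open>At the root \<open>children_rec\<close> is void because \<open>par rt = rt\<close>; but
  a sequence of parents that starts at the root never leaves it, whatever its length.\<close>

lemma root_children: "rt \<in> ch y \<longleftrightarrow> y = rt"
proof
  assume "rt \<in> ch y"
  then obtain xs where xs: "xs \<noteq> []" "hd xs = rt" "last xs = y" "successively (\<lambda>u v. par u = v) xs"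
    by (auto simp: children_def)
  have "hd xs = rt \<Longrightarrow> successively (\<lambda>u v. par u = v) xs \<Longrightarrow> xs \<noteq> [] \<Longrightarrow> last xs = rt" for xs
    by (induction xs) (auto simp: successively_Cons)
  then show "y = rt" using xs by blast
qed simp

text \<open>The path to the root is a finite list, so a vertex has finitely many ancestors whatever
  the degrees in the tree. Sums over ancestors are therefore finite.\<close>

lemma children_iff_path: "x \<in> ch z \<longleftrightarrow> z \<in> set (tree_path E x rt)"
proof (induction x rule: tree_path_induct)
  case root
  then show ?case by (auto simp: root_children tree_path_same)
next
  case (step x)
  then show ?case using children_rec[of x z] tree_path_parent[of x] by auto
qed

lemma parent_not_children: 
  assumes "z \<noteq> rt"
  shows "par z \<notin> ch z"
  using is_path_tree_path[of z rt] tree_path_parent[OF assms]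
  by (auto simp: is_path_def children_iff_path)

lemma finite_ancestors: "finite {z. x \<in> ch z}"
  by (simp add: children_iff_path)

text \<open>The ancestors of \<open>x\<close> form a chain, since all of them lie on one path to the
  root.\<close>

lemma children_linear:
  assumes "x \<in> ch y" "x \<in> ch z"
  shows "y \<in> ch z \<or> z \<in> ch y"
  using assms
proof (induction x rule: tree_path_induct)
  case root
  then show ?case by (auto simp: root_children)
next
  case (step x)
  then show ?case by (metis children_rec)
qed

lemma siblings_disjoint:
  assumes "x \<in> ch y" "x \<in> ch z" "par y = par z" "y \<noteq> rt" "z \<noteq> rt"
  shows "y = z"
  using children_linear[OF assms(1,2)] assms children_rec parent_not_children by metis

text \<open>A step along an edge goes to a parent or to a child, and by \<open>children_rec\<close>
  it changes membership in \<open>ch z\<close> only when the lower endpoint is \<open>z\<close>. The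
  descendants of \<open>z\<close> are tied to the rest of the tree by this edge alone.\<close>

lemma crossing_edge:
  assumes "successively adj ps" "ps \<noteq> []" "z \<noteq> rt"
    and "(hd ps \<in> ch z) \<noteq> (last ps \<in> ch z)"
  shows "\<exists>P Q u v. ps = P @ u # v # Q \<and> {u, v} = {z, par z}"
  using assms
proof (induction ps)
  case Nil
  then show ?case by simp
next
  case (Cons u ps)
  then have ne: "ps \<noteq> []" by auto
  then obtain v qs where v: "ps = v # qs" by (cases ps) auto
  show ?case
  proof (cases "(u \<in> ch z) = (v \<in> ch z)")
    case True
    then have "\<exists>P Q u v. ps = P @ u # v # Q \<and> {u, v} = {z, par z}"
      using Cons v by (auto simp: successively_Cons)
    then obtain P Q a b where "ps = P @ a # b # Q" "{a, b} = {z, par z}" by blast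
    then have "u # ps = (u # P) @ a # b # Q" "{a, b} = {z, par z}" by auto
    then show ?thesis by blast
  next
    case False
    have "adj u v" using Cons.prems v by (auto simp: successively_Cons)
    from adj_cases[OF this] False have "{u, v} = {z, par z}"
      using children_rec[of u z] children_rec[of v z] by auto
    then have "u # ps = [] @ u # v # qs \<and> {u, v} = {z, par z}" using v by simp
    then show ?thesis by blast
  qed
qed

text \<open>Two different vertices with the same edge above them would be parents of each other.
  Distinct cuts thus contribute distinct edges to a path.\<close>

lemma edge_inj: "inj_on (\<lambda>z. {z, par z}) (- {rt})"
proof (rule inj_onI)
  fix y z assume yz: "y \<in> - {rt}" "z \<in> - {rt}" "{y, par y} = {z, par z}"
  show "y = z"
  proof (rule ccontr)
    assume "y \<noteq> z"
    then have "y = par z" "z = par y" using yz by (auto simp: doubleton_eq_iff)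
    then have "y \<in> ch z" using children_rec[of y z] by simp
    then show False using \<open>y = par z\<close> parent_not_children[of z] yz(2) by simp
  qed
qed

fun edges :: "'a list \<Rightarrow> 'a set list" where
  "edges (x # y # ps) = {x, y} # edges (y # ps)"
| "edges _ = []"

lemma plen_edges: "plen ps = sum_list (map w (edges ps))"
  by (induction ps rule: edges.induct) auto

lemma edges_append: "{u, v} \<in> set (edges (P @ u # v # Q))"
  by (induction P rule: edges.induct) auto

lemma edges_subset: "successively adj ps \<Longrightarrow> set (edges ps) \<subseteq> E"
  by (induction ps rule: edges.induct) auto

lemma sum_set_le_sum_list:
  fixes f :: "'b \<Rightarrow> real"
  assumes "\<And>x. x \<in> set xs \<Longrightarrow> 0 \<le> f x"
  shows "sum f (set xs) \<le> sum_list (map f xs)"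
  using assms
proof (induction xs)
  case (Cons x xs)
  then have "sum f (set xs) \<le> sum_list (map f xs)" by simp
  moreover have "0 \<le> f x" using Cons by simp
  ultimately show ?case by (cases "x \<in> set xs") (auto simp: insert_absorb)
qed simp

text \<open>The path from \<open>x\<close> to \<open>y\<close> contains the edge above each
  \<open>z\<close> in \<open>B\<close>; these edges are distinct, so their weights make up a part of
  its length.\<close>

lemma sum_crossing_le_dist:
  assumes "finite B" "\<And>z. z \<in> B \<Longrightarrow> z \<noteq> rt \<and> (x \<in> ch z) \<noteq> (y \<in> ch z)"
  shows "(\<Sum>z\<in>B. tree_dist E w z (par z)) \<le> tree_dist E w x y"
proof -
  let ?p = "tree_path E x y"
  have p: "is_path E x ?p y" by (rule is_path_tree_path)
  have sub: "(\<lambda>z. {z, par z}) ` B \<subseteq> set (edges ?p)"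
  proof safe
    fix z assume "z \<in> B"
    then obtain P Q u v where "?p = P @ u # v # Q" "{u, v} = {z, par z}"
      using crossing_edge[of ?p z] p assms(2)[of z] unfolding is_path_def by metis
    then show "{z, par z} \<in> set (edges ?p)" using edges_append by metis
  qed
  have E: "set (edges ?p) \<subseteq> E" using p edges_subset unfolding is_path_def by blast
  have inj: "inj_on (\<lambda>z. {z, par z}) B"
    using assms(2) by (intro inj_on_subset[OF edge_inj]) auto
  have "(\<Sum>z\<in>B. tree_dist E w z (par z)) = (\<Sum>z\<in>B. w {z, par z})"
    using assms(2) by (intro sum.cong refl dist_adj parent_adj) auto
  also have "\<dots> = sum w ((\<lambda>z. {z, par z}) ` B)"
    using inj by (simp add: sum.reindex)
  also have "\<dots> \<le> sum w (set (edges ?p))"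
    by (rule sum_mono2[OF _ sub]) (use E in \<open>auto intro: less_imp_le weight_pos\<close>)
  also have "\<dots> \<le> tree_dist E w x y"
    unfolding tree_dist_plen plen_edges
    by (rule sum_set_le_sum_list) (use E in \<open>auto intro: less_imp_le weight_pos\<close>)
  finally show ?thesis .
qed

end

text \<open>In each term \<open>f z * f z powr (p - 1)\<close> the second factor is enlarged to the
  power of the whole sum, which needs \<open>1 \<le> p\<close>.\<close>

lemma sum_powr_le_powr_sum:
  fixes f :: "'b \<Rightarrow> real"
  assumes "finite B" "\<And>z. z \<in> B \<Longrightarrow> 0 \<le> f z" "1 \<le> p"
  shows "(\<Sum>z\<in>B. f z powr p) \<le> (\<Sum>z\<in>B. f z) powr p"
proof -
  let ?s = "\<Sum>z\<in>B. f z"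
  have s: "0 \<le> ?s" by (simp add: assms(2) sum_nonneg)
  have "(\<Sum>z\<in>B. f z powr p) \<le> (\<Sum>z\<in>B. f z * ?s powr (p - 1))"
  proof (rule sum_mono)
    fix z assume z: "z \<in> B"
    have "f z \<le> ?s" using assms z by (intro member_le_sum) auto
    have "f z powr p = f z * f z powr (p - 1)"
      using assms(2)[OF z] powr_mult_base[of "f z" "p - 1"] by simp
    also have "\<dots> \<le> f z * ?s powr (p - 1)"
      using assms(2)[OF z] assms(3) \<open>f z \<le> ?s\<close> by (intro mult_left_mono powr_mono2) auto
    finally show "f z powr p \<le> f z * ?s powr (p - 1)" .
  qed
  also have "\<dots> = ?s * ?s powr (p - 1)" by (simp add: sum_distrib_right)
  also have "\<dots> = ?s powr p" using s powr_mult_base[of ?s "p - 1"] by simp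
  finally show ?thesis .
qed

lemma (in wtree) sum_crossing_powr_le:
  assumes "finite B" "\<And>z. z \<in> B \<Longrightarrow> z \<noteq> rt \<and> (x \<in> ch z) \<noteq> (y \<in> ch z)" "1 \<le> p"
  shows "(\<Sum>z\<in>B. tree_dist E w z (par z) powr p) \<le> tree_dist E w x y powr p"
proof -
  have "(\<Sum>z\<in>B. tree_dist E w z (par z) powr p) \<le> (\<Sum>z\<in>B. tree_dist E w z (par z)) powr p"
    using assms by (intro sum_powr_le_powr_sum) auto
  also have "\<dots> \<le> tree_dist E w x y powr p"
    using assms by (intro powr_mono2 sum_crossing_le_dist) (auto intro: sum_nonneg)
  finally show ?thesis .
qed

section \<open>Transport cost and the truncated functional: lower bound\<close>

lemma nn_integral_delta:
  "(\<integral>\<^sup>+y. (if y = z then f y else 0) \<partial>count_space UNIV) = f z"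
  by (subst nn_integral_count_space'[where A = "{z}"]) auto

text \<open>The kernel value \<open>k x y\<close> is the mass shipped from \<open>x\<close> to
  \<open>y\<close>; the rest stays on the diagonal at cost 0. \<open>outflow_le\<close> makes this
  rest nonnegative and yields the marginal \<eta>, \<open>balance\<close> yields \<theta>. The
  balance is written with sums only, since subtraction in \<open>ennreal\<close> truncates at
  0.\<close>

lemma transport_plan:
  fixes \<eta> \<theta> :: "'a pmf" and k :: "'a \<Rightarrow> 'a \<Rightarrow> ennreal" and c :: "'a \<Rightarrow> 'a \<Rightarrow> ennreal"
  defines "outflow \<equiv> \<lambda>x. \<integral>\<^sup>+y. k x y \<partial>count_space UNIV"
    and "inflow \<equiv> \<lambda>y. \<integral>\<^sup>+x. k x y \<partial>count_space UNIV"
  assumes outflow_le: "\<And>x. outflow x \<le> ennreal (pmf \<eta> x)"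
    and balance: "\<And>x. ennreal (pmf \<theta> x) + outflow x = ennreal (pmf \<eta> x) + inflow x"
    and diag: "\<And>x. c x x = 0"
  shows "\<exists>q\<in>couplings \<eta> \<theta>. (\<integral>\<^sup>+(x, y). c x y \<partial>measure_pmf q)
           = (\<integral>\<^sup>+x. \<integral>\<^sup>+y. k x y * c x y \<partial>count_space UNIV \<partial>count_space UNIV)"
proof -
  define stay where "stay x = ennreal (pmf \<eta> x) - outflow x" for x
  define W where "W z = k (fst z) (snd z) + (if snd z = fst z then stay (fst z) else 0)" for z
  have out_eq: "integral\<^sup>N (count_space UNIV) (k x) = outflow x" for x
    by (simp add: outflow_def)
  have in_eq: "(\<integral>\<^sup>+x. k x y \<partial>count_space UNIV) = inflow y" for y
    by (simp add: inflow_def)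
  have k_le: "k x y \<le> outflow x" for x y
    unfolding outflow_def by (rule nn_integral_ge_point) simp
  have out_fin: "outflow x < \<top>" for x
    using le_less_trans[OF outflow_le[of x]] by simp
  have W_pair: "W (x, y) = k x y + (if y = x then stay x else 0)" for x y
    by (simp add: W_def)
  \<comment> \<open>Finiteness permits the passage to reals and back that \<open>embed_pmf\<close>
    involves.\<close>
  have fin: "W z < \<top>" for z
    unfolding W_def stay_def using le_less_trans[OF k_le out_fin]
    by (auto intro!: ennreal_add_eq_top[THEN iffD1] simp: ennreal_minus_if less_top[symmetric])
  define q where "q = embed_pmf (\<lambda>z. enn2real (W z))"
  have eW: "ennreal (enn2real (W z)) = W z" for z
    using fin by (simp add: less_top)
  have row: "(\<integral>\<^sup>+y. W (x, y) \<partial>count_space UNIV) = ennreal (pmf \<eta> x)" for x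
    by (simp add: W_pair nn_integral_add nn_integral_delta out_eq)
       (simp add: stay_def add.commute[of "outflow x"] diff_add_cancel_ennreal outflow_le)
  have col: "(\<integral>\<^sup>+x. W (x, y) \<partial>count_space UNIV) = ennreal (pmf \<theta> y)" for y
  proof -
    have "(\<integral>\<^sup>+x. (if y = x then stay x else 0) \<partial>count_space UNIV)
        = (\<integral>\<^sup>+x. (if x = y then stay x else 0) \<partial>count_space UNIV)"
      by (intro nn_integral_cong) auto
    then have "(\<integral>\<^sup>+x. W (x, y) \<partial>count_space UNIV) = inflow y + stay y"
      by (simp add: W_pair nn_integral_add in_eq nn_integral_delta)
    also have "\<dots> = (ennreal (pmf \<eta> y) + inflow y) - outflow y"
      unfolding stay_def by (simp only: add_diff_eq_ennreal[OF outflow_le] add.commute)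
    also have "\<dots> = ennreal (pmf \<theta> y)"
      unfolding balance[symmetric] using out_fin[of y]
      by (intro ennreal_add_diff_cancel_right) (simp add: less_top)
    finally show ?thesis .
  qed
  have total: "(\<integral>\<^sup>+z. ennreal (enn2real (W z)) \<partial>count_space UNIV) = 1"
    unfolding eW by (subst nn_integral_fst_count_space[symmetric]) (simp add: row nn_integral_pmf)
  have pmf_q: "ennreal (pmf q z) = W z" for z
    unfolding q_def by (subst pmf_embed_pmf[OF _ total]) (simp_all add: eW)
  have q_int: "(\<integral>\<^sup>+z. f z \<partial>measure_pmf q) = (\<integral>\<^sup>+x. \<integral>\<^sup>+y. W (x, y) * f (x, y) \<partial>count_space UNIV \<partial>count_space UNIV)"
    for f :: "'a \<times> 'a \<Rightarrow> ennreal"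
    unfolding nn_integral_measure_pmf pmf_q
    by (rule nn_integral_fst_count_space[of "\<lambda>z. W z * f z", symmetric])
  have q_int': "(\<integral>\<^sup>+z. f z \<partial>measure_pmf q) = (\<integral>\<^sup>+y. \<integral>\<^sup>+x. W (x, y) * f (x, y) \<partial>count_space UNIV \<partial>count_space UNIV)"
    for f :: "'a \<times> 'a \<Rightarrow> ennreal"
    unfolding nn_integral_measure_pmf pmf_q
    by (rule nn_integral_snd_count_space[of "\<lambda>z. W z * f z", symmetric])
  have "map_pmf fst q = \<eta>"
  proof (rule pmf_eqI)
    fix x
    have "ennreal (pmf (map_pmf fst q) x)
        = (\<integral>\<^sup>+x'. \<integral>\<^sup>+y. W (x', y) * indicator (fst -` {x}) (x', y) \<partial>count_space UNIV \<partial>count_space UNIV)"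
      unfolding ennreal_pmf_map q_int ..
    also have "\<dots> = (\<integral>\<^sup>+x'. (if x' = x then \<integral>\<^sup>+y. W (x', y) \<partial>count_space UNIV else 0) \<partial>count_space UNIV)"
      by (intro nn_integral_cong) auto
    also have "\<dots> = ennreal (pmf \<eta> x)"
      unfolding nn_integral_delta row ..
    finally show "pmf (map_pmf fst q) x = pmf \<eta> x" by simp
  qed
  moreover have "map_pmf snd q = \<theta>"
  proof (rule pmf_eqI)
    fix x
    have "ennreal (pmf (map_pmf snd q) x)
        = (\<integral>\<^sup>+y. \<integral>\<^sup>+x'. W (x', y) * indicator (snd -` {x}) (x', y) \<partial>count_space UNIV \<partial>count_space UNIV)"
      unfolding ennreal_pmf_map q_int' ..
    also have "\<dots> = (\<integral>\<^sup>+y. (if y = x then \<integral>\<^sup>+x'. W (x', y) \<partial>count_space UNIV else 0) \<partial>count_space UNIV)"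
      by (intro nn_integral_cong) auto
    also have "\<dots> = ennreal (pmf \<theta> x)"
      unfolding nn_integral_delta col ..
    finally show "pmf (map_pmf snd q) x = pmf \<theta> x" by simp
  qed
  moreover have "(\<integral>\<^sup>+(x, y). c x y \<partial>measure_pmf q)
      = (\<integral>\<^sup>+x. \<integral>\<^sup>+y. k x y * c x y \<partial>count_space UNIV \<partial>count_space UNIV)"
    unfolding q_int by (intro nn_integral_cong) (auto simp: W_def diag)
  ultimately show ?thesis unfolding couplings_def by blast
qed

lemma integral_pmf_count_space:
  fixes f :: "'a \<Rightarrow> real"
  shows "(\<integral>x. f x \<partial>measure_pmf \<eta>) = (\<integral>x. pmf \<eta> x * f x \<partial>count_space UNIV)"
    and "integrable (measure_pmf \<eta>) f \<longleftrightarrow> integrable (count_space UNIV) (\<lambda>x. pmf \<eta> x * f x)"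
  by (simp_all add: measure_pmf_eq_density integral_real_density integrable_real_density)

section \<open>Finite subtrees and the dual lower bound\<close>

context wtree
begin

abbreviation "td \<equiv> tree_dist E w"

text \<open>Edges are indexed by their lower endpoint, so that sums over edges become sums over
  vertices. The root contributes 0, being its own parent.\<close>

definition ecost :: "real \<Rightarrow> 'a \<Rightarrow> real" where
  "ecost p z = td z (par z) powr p"

text \<open>Closure under \<open>par\<close> makes \<open>A\<close> a subtree, so mass can move
  between nodes of \<open>A\<close> along edges of \<open>A\<close>.\<close>

definition rooted_part :: "'a set \<Rightarrow> bool" where
  "rooted_part A \<longleftrightarrow> finite A \<and> rt \<in> A \<and> par ` A \<subseteq> A"

definition trunc_S :: "'a set \<Rightarrow> ('a \<Rightarrow> real) \<Rightarrow> 'a \<Rightarrow> real" where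
  "trunc_S A u z = (\<Sum>x\<in>A \<inter> ch z. u x)"

text \<open>A finite version of the p-th power of \<open>tree_Z\<close>. Without the root it is
  homogeneous of degree one, and scale factors pass through.\<close>

definition trunc_Z :: "real \<Rightarrow> 'a set \<Rightarrow> ('a \<Rightarrow> real) \<Rightarrow> real" where
  "trunc_Z p A u = (\<Sum>z\<in>A. ecost p z * \<bar>trunc_S A u z\<bar>)"

text \<open>Values are taken in \<open>ennreal\<close>, as the argument may be a difference of
  measures without finite moments.\<close>

definition tail :: "real \<Rightarrow> 'a set \<Rightarrow> ('a \<Rightarrow> real) \<Rightarrow> ennreal" where
  "tail p A u = (\<integral>\<^sup>+x. ennreal (td x rt powr p * \<bar>u x\<bar>) \<partial>count_space (- A))"

lemma ecost_root [simp]: "ecost p rt = 0"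
  by (simp add: ecost_def)

lemma ecost_nonneg [simp]: "0 \<le> ecost p z"
  by (simp add: ecost_def)

lemma trunc_S_indicator:
  assumes "finite A"
  shows "trunc_S A u z = (\<Sum>x\<in>A. indicator (ch z) x * u x)"
  unfolding trunc_S_def sum.inter_restrict[OF assms]
  by (rule sum.cong) (simp_all add: indicator_def)

lemma trunc_Z_nonneg: "0 \<le> trunc_Z p A u"
  unfolding trunc_Z_def by (intro sum_nonneg) auto

lemma rooted_partD:
  assumes "rooted_part A"
  shows "finite A" "rt \<in> A" "x \<in> A \<Longrightarrow> par x \<in> A"
  using assms by (auto simp: rooted_part_def)

lemma rooted_part_ancestor:
  assumes "rooted_part A" "x \<in> A" "x \<in> ch z"
  shows "z \<in> A"
  using assms(2,3)
proof (induction x rule: tree_path_induct)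
  case root
  then show ?case by (simp add: root_children)
next
  case (step x)
  then show ?case using children_rec[of x z] rooted_partD[OF assms(1)] by blast
qed

lemma children_root: "ch rt = UNIV"
proof -
  have "x \<in> ch rt" for x
  proof (induction x rule: tree_path_induct)
    case (step x)
    then show ?case using children_rec[of x rt] by blast
  qed simp
  then show ?thesis by blast
qed

text \<open>Superadditivity in the form of a Lipschitz estimate: it bounds the increments of every
  potential that is a signed sum of \<open>ecost\<close> over ancestors.\<close>

lemma sum_ecost_crossing_le:
  assumes "finite A" "1 \<le> p"
  shows "(\<Sum>z\<in>A. ecost p z * \<bar>indicator (ch z) x - indicator (ch z) y\<bar>) \<le> td x y powr p"
proof -
  let ?B = "{z \<in> A. z \<noteq> rt \<and> (x \<in> ch z) \<noteq> (y \<in> ch z)}"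
  have "(\<Sum>z\<in>A. ecost p z * \<bar>indicator (ch z) x - indicator (ch z) y\<bar>) = (\<Sum>z\<in>?B. ecost p z)"
    using assms(1) by (intro sum.mono_neutral_cong_right) (auto simp: indicator_def)
  also have "\<dots> \<le> td x y powr p"
    unfolding ecost_def using assms by (intro sum_crossing_powr_le) auto
  finally show ?thesis .
qed

lemma sum_ecost_ancestors_le:
  assumes "finite A" "1 \<le> p"
  shows "(\<Sum>z\<in>A. ecost p z * indicator (ch z) x) \<le> td x rt powr p"
proof -
  have "(\<Sum>z\<in>A. ecost p z * indicator (ch z) x)
      \<le> (\<Sum>z\<in>A. ecost p z * \<bar>indicator (ch z) x - indicator (ch z) rt\<bar>)"
    by (intro sum_mono) (auto simp: indicator_def root_children)
  also have "\<dots> \<le> td x rt powr p" using assms by (rule sum_ecost_crossing_le)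
  finally show ?thesis .
qed

lemma trunc_Z_le_cost:
  assumes A: "rooted_part A" and p: "1 \<le> p" and q: "q \<in> couplings \<eta> \<theta>"
  defines "u \<equiv> \<lambda>x. pmf \<eta> x - pmf \<theta> x"
  shows "ennreal (trunc_Z p A u) \<le> (\<integral>\<^sup>+(x, y). ennreal (td x y powr p) \<partial>measure_pmf q) + tail p A u"
proof -
  note fin = rooted_partD(1)[OF A]
  \<comment> \<open>The potential. On the way from the root down to \<open>x\<close> it changes by
    the signed \<open>ecost\<close> of each edge of \<open>A\<close>; with these signs its pairing
    with \<open>u\<close> on \<open>A\<close> becomes a sum of absolute values.\<close>
  define f where "f x = (\<Sum>z\<in>A. sgn (trunc_S A u z) * ecost p z * indicator (ch z) x)" for x
  have lip: "\<bar>f x - f y\<bar> \<le> td x y powr p" for x y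
  proof -
    have "\<bar>f x - f y\<bar> = \<bar>\<Sum>z\<in>A. sgn (trunc_S A u z) * ecost p z * (indicator (ch z) x - indicator (ch z) y)\<bar>"
      unfolding f_def sum_subtractf[symmetric] by (simp add: algebra_simps)
    also have "\<dots> \<le> (\<Sum>z\<in>A. \<bar>sgn (trunc_S A u z) * ecost p z * (indicator (ch z) x - indicator (ch z) y)\<bar>)"
      by (rule sum_abs)
    also have "\<dots> \<le> (\<Sum>z\<in>A. ecost p z * \<bar>indicator (ch z) x - indicator (ch z) y\<bar>)"
      by (intro sum_mono) (auto simp: abs_mult sgn_real_def)
    also have "\<dots> \<le> td x y powr p" using fin p by (rule sum_ecost_crossing_le)
    finally show ?thesis .
  qed
  \<comment> \<open>Only the root has the root as a descendant, and its \<open>ecost\<close> is 0.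
    The Lipschitz bound from the root then controls \<open>f\<close> outside \<open>A\<close>, which
    is how the tail enters.\<close>
  have "f rt = 0"
    unfolding f_def by (rule sum.neutral) (auto simp: root_children indicator_def)
  with lip[of _ rt] have f_le: "\<bar>f x\<bar> \<le> td x rt powr p" for x by simp
  \<comment> \<open>As \<open>A\<close> is finite, \<open>f\<close> is bounded and hence integrable
    for every pmf, with or without moments.\<close>
  have f_bdd: "\<bar>f x\<bar> \<le> (\<Sum>z\<in>A. ecost p z)" for x
  proof -
    have "\<bar>f x\<bar> \<le> (\<Sum>z\<in>A. \<bar>sgn (trunc_S A u z) * ecost p z * indicator (ch z) x\<bar>)"
      unfolding f_def by (rule sum_abs)
    also have "\<dots> \<le> (\<Sum>z\<in>A. ecost p z)"
      by (intro sum_mono) (auto simp: abs_mult sgn_real_def indicator_def)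
    finally show ?thesis .
  qed
  have int_f: "integrable (measure_pmf \<nu>) (\<lambda>x. f (g x))" for \<nu> :: "'b pmf" and g
    by (rule measure_pmf.integrable_const_bound[where B = "\<Sum>z\<in>A. ecost p z"]) (simp_all add: f_bdd)
  have marg: "\<eta> = map_pmf fst q" "\<theta> = map_pmf snd q"
    using q by (auto simp: couplings_def)
  define D where "D = (\<integral>x. f x \<partial>measure_pmf \<eta>) - (\<integral>x. f x \<partial>measure_pmf \<theta>)"
  have "D = (\<integral>z. f (fst z) - f (snd z) \<partial>measure_pmf q)"
    unfolding D_def marg integral_map_pmf by (rule Bochner_Integration.integral_diff[symmetric]) (rule int_f)+
  then have "ennreal \<bar>D\<bar> \<le> (\<integral>\<^sup>+z. ennreal (norm (f (fst z) - f (snd z))) \<partial>measure_pmf q)"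
    using integral_norm_bound_ennreal[OF Bochner_Integration.integrable_diff[OF int_f int_f], of q fst snd]
    by simp
  also have "\<dots> \<le> (\<integral>\<^sup>+(x, y). ennreal (td x y powr p) \<partial>measure_pmf q)"
    by (intro nn_integral_mono) (auto split: prod.split intro!: ennreal_leI lip)
  finally have D_le: "ennreal \<bar>D\<bar> \<le> (\<integral>\<^sup>+(x, y). ennreal (td x y powr p) \<partial>measure_pmf q)" .
  have i1: "integrable (count_space UNIV) (\<lambda>x. pmf \<nu> x * f x)" for \<nu>
    using int_f[of \<nu> "\<lambda>x. x"] unfolding integral_pmf_count_space(2) .
  have int_u: "integrable (count_space UNIV) (\<lambda>x. u x * f x)"
    using Bochner_Integration.integrable_diff[OF i1[of \<eta>] i1[of \<theta>]] by (simp add: u_def algebra_simps)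
  have D_u: "D = (\<integral>x. u x * f x \<partial>count_space UNIV)"
    unfolding D_def integral_pmf_count_space(1) u_def
    by (subst Bochner_Integration.integral_diff[symmetric, OF i1 i1]) (simp add: algebra_simps)
  \<comment> \<open>Vertices outside \<open>A\<close> still feel \<open>f\<close> through their
    ancestors in \<open>A\<close>; \<open>T\<close> collects their share.\<close>
  define T where "T = (\<integral>x. indicator (- A) x * (u x * f x) \<partial>count_space UNIV)"
  have iA: "integrable (count_space UNIV) (\<lambda>x. indicator B x * (u x * f x))" for B
    using integrable_real_mult_indicator[OF _ int_u, of B] by (simp add: mult.commute)
  have "(\<integral>x. indicator A x * (u x * f x) \<partial>count_space UNIV) = (\<Sum>x\<in>A. u x * f x)"
    using fin by (subst lebesgue_integral_count_space_finite_support)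
      (auto intro!: sum.mono_neutral_cong_left elim: finite_subset[rotated] simp: indicator_def)
  moreover have "D = (\<integral>x. indicator A x * (u x * f x) \<partial>count_space UNIV) + T"
    unfolding D_u T_def
    by (subst Bochner_Integration.integral_add[symmetric, OF iA iA])
       (auto intro!: Bochner_Integration.integral_cong simp: indicator_def)
  ultimately have D_sum: "D = (\<Sum>x\<in>A. u x * f x) + T" by simp
  have "(\<Sum>x\<in>A. u x * f x) = (\<Sum>z\<in>A. \<Sum>x\<in>A. sgn (trunc_S A u z) * ecost p z * (indicator (ch z) x * u x))"
    unfolding f_def sum_distrib_left by (subst sum.swap) (simp add: mult_ac)
  also have "\<dots> = (\<Sum>z\<in>A. sgn (trunc_S A u z) * ecost p z * trunc_S A u z)"
    by (simp add: trunc_S_indicator[OF fin] sum_distrib_left)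
  also have "\<dots> = trunc_Z p A u"
    unfolding trunc_Z_def by (intro sum.cong) (auto simp: abs_sgn mult_ac)
  finally have Z_eq: "trunc_Z p A u = D - T" using D_sum by simp
  have "ennreal \<bar>T\<bar> \<le> (\<integral>\<^sup>+x. ennreal (norm (indicator (- A) x * (u x * f x))) \<partial>count_space UNIV)"
    unfolding T_def using integral_norm_bound_ennreal[OF iA[of "- A"]] by simp
  also have "\<dots> \<le> (\<integral>\<^sup>+x. ennreal (td x rt powr p * \<bar>u x\<bar>) * indicator (- A) x \<partial>count_space UNIV)"
    using f_le by (intro nn_integral_mono)
      (auto simp: indicator_def abs_mult mult.commute[of "\<bar>u _\<bar>"] intro!: ennreal_leI mult_right_mono)
  also have "\<dots> = tail p A u"
    unfolding tail_def by (simp add: nn_integral_count_space_indicator)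
  finally have T_le: "ennreal \<bar>T\<bar> \<le> tail p A u" .
  have "ennreal (trunc_Z p A u) \<le> ennreal (\<bar>D\<bar> + \<bar>T\<bar>)"
    unfolding Z_eq by (intro ennreal_leI) auto
  also have "\<dots> = ennreal \<bar>D\<bar> + ennreal \<bar>T\<bar>" by simp
  also have "\<dots> \<le> (\<integral>\<^sup>+(x, y). ennreal (td x y powr p) \<partial>measure_pmf q) + tail p A u"
    by (intro add_mono D_le T_le)
  finally show ?thesis .
qed

lemma children_trans: "x \<in> ch y \<Longrightarrow> y \<in> ch z \<Longrightarrow> x \<in> ch z"
proof (induction x rule: tree_path_induct)
  case root
  then show ?case by (simp add: root_children)
next
  case (step x)
  then show ?case using children_rec[of x y] children_rec[of x z] by blast
qed

lemma children_split:
  assumes A: "rooted_part A" and v: "v \<in> A" "v \<in> ch x" "v \<noteq> x"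
  shows "\<exists>y\<in>A. y \<noteq> rt \<and> par y = x \<and> v \<in> ch y"
  using v
proof (induction v rule: tree_path_induct)
  case root
  then show ?case by (simp add: root_children)
next
  case (step v)
  show ?case
  proof (cases "par v = x")
    case True
    then show ?thesis using step by (intro bexI[of _ v]) auto
  next
    case False
    then obtain y where "y \<in> A" "y \<noteq> rt" "par y = x" "par v \<in> ch y"
      using step children_rec[of v x] rooted_partD(3)[OF A] by blast
    then show ?thesis using children_rec[of v y] by blast
  qed
qed

text \<open>The part of \<open>A\<close> below \<open>x\<close> consists of \<open>x\<close> and the
  disjoint parts below its children. Read as a flow over edges, this is the conservation law at
  \<open>x\<close> that makes the coupling below balance.\<close>

lemma trunc_S_rec:
  assumes A: "rooted_part A" and x: "x \<in> A"
  shows "trunc_S A u x = u x + (\<Sum>y | y \<in> A \<and> y \<noteq> rt \<and> par y = x. trunc_S A u y)"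
proof -
  let ?C = "{y. y \<in> A \<and> y \<noteq> rt \<and> par y = x}"
  note fin = rooted_partD(1)[OF A]
  have sub: "v \<in> ch x" if "y \<in> ?C" "v \<in> ch y" for v y
    using that children_trans[of v y x] children_rec[of y x] by auto
  have "A \<inter> ch x = insert x (\<Union>y\<in>?C. A \<inter> ch y)"
    using x sub by (auto dest: children_split[OF A])
  then have "trunc_S A u x = sum u (insert x (\<Union>y\<in>?C. A \<inter> ch y))"
    by (simp add: trunc_S_def)
  also have "\<dots> = u x + sum u (\<Union>y\<in>?C. A \<inter> ch y)"
    using fin parent_not_children by (intro sum.insert) auto
  also have "sum u (\<Union>y\<in>?C. A \<inter> ch y) = (\<Sum>y\<in>?C. sum u (A \<inter> ch y))"
    using fin siblings_disjoint by (intro sum.UNION_disjoint) auto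
  finally show ?thesis by (simp add: trunc_S_def)
qed

end

section \<open>Upper bound by an explicit coupling\<close>

lemma count_space_indicator_finite:
  fixes f :: "'b \<Rightarrow> real"
  assumes "finite A"
  shows "integrable (count_space UNIV) (\<lambda>x. indicator A x * f x)"
    and "(\<integral>x. indicator A x * f x \<partial>count_space UNIV) = (\<Sum>x\<in>A. f x)"
proof -
  have "Infinite_Set_Sum.abs_summable_on f A" using assms by simp
  then show "integrable (count_space UNIV) (\<lambda>x. indicator A x * f x)"
    by (simp add: abs_summable_on_altdef set_integrable_def)
  show "(\<integral>x. indicator A x * f x \<partial>count_space UNIV) = (\<Sum>x\<in>A. f x)"
    using infsetsum_finite[OF assms, of f] by (simp add: infsetsum_altdef set_lebesgue_integral_def)
qed

text \<open>Twice the total variation distance. It bounds the flow over every edge at once, whatever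
  the shape of the tree.\<close>

definition l1dist :: "'b pmf \<Rightarrow> 'b pmf \<Rightarrow> ennreal" where
  "l1dist \<eta> \<theta> = (\<integral>\<^sup>+x. ennreal \<bar>pmf \<eta> x - pmf \<theta> x\<bar> \<partial>count_space UNIV)"

context wtree
begin

text \<open>The quantity in \<open>wasserstein\<close> before \<open>enn2real\<close> and the root,
  so that an infinite cost stays visible.\<close>

definition wcost :: "real \<Rightarrow> 'a pmf \<Rightarrow> 'a pmf \<Rightarrow> ennreal" where
  "wcost p \<eta> \<theta> = (INF q\<in>couplings \<eta> \<theta>. \<integral>\<^sup>+(x, y). ennreal (td x y powr p) \<partial>measure_pmf q)"

text \<open>The tail does not depend on the coupling, so it is subtracted before the infimum is
  taken. If it is infinite, the difference is 0 and the bound is trivial.\<close>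

lemma trunc_Z_le_wcost:
  assumes "rooted_part A" "1 \<le> p"
  shows "ennreal (trunc_Z p A (\<lambda>x. pmf \<eta> x - pmf \<theta> x)) \<le> wcost p \<eta> \<theta> + tail p A (\<lambda>x. pmf \<eta> x - pmf \<theta> x)"
proof -
  let ?u = "\<lambda>x. pmf \<eta> x - pmf \<theta> x"
  have "ennreal (trunc_Z p A ?u) - tail p A ?u \<le> wcost p \<eta> \<theta>"
    unfolding wcost_def
  proof (rule INF_greatest)
    fix q assume "q \<in> couplings \<eta> \<theta>"
    from trunc_Z_le_cost[OF assms this]
    show "ennreal (trunc_Z p A ?u) - tail p A ?u \<le> (\<integral>\<^sup>+(x, y). ennreal (td x y powr p) \<partial>measure_pmf q)"
      by (cases "tail p A ?u = \<top>") (auto simp: ennreal_minus_le_iff add.commute)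
  qed
  then show ?thesis
    by (cases "tail p A ?u = \<top>") (auto simp: ennreal_minus_le_iff add.commute)
qed

text \<open>When \<open>\<eta>\<close> and \<open>\<theta>\<close> are close, the nodes of \<open>A\<close> have enough mass to
  move all the surpluses at once along the edges inside \<open>A\<close>, and directly
  between the root and the nodes outside \<open>A\<close>.\<close>

lemma wcost_le_trunc_Z:
  assumes A: "rooted_part A" and p: "1 \<le> p"
    and close: "\<And>x. x \<in> A \<Longrightarrow> of_nat (card A + 2) * l1dist \<eta> \<theta> \<le> ennreal (pmf \<eta> x)"
  defines "u \<equiv> \<lambda>x. pmf \<eta> x - pmf \<theta> x"
  shows "wcost p \<eta> \<theta> \<le> ennreal (trunc_Z p A u) + tail p A u"
proof -
  let ?cs = "count_space (UNIV :: 'a set)"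
  note fin = rooted_partD(1)[OF A] and rtA = rooted_partD(2)[OF A] and parA = rooted_partD(3)[OF A]
  define h where "h x = pmf \<theta> x - pmf \<eta> x" for x
  define D where "D = l1dist \<eta> \<theta>"
  have uh: "u = (\<lambda>x. - h x)" by (simp add: u_def h_def)
  have D_h: "D = (\<integral>\<^sup>+x. ennreal \<bar>h x\<bar> \<partial>?cs)"
    by (simp add: D_def l1dist_def h_def abs_minus_commute)
  have int_h: "integrable ?cs h"
    unfolding h_def by (intro Bochner_Integration.integrable_diff integrable_pmf)
  have tot_h: "(\<integral>x. h x \<partial>?cs) = 0"
    unfolding h_def by (subst Bochner_Integration.integral_diff) (auto simp: integrable_pmf integral_pmf)
  \<comment> \<open>The net amount that has to pass from \<open>t x\<close> to \<open>x\<close>: the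
    deficit of the part of \<open>A\<close> below \<open>x\<close> for \<open>x\<close> in
    \<open>A\<close>, and the deficit of \<open>x\<close> alone otherwise. A negative value means
    transport from \<open>x\<close> to \<open>t x\<close>.\<close>
  define a where "a x = (if x \<in> A then trunc_S A h x else h x)" for x
  define t where "t x = (if x \<in> A then par x else rt)" for x
  define g where "g x y = (if y \<noteq> rt \<and> x = t y then a y else 0)" for x y
  \<comment> \<open>The negative part of \<open>a x\<close> travels from \<open>x\<close> to
    \<open>t x\<close>, the positive part of \<open>a y\<close> from \<open>t y\<close> to
    \<open>y\<close>.\<close>
  define k where "k x y = (if y = t x then (if x \<noteq> rt then ennreal (- a x) else 0) else 0) + ennreal (g x y)" for x y
  have S_le: "ennreal \<bar>trunc_S A h x\<bar> \<le> D" for x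
  proof -
    have "ennreal \<bar>trunc_S A h x\<bar> \<le> ennreal (\<Sum>x\<in>A \<inter> ch x. \<bar>h x\<bar>)"
      unfolding trunc_S_def by (intro ennreal_leI sum_abs)
    also have "\<dots> = (\<Sum>x\<in>A \<inter> ch x. ennreal \<bar>h x\<bar>)" by simp
    also have "\<dots> = (\<integral>\<^sup>+x. ennreal \<bar>h x\<bar> \<partial>count_space (A \<inter> ch x))"
      using fin by (simp add: nn_integral_count_space_finite)
    also have "\<dots> \<le> D"
      unfolding D_h by (simp add: nn_integral_count_space_indicator) 
        (intro nn_integral_mono, auto simp: indicator_def)
    finally show ?thesis .
  qed
  have tail_le: "(\<integral>\<^sup>+x. ennreal \<bar>h x\<bar> * indicator (- A) x \<partial>?cs) \<le> D"
    unfolding D_h by (intro nn_integral_mono) (auto simp: indicator_def)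
  have int_gA: "integrable ?cs (\<lambda>y. indicator A y * g x y)" for x
    by (rule count_space_indicator_finite(1)[OF fin])
  have int_gB: "integrable ?cs (\<lambda>y. indicator (- A) y * g x y)" for x
    by (rule Bochner_Integration.integrable_bound[OF int_h]) (auto simp: g_def a_def indicator_def)
  have split_g: "g x y = indicator A y * g x y + indicator (- A) y * g x y" for x y
    by (simp add: indicator_def)
  have int_g: "integrable ?cs (g x)" for x
    using Bochner_Integration.integrable_add[OF int_gA int_gB, of x x] by (simp add: split_g[symmetric])
  have sum_gA: "(\<integral>y. indicator A y * g x y \<partial>?cs) = (\<Sum>y | y \<in> A \<and> y \<noteq> rt \<and> par y = x. trunc_S A h y)" for x
  proof -
    have "(\<integral>y. indicator A y * g x y \<partial>?cs) = (\<Sum>y\<in>A. g x y)"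
      by (rule count_space_indicator_finite(2)[OF fin])
    also have "\<dots> = (\<Sum>y | y \<in> A \<and> y \<noteq> rt \<and> par y = x. trunc_S A h y)"
      using fin by (intro sum.mono_neutral_cong_right) (auto simp: g_def a_def t_def)
    finally show ?thesis .
  qed
  have S_root: "trunc_S A h rt = (\<Sum>x\<in>A. h x)"
    by (simp add: trunc_S_def children_root)
  \<comment> \<open>The root serves all vertices outside \<open>A\<close>. Since the deficits sum to
    0 by \<open>tot_h\<close>, the total of these possibly infinitely many flows is minus the
    deficit of \<open>A\<close>.\<close>
  have sum_gB: "(\<integral>y. indicator (- A) y * g x y \<partial>?cs) = (if x = rt then - trunc_S A h rt else 0)" for x
  proof (cases "x = rt")
    case False
    then have "(\<lambda>y. indicator (- A) y * g x y) = (\<lambda>_. 0)"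
      by (auto simp: g_def t_def indicator_def)
    then show ?thesis using False by simp
  next
    case True
    have ih: "integrable ?cs (\<lambda>y. indicator B y * h y)" for B
      using integrable_real_mult_indicator[OF _ int_h, of B] by (simp add: mult.commute)
    have "(\<integral>y. indicator A y * h y \<partial>?cs) + (\<integral>y. indicator (- A) y * h y \<partial>?cs) = (\<integral>y. h y \<partial>?cs)"
      by (subst Bochner_Integration.integral_add[symmetric, OF ih ih])
        (auto intro!: Bochner_Integration.integral_cong simp: indicator_def)
    moreover have "(\<integral>y. indicator A y * h y \<partial>?cs) = (\<Sum>x\<in>A. h x)"
      by (rule count_space_indicator_finite(2)[OF fin])
    moreover have "(\<lambda>y. indicator (- A) y * g x y) = (\<lambda>y. indicator (- A) y * h y)"
      using True rtA by (auto simp: g_def t_def a_def indicator_def)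
    ultimately show ?thesis using True tot_h S_root by simp
  qed
  \<comment> \<open>What \<open>x\<close> passes on is what it receives from \<open>t x\<close>
    minus its own deficit. Inside \<open>A\<close> this is \<open>trunc_S_rec\<close>; at the root
    the exchange with the outside cancels the total deficit of \<open>A\<close>, which leaves 0 as
    the flow from above.\<close>
  have sum_g: "(\<integral>y. g x y \<partial>?cs) = (if x = rt then 0 else a x) - h x" for x
  proof -
    have "(\<integral>y. g x y \<partial>?cs) = (\<integral>y. indicator A y * g x y \<partial>?cs) + (\<integral>y. indicator (- A) y * g x y \<partial>?cs)"
      by (subst Bochner_Integration.integral_add[symmetric, OF int_gA int_gB])
         (simp add: split_g[symmetric])
    also have "\<dots> = (if x = rt then 0 else a x) - h x"
    proof (cases "x \<in> A")
      case True
      then show ?thesis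
        unfolding sum_gA sum_gB using trunc_S_rec[OF A, of x h] by (cases "x = rt") (auto simp: a_def)
    next
      case False
      then have e: "{y. y \<in> A \<and> y \<noteq> rt \<and> par y = x} = {}" and "x \<noteq> rt"
        using parA rtA by auto
      then show ?thesis unfolding sum_gA sum_gB e using False by (simp add: a_def)
    qed
    finally show ?thesis .
  qed
  have out_eq: "(\<integral>\<^sup>+y. k x y \<partial>?cs) = (if x \<noteq> rt then ennreal (- a x) else 0) + (\<integral>\<^sup>+y. ennreal (g x y) \<partial>?cs)" for x
    unfolding k_def by (simp add: nn_integral_add nn_integral_delta)
  have in_eq: "(\<integral>\<^sup>+x. k x y \<partial>?cs) = (\<integral>\<^sup>+x. ennreal (- g y x) \<partial>?cs) + (if y \<noteq> rt then ennreal (a y) else 0)" for y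
  proof -
    have "(\<integral>\<^sup>+x. k x y \<partial>?cs) = (\<integral>\<^sup>+x. ennreal (- g y x) + (if x = t y then (if y \<noteq> rt then ennreal (a y) else 0) else 0) \<partial>?cs)"
      by (intro nn_integral_cong) (auto simp: k_def g_def)
    then show ?thesis by (simp add: nn_integral_add nn_integral_delta)
  qed
  define P where "P x = enn2real (\<integral>\<^sup>+y. ennreal (g x y) \<partial>?cs)" for x
  define Q where "Q x = enn2real (\<integral>\<^sup>+y. ennreal (- g x y) \<partial>?cs)" for x
  have P: "(\<integral>\<^sup>+y. ennreal (g x y) \<partial>?cs) = ennreal (P x)"
    and Q: "(\<integral>\<^sup>+y. ennreal (- g x y) \<partial>?cs) = ennreal (Q x)" for x
    using int_g[of x] unfolding P_def Q_def real_integrable_def by (simp_all add: less_top)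
  have PQ: "P x - Q x = (if x = rt then 0 else a x) - h x" "0 \<le> P x" "0 \<le> Q x" for x
    unfolding sum_g[symmetric] using real_lebesgue_integral_def[OF int_g[of x]] by (simp_all add: P_def Q_def)
  have balance: "ennreal (pmf \<theta> x) + (\<integral>\<^sup>+y. k x y \<partial>?cs) = ennreal (pmf \<eta> x) + (\<integral>\<^sup>+y. k y x \<partial>?cs)" for x
  proof -
    \<comment> \<open>With the value 0 at the root, the balance is the signed identity for
      \<open>P x - Q x\<close>, its terms sorted so that both sides are sums of nonnegative
      reals.\<close>
    define b where "b = (if x = rt then 0 else a x)"
    have b: "(if x \<noteq> rt then ennreal (- a x) else 0) = ennreal (max 0 (- b))"
      "(if x \<noteq> rt then ennreal (a x) else 0) = ennreal (max 0 b)"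
      by (auto simp: b_def max_def ennreal_neg)
    have "pmf \<theta> x + (max 0 (- b) + P x) = pmf \<eta> x + (Q x + max 0 b)"
      using PQ(1)[of x] by (auto simp: b_def h_def max_def split: if_splits)
    then have "ennreal (pmf \<theta> x + (max 0 (- b) + P x)) = ennreal (pmf \<eta> x + (Q x + max 0 b))"
      by (rule arg_cong)
    then show ?thesis
      unfolding out_eq in_eq P Q b using PQ(2,3)[of x] by simp
  qed
  \<comment> \<open>The constant \<open>card A + 2\<close> counts flows out of a node of
    \<open>A\<close>: one upwards, at most \<open>card A\<close> to nodes of \<open>A\<close>, and
    the joint flow to the outside, each at most the l1 distance. A vertex outside \<open>A\<close>
    gives away only its own surplus.\<close>
  have out_le: "(\<integral>\<^sup>+y. k x y \<partial>?cs) \<le> ennreal (pmf \<eta> x)" for x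
  proof (cases "x \<in> A")
    case True
    have "(\<integral>\<^sup>+y. ennreal (g x y) \<partial>?cs)
        \<le> (\<integral>\<^sup>+y. ennreal \<bar>trunc_S A h y\<bar> * indicator A y + ennreal \<bar>h y\<bar> * indicator (- A) y \<partial>?cs)"
      by (intro nn_integral_mono) (auto simp: g_def a_def indicator_def intro!: ennreal_leI)
    also have "\<dots> = (\<Sum>y\<in>A. ennreal \<bar>trunc_S A h y\<bar>) + (\<integral>\<^sup>+y. ennreal \<bar>h y\<bar> * indicator (- A) y \<partial>?cs)"
      using fin by (simp add: nn_integral_add nn_integral_count_space_indicator[symmetric] nn_integral_count_space_finite)
    also have "\<dots> \<le> (\<Sum>y\<in>A. D) + D"
      by (intro add_mono sum_mono S_le tail_le)
    finally have "(\<integral>\<^sup>+y. ennreal (g x y) \<partial>?cs) \<le> of_nat (card A) * D + D" by simp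
    moreover have "(if x \<noteq> rt then ennreal (- a x) else 0) \<le> D"
    proof -
      have "ennreal (- trunc_S A h x) \<le> ennreal \<bar>trunc_S A h x\<bar>" by (intro ennreal_leI) simp
      also have "\<dots> \<le> D" by (rule S_le)
      finally show ?thesis using True by (simp add: a_def)
    qed
    ultimately have "(\<integral>\<^sup>+y. k x y \<partial>?cs) \<le> D + (of_nat (card A) * D + D)"
      unfolding out_eq by (intro add_mono)
    also have "\<dots> = of_nat (card A + 2) * D" by (simp add: distrib_right algebra_simps mult_2)
    also have "\<dots> \<le> ennreal (pmf \<eta> x)" using close[OF True] by (simp add: D_def)
    finally show ?thesis .
  next
    case False
    then have "g x y = 0" for y using rtA parA by (auto simp: g_def t_def)
    then show ?thesis unfolding out_eq using False
      by (auto simp: a_def h_def intro!: ennreal_leI)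
  qed
  obtain q where q: "q \<in> couplings \<eta> \<theta>"
    "(\<integral>\<^sup>+(x, y). ennreal (td x y powr p) \<partial>measure_pmf q)
      = (\<integral>\<^sup>+x. \<integral>\<^sup>+y. k x y * ennreal (td x y powr p) \<partial>?cs \<partial>?cs)"
    using transport_plan[of k \<eta> \<theta> "\<lambda>x y. ennreal (td x y powr p)"] out_le balance by auto
  define c where "c x = (if x \<noteq> rt then ennreal (td x (t x) powr p) else 0)" for x
  \<comment> \<open>Downward flows are resummed by target instead of source, so that every vertex is
    charged once, with \<open>\<bar>a x\<bar>\<close> for its connection to
    \<open>t x\<close>.\<close>
  have "(\<integral>\<^sup>+x. \<integral>\<^sup>+y. k x y * ennreal (td x y powr p) \<partial>?cs \<partial>?cs)
      = (\<integral>\<^sup>+x. \<integral>\<^sup>+y. (if y = t x then ennreal (- a x) * c x else 0) \<partial>?cs \<partial>?cs)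
        + (\<integral>\<^sup>+x. \<integral>\<^sup>+y. (if x = t y then ennreal (a y) * c y else 0) \<partial>?cs \<partial>?cs)"
    by (subst nn_integral_add[symmetric], simp, simp, rule nn_integral_cong)
      (subst nn_integral_add[symmetric], simp, simp, rule nn_integral_cong,
        auto simp: k_def g_def c_def distrib_right tdist_commute)
  also have "(\<integral>\<^sup>+x. \<integral>\<^sup>+y. (if x = t y then ennreal (a y) * c y else 0) \<partial>?cs \<partial>?cs)
      = (\<integral>\<^sup>+y. \<integral>\<^sup>+x. (if x = t y then ennreal (a y) * c y else 0) \<partial>?cs \<partial>?cs)"
    using nn_integral_fst_count_space[of "\<lambda>(x, y). if x = t y then ennreal (a y) * c y else 0"]
      nn_integral_snd_count_space[of "\<lambda>(x, y). if x = t y then ennreal (a y) * c y else 0"] by simp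
  also have "(\<integral>\<^sup>+x. \<integral>\<^sup>+y. (if y = t x then ennreal (- a x) * c x else 0) \<partial>?cs \<partial>?cs)
      + (\<integral>\<^sup>+y. \<integral>\<^sup>+x. (if x = t y then ennreal (a y) * c y else 0) \<partial>?cs \<partial>?cs)
      = (\<integral>\<^sup>+x. ennreal (- a x) * c x + ennreal (a x) * c x \<partial>?cs)"
    by (simp add: nn_integral_delta nn_integral_add)
  also have "\<dots> = (\<integral>\<^sup>+x. ennreal (ecost p x * \<bar>trunc_S A u x\<bar>) * indicator A x
      + ennreal (td x rt powr p * \<bar>u x\<bar>) * indicator (- A) x \<partial>?cs)"
  proof (rule nn_integral_cong)
    fix x
    have "ennreal (- a x) + ennreal (a x) = ennreal \<bar>a x\<bar>"
      by (cases "a x \<ge> 0") (auto simp: ennreal_neg)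
    then have "ennreal (- a x) * c x + ennreal (a x) * c x = ennreal \<bar>a x\<bar> * c x"
      by (simp add: distrib_right[symmetric])
    also have "\<dots> = ennreal (ecost p x * \<bar>trunc_S A u x\<bar>) * indicator A x
      + ennreal (td x rt powr p * \<bar>u x\<bar>) * indicator (- A) x"
      using rtA by (auto simp: c_def a_def t_def uh trunc_S_def sum_negf ecost_def indicator_def 
          ennreal_mult[symmetric] mult.commute)
    finally show "ennreal (- a x) * c x + ennreal (a x) * c x = ennreal (ecost p x * \<bar>trunc_S A u x\<bar>) * indicator A x
      + ennreal (td x rt powr p * \<bar>u x\<bar>) * indicator (- A) x" .
  qed
  also have "\<dots> = (\<Sum>x\<in>A. ennreal (ecost p x * \<bar>trunc_S A u x\<bar>)) + tail p A u"
    using fin by (simp add: nn_integral_add nn_integral_count_space_indicator[symmetric]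
        nn_integral_count_space_finite tail_def)
  also have "\<dots> = ennreal (trunc_Z p A u) + tail p A u"
    unfolding trunc_Z_def by simp
  finally show ?thesis
    using q unfolding wcost_def by (intro INF_lower2[of q]) auto
qed

end

section \<open>Trigonometric approximation and central limit estimates\<close>

text \<open>Linear combinations of the characters of the vector of coordinates in \<open>A\<close>.
  Convergence of joint characteristic functions carries over to their means by linearity, and the
  class is closed under products because frequencies add.\<close>

inductive trig_poly :: "'a set \<Rightarrow> (('a \<Rightarrow> real) \<Rightarrow> complex) \<Rightarrow> bool" for A where
  cis: "trig_poly A (\<lambda>u. z * cis (\<Sum>x\<in>A. t x * u x))"
| add: "trig_poly A f \<Longrightarrow> trig_poly A g \<Longrightarrow> trig_poly A (\<lambda>u. f u + g u)"

lemma trig_poly_const: "trig_poly A (\<lambda>_. z)"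
  using trig_poly.cis[of A z "\<lambda>_. 0"] by simp

lemma trig_poly_cis_mult:
  assumes "trig_poly A f"
  shows "trig_poly A (\<lambda>u. (z * cis (\<Sum>x\<in>A. t x * u x)) * f u)"
  using assms
proof induction
  case (cis z' t')
  have "(\<lambda>u. (z * cis (\<Sum>x\<in>A. t x * u x)) * (z' * cis (\<Sum>x\<in>A. t' x * u x)))
      = (\<lambda>u. (z * z') * cis (\<Sum>x\<in>A. (t x + t' x) * u x))"
    by (simp add: distrib_right sum.distrib cis_mult[symmetric] mult.assoc mult.left_commute)
  then show ?case by (simp only: trig_poly.cis)
next
  case (add f g)
  then show ?case using trig_poly.add by (simp add: distrib_left)
qed

lemma trig_poly_mult:
  assumes "trig_poly A f" "trig_poly A g"
  shows "trig_poly A (\<lambda>u. f u * g u)"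
  using assms(1)
proof induction
  case (cis z t)
  then show ?case by (rule trig_poly_cis_mult[OF assms(2)])
next
  case (add f g)
  then show ?case using trig_poly.add by (simp add: distrib_right)
qed

lemma trig_poly_prod:
  assumes "finite B" "\<And>z. z \<in> B \<Longrightarrow> trig_poly A (f z)"
  shows "trig_poly A (\<lambda>u. \<Prod>z\<in>B. f z u)"
  using assms by (induction B rule: finite_induct) (auto intro: trig_poly_const trig_poly_mult)

lemma trig_poly_cos: "trig_poly A (\<lambda>u. complex_of_real (cos (\<Sum>x\<in>A. t x * u x)))"
proof -
  have "complex_of_real (cos s) = 1/2 * cis s + 1/2 * cis (- s)" for s
    by (simp add: complex_eq_iff)
  then have "(\<lambda>u. complex_of_real (cos (\<Sum>x\<in>A. t x * u x)))
      = (\<lambda>u. 1/2 * cis (\<Sum>x\<in>A. t x * u x) + 1/2 * cis (\<Sum>x\<in>A. (- t x) * u x))"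
    by (simp add: sum_negf)
  then show ?thesis by (simp only: trig_poly.add trig_poly.cis)
qed

lemma trig_poly_polynomial_cos:
  assumes "real_polynomial_function q"
  shows "trig_poly A (\<lambda>u. complex_of_real (q (cos (\<Sum>x\<in>A. t x * u x))))"
  using assms
proof induction
  case (linear f)
  then obtain c where "f = (\<lambda>x. x * c)" by (auto simp: real_bounded_linear)
  then show ?case
    using trig_poly_mult[OF trig_poly_cos trig_poly_const[of A "complex_of_real c"]] by simp
qed (auto intro: trig_poly_const trig_poly.add trig_poly_mult)

lemma trig_poly_measurable:
  assumes "trig_poly A f" "\<And>x. x \<in> A \<Longrightarrow> U x \<in> borel_measurable M"
  shows "(\<lambda>\<omega>. f (\<lambda>x. U x \<omega>)) \<in> borel_measurable M"
  using assms
proof induction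
  case (cis z t)
  have "(\<lambda>\<omega>. \<Sum>x\<in>A. t x * U x \<omega>) \<in> borel_measurable M"
    using cis by (intro borel_measurable_sum borel_measurable_times) auto
  moreover have "cis \<in> borel_measurable borel"
    by (intro borel_measurable_continuous_onI continuous_intros)
  ultimately show ?case by (intro borel_measurable_times) (auto intro: measurable_compose)
qed auto

lemma trig_poly_bounded: "trig_poly A f \<Longrightarrow> \<exists>b. \<forall>u. norm (f u) \<le> b"
proof (induction rule: trig_poly.induct)
  case (cis z t)
  then show ?case by (intro exI[of _ "norm z"]) (simp add: norm_mult)
next
  case (add f g)
  then obtain b1 b2 where "\<forall>u. norm (f u) \<le> b1" "\<forall>u. norm (g u) \<le> b2" by blast
  then show ?case by (intro exI[of _ "b1 + b2"]) (auto intro: norm_triangle_le add_mono)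
qed

text \<open>On \<open>[- K, K]\<close> the function \<open>cis (\<beta> * \<bar>s\<bar>)\<close> is a continuous
  function of \<open>cos (pi * s / K)\<close>, hence close to a polynomial in it.\<close>

lemma cis_abs_approx:
  fixes \<beta> \<epsilon> :: real
  assumes "0 < \<epsilon>"
  shows "\<exists>q1 q2 c. real_polynomial_function q1 \<and> real_polynomial_function q2 \<and>
    (\<forall>s. norm (Complex (q1 (cos (c * s))) (q2 (cos (c * s)))) \<le> 1) \<and>
    (\<forall>s. norm (Complex (q1 (cos (c * s))) (q2 (cos (c * s))) - cis (\<beta> * \<bar>s\<bar>)) \<le> \<epsilon> * (1 + \<bar>s\<bar>))"
proof -
  \<comment> \<open>Beyond \<open>K\<close> the trivial bound 2 on the difference equals
    \<open>\<epsilon> * K\<close>, which the factor \<open>1 + \<bar>s\<bar>\<close>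
    absorbs.\<close>
  define K where "K = 2 / \<epsilon>"
  define \<delta> where "\<delta> = \<epsilon> / 2"
  have pos: "0 < K" "0 < \<delta>" using assms by (auto simp: K_def \<delta>_def)
  \<comment> \<open>Chosen so that
    \<open>g (cos (pi * s / K)) = cis (\<beta> * \<bar>s\<bar>)\<close> for
    \<open>\<bar>s\<bar> \<le> K\<close>: the cosine is even and hence depends only on
    \<open>\<bar>s\<bar>\<close>.\<close>
  define g where "g v = cis (\<beta> * (K / pi) * arccos v)" for v
  have "continuous_on {-1..1} g"
    unfolding g_def by (intro continuous_intros) auto
  then obtain h where h: "polynomial_function h" "\<And>v. v \<in> {-1..1} \<Longrightarrow> norm (g v - h v) < \<delta>"
    using Stone_Weierstrass_polynomial_function[of "{-1..1::real}" g \<delta>] pos by auto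
  \<comment> \<open>The approximant may leave the unit disc by \<delta>. Rescaling brings it back,
    as the products below require, and at most doubles the error, to
    \<open>2 * \<delta> = \<epsilon>\<close>.\<close>
  define P where "P v = h v / complex_of_real (1 + \<delta>)" for v
  have P1: "norm (P v) \<le> 1" if "v \<in> {-1..1}" for v
  proof -
    have "norm (h v) \<le> norm (g v) + norm (g v - h v)"
      using norm_triangle_ineq4[of "g v" "g v - h v"] by simp
    also have "\<dots> \<le> 1 + \<delta>" using h(2)[OF that] by (simp add: g_def)
    finally show ?thesis using pos by (simp add: P_def norm_divide del: of_real_add)
  qed
  have P2: "norm (P v - g v) \<le> \<epsilon>" if "v \<in> {-1..1}" for v
  proof -
    have e: "P v - g v = (h v - g v) / complex_of_real (1 + \<delta>) - g v * complex_of_real (\<delta> / (1 + \<delta>))"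
    proof -
      have "1 + complex_of_real \<delta> \<noteq> 0"
        using pos by (auto simp: complex_eq_iff)
      then show ?thesis by (simp add: P_def divide_simps) (simp add: algebra_simps)
    qed
    have "norm (P v - g v) \<le> norm (h v - g v) / (1 + \<delta>) + norm (g v) * (\<delta> / (1 + \<delta>))"
      unfolding e using pos
      by (intro norm_triangle_le_diff) (simp add: norm_divide norm_mult del: of_real_add of_real_divide)
    also have "\<dots> \<le> \<delta> / 1 + 1 * (\<delta> / 1)"
      using h(2)[OF that] pos
      by (intro add_mono mult_mono frac_le) (auto simp: g_def norm_minus_commute)
    finally show ?thesis by (simp add: \<delta>_def)
  qed
  define c where "c = pi / K"
  have close: "norm (P (cos (c * s)) - cis (\<beta> * \<bar>s\<bar>)) \<le> \<epsilon> * (1 + \<bar>s\<bar>)" for s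
  proof (cases "\<bar>s\<bar> \<le> K")
    case True
    have "cos (c * s) = cos (c * \<bar>s\<bar>)" by (auto simp: abs_if)
    moreover have "arccos (cos (c * \<bar>s\<bar>)) = c * \<bar>s\<bar>"
      using True pos by (intro arccos_cos) (auto simp: c_def field_simps)
    ultimately have "g (cos (c * s)) = cis (\<beta> * \<bar>s\<bar>)"
      using pos by (simp add: g_def c_def)
    then have "norm (P (cos (c * s)) - cis (\<beta> * \<bar>s\<bar>)) \<le> \<epsilon>"
      using P2[of "cos (c * s)"] by simp
    also have "\<dots> \<le> \<epsilon> * (1 + \<bar>s\<bar>)" using assms by simp
    finally show ?thesis .
  next
    case False
    have "norm (P (cos (c * s)) - cis (\<beta> * \<bar>s\<bar>)) \<le> 1 + 1"
      using P1[of "cos (c * s)"] by (intro norm_triangle_le_diff add_mono) auto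
    also have "\<dots> = \<epsilon> * K" using assms by (simp add: K_def)
    also have "\<dots> \<le> \<epsilon> * (1 + \<bar>s\<bar>)" using assms False by (intro mult_left_mono) auto
    finally show ?thesis .
  qed
  define k where "k = inverse (1 + \<delta>)"
  have Pk: "P v = Complex (k * Re (h v)) (k * Im (h v))" for v
    by (simp add: P_def k_def complex_eq_iff divide_inverse del: of_real_add flip: of_real_inverse)
  have q: "real_polynomial_function (\<lambda>v. k * Re (h v))" "real_polynomial_function (\<lambda>v. k * Im (h v))"
    using h(1) bounded_linear_Re bounded_linear_Im
    by (auto simp: polynomial_function_def o_def intro!: real_polynomial_function.intros(4) real_polynomial_function.intros(2))
  show ?thesis
    using q P1 close unfolding Pk
    by (intro exI[of _ "\<lambda>v. k * Re (h v)"] exI[of _ "\<lambda>v. k * Im (h v)"] exI[of _ c]) auto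
qed

lemma trig_poly_cis_abs_approx:
  fixes \<beta> \<epsilon> :: real
  assumes "0 < \<epsilon>"
  shows "\<exists>f. trig_poly A f \<and> (\<forall>u. norm (f u) \<le> 1) \<and>
    (\<forall>u. norm (f u - cis (\<beta> * \<bar>\<Sum>x\<in>A. t x * u x\<bar>)) \<le> \<epsilon> * (1 + \<bar>\<Sum>x\<in>A. t x * u x\<bar>))"
proof -
  obtain q1 q2 c where q: "real_polynomial_function q1" "real_polynomial_function q2"
    "\<And>s. norm (Complex (q1 (cos (c * s))) (q2 (cos (c * s)))) \<le> 1"
    "\<And>s. norm (Complex (q1 (cos (c * s))) (q2 (cos (c * s))) - cis (\<beta> * \<bar>s\<bar>)) \<le> \<epsilon> * (1 + \<bar>s\<bar>)"
    using cis_abs_approx[OF assms, of \<beta>] by blast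
  define f where "f u = Complex (q1 (cos (c * (\<Sum>x\<in>A. t x * u x)))) (q2 (cos (c * (\<Sum>x\<in>A. t x * u x))))" for u
  have "f = (\<lambda>u. complex_of_real (q1 (cos (\<Sum>x\<in>A. (c * t x) * u x)))
       + \<i> * complex_of_real (q2 (cos (\<Sum>x\<in>A. (c * t x) * u x))))"
    by (simp add: f_def fun_eq_iff Complex_eq sum_distrib_left mult_ac)
  then have "trig_poly A f"
    by (auto intro!: trig_poly.add trig_poly_mult trig_poly_const trig_poly_polynomial_cos q)
  then show ?thesis using q(3,4) unfolding f_def by blast
qed

text \<open>The exponential of the sum is a product of factors in the unit disc, and so is its
  approximation; replacing one factor at a time adds up the single errors.\<close>

lemma trig_poly_cis_sum_abs_approx:
  fixes \<beta> :: "'b \<Rightarrow> real" and \<epsilon> :: real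
  assumes "0 < \<epsilon>" "finite B"
  shows "\<exists>f. trig_poly A f \<and>
    (\<forall>u. norm (f u - cis (\<Sum>z\<in>B. \<beta> z * \<bar>\<Sum>x\<in>A. t z x * u x\<bar>)) \<le> \<epsilon> * (\<Sum>z\<in>B. 1 + \<bar>\<Sum>x\<in>A. t z x * u x\<bar>))"
proof -
  have "\<forall>z. \<exists>f. trig_poly A f \<and> (\<forall>u. norm (f u) \<le> 1) \<and>
    (\<forall>u. norm (f u - cis (\<beta> z * \<bar>\<Sum>x\<in>A. t z x * u x\<bar>)) \<le> \<epsilon> * (1 + \<bar>\<Sum>x\<in>A. t z x * u x\<bar>))"
    using trig_poly_cis_abs_approx[OF assms(1)] by blast
  then obtain f where f: "\<And>z. trig_poly A (f z)" "\<And>z u. norm (f z u) \<le> 1"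
    "\<And>z u. norm (f z u - cis (\<beta> z * \<bar>\<Sum>x\<in>A. t z x * u x\<bar>)) \<le> \<epsilon> * (1 + \<bar>\<Sum>x\<in>A. t z x * u x\<bar>)"
    by metis
  have cis_sum: "cis (\<Sum>z\<in>B. k z) = (\<Prod>z\<in>B. cis (k z))" for k :: "'b \<Rightarrow> real"
    using assms(2) by (induction B rule: finite_induct) (auto simp: cis_mult[symmetric])
  have "norm ((\<Prod>z\<in>B. f z u) - cis (\<Sum>z\<in>B. \<beta> z * \<bar>\<Sum>x\<in>A. t z x * u x\<bar>))
      \<le> \<epsilon> * (\<Sum>z\<in>B. 1 + \<bar>\<Sum>x\<in>A. t z x * u x\<bar>)" for u
  proof -
    have "norm ((\<Prod>z\<in>B. f z u) - cis (\<Sum>z\<in>B. \<beta> z * \<bar>\<Sum>x\<in>A. t z x * u x\<bar>))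
      \<le> (\<Sum>z\<in>B. norm (f z u - cis (\<beta> z * \<bar>\<Sum>x\<in>A. t z x * u x\<bar>)))"
      unfolding cis_sum by (rule norm_prod_diff) (auto simp: f(2))
    also have "\<dots> \<le> (\<Sum>z\<in>B. \<epsilon> * (1 + \<bar>\<Sum>x\<in>A. t z x * u x\<bar>))"
      by (intro sum_mono f)
    finally show ?thesis by (simp add: sum_distrib_left)
  qed
  then show ?thesis
    using trig_poly_prod[of B A f, OF assms(2) f(1)] by (intro exI[of _ "\<lambda>u. \<Prod>z\<in>B. f z u"]) simp
qed

section \<open>Limits of characteristic functions and normal laws\<close>

lemma exp_minus_bound:
  fixes y :: real
  assumes "0 \<le> y"
  shows "\<bar>exp (- y) - (1 - y)\<bar> \<le> y\<^sup>2"
proof -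
  have "exp (- y) \<le> 1 / (1 + y)"
    using assms exp_ge_add_one_self[of y] by (simp add: exp_minus field_simps)
  \<comment> \<open>Here \<open>(1 - y + y^2) * (1 + y) = 1 + y^3\<close>.\<close>
  also have "\<dots> \<le> 1 - y + y\<^sup>2"
  proof -
    have "1 \<le> (1 - y + y\<^sup>2) * (1 + y)"
      using assms by (simp add: power2_eq_square algebra_simps)
    then show ?thesis using assms by (simp add: pos_divide_le_eq)
  qed
  finally show ?thesis using exp_ge_add_one_self[of "- y"] by simp
qed

text \<open>Every factor is expanded to third order and compared with a Gaussian factor. Both the
  scale \<open>s j\<close> and the sample size \<open>n j\<close> vary, because the weights of the
  two samples only converge.\<close>

lemma (in prob_space) clt_power:
  fixes \<xi> :: "'a \<Rightarrow> real" and s :: "nat \<Rightarrow> real" and n :: "nat \<Rightarrow> nat"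
  assumes [measurable]: "\<xi> \<in> borel_measurable M" and bdd: "\<And>\<omega>. \<bar>\<xi> \<omega>\<bar> \<le> c"
    and mean: "expectation \<xi> = 0"
    and s: "s \<longlonglongrightarrow> s0" and n: "filterlim n at_top sequentially"
  shows "(\<lambda>j. (expectation (\<lambda>\<omega>. cis (s j / sqrt (n j) * \<xi> \<omega>))) ^ n j)
    \<longlonglongrightarrow> complex_of_real (exp (- (s0\<^sup>2 * expectation (\<lambda>\<omega>. (\<xi> \<omega>)\<^sup>2) / 2)))"
proof -
  define \<sigma>2 where "\<sigma>2 = expectation (\<lambda>\<omega>. (\<xi> \<omega>)\<^sup>2)"
  have c: "0 \<le> c" using bdd[of undefined] by linarith
  have int1: "integrable M \<xi>"
    by (rule integrable_const_bound[of _ c]) (auto simp: bdd)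
  have int2: "integrable M (\<lambda>\<omega>. (\<xi> \<omega>)\<^sup>2)"
    by (rule integrable_const_bound[of _ "c\<^sup>2"]) (auto simp: bdd abs_le_square_iff[symmetric] c)
  have \<sigma>2: "0 \<le> \<sigma>2" by (simp add: \<sigma>2_def)
  define \<phi> where "\<phi> t = expectation (\<lambda>\<omega>. cis (t * \<xi> \<omega>))" for t
  have char: "char (distr M borel \<xi>) t = \<phi> t" for t
    unfolding char_def \<phi>_def by (subst integral_distr) (auto simp: cis_conv_exp)
  have \<phi>_le: "norm (\<phi> t) \<le> 1" for t
    using real_distribution.cmod_char_le_1[of "distr M borel \<xi>"] by (simp add: char[symmetric] real_distribution_distr)
  \<comment> \<open>A third-moment term, from the boundedness of \<xi>, and the remainder of
    \<open>exp\<close>. Both have order above \<open>t^2\<close>, so \<open>n j\<close> times the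
    error at \<open>s j / sqrt (n j)\<close> vanishes.\<close>
  define err where "err t = \<bar>t\<bar> ^ 3 * c ^ 3 / 6 + (t\<^sup>2 * \<sigma>2 / 2)\<^sup>2" for t
  have \<phi>_approx: "norm (\<phi> t - complex_of_real (exp (- (t\<^sup>2 * \<sigma>2 / 2)))) \<le> err t" for t
  proof -
    have "norm (\<phi> t - (1 - t\<^sup>2 * \<sigma>2 / 2)) \<le> (t\<^sup>2 / 6) * expectation (\<lambda>x. min (6 * (\<xi> x)\<^sup>2) (\<bar>t\<bar> * \<bar>\<xi> x\<bar> ^ 3))"
      unfolding char[symmetric]
      by (rule char_approx3') (auto simp: int1 int2 mean \<sigma>2_def)
    also have "\<dots> \<le> (t\<^sup>2 / 6) * expectation (\<lambda>x. \<bar>t\<bar> * c ^ 3)"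
    proof (intro mult_left_mono integral_mono')
      fix x
      have "\<bar>t\<bar> * \<bar>\<xi> x\<bar> ^ 3 \<le> \<bar>t\<bar> * c ^ 3"
        by (intro mult_left_mono power_mono bdd) auto
      then show "min (6 * (\<xi> x)\<^sup>2) (\<bar>t\<bar> * \<bar>\<xi> x\<bar> ^ 3) \<le> \<bar>t\<bar> * c ^ 3"
        by linarith
    qed (auto simp: c)
    also have "\<dots> = \<bar>t\<bar> ^ 3 * c ^ 3 / 6"
      by (simp add: prob_space power3_eq_cube power2_eq_square)
    finally have 1: "norm (\<phi> t - (1 - t\<^sup>2 * \<sigma>2 / 2)) \<le> \<bar>t\<bar> ^ 3 * c ^ 3 / 6" .
    have "norm (complex_of_real (1 - t\<^sup>2 * \<sigma>2 / 2) - complex_of_real (exp (- (t\<^sup>2 * \<sigma>2 / 2)))) \<le> (t\<^sup>2 * \<sigma>2 / 2)\<^sup>2"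
      using exp_minus_bound[of "t\<^sup>2 * \<sigma>2 / 2"] \<sigma>2
      unfolding of_real_diff[symmetric] norm_of_real by (simp add: abs_minus_commute)
    then show ?thesis
      unfolding err_def using 1 norm_triangle_le[of "\<phi> t - (1 - t\<^sup>2 * \<sigma>2 / 2)"
          "complex_of_real (1 - t\<^sup>2 * \<sigma>2 / 2) - complex_of_real (exp (- (t\<^sup>2 * \<sigma>2 / 2)))"]
      by simp
  qed
  have n_real: "filterlim (\<lambda>j. real (n j)) at_top sequentially"
    by (rule filterlim_compose[OF filterlim_real_sequentially n])
  have n_pos: "\<forall>\<^sub>F j in sequentially. 0 < n j"
    using eventually_compose_filterlim[OF eventually_gt_at_top n] .
  have lim_err: "(\<lambda>j. n j * err (s j / sqrt (n j))) \<longlonglongrightarrow> 0"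
  proof -
    have *: "n j * err (s j / sqrt (n j))
        = \<bar>s j\<bar> ^ 3 * c ^ 3 / 6 * (1 / sqrt (n j)) + ((s j)\<^sup>2 * \<sigma>2 / 2)\<^sup>2 * (1 / n j)" if "0 < n j" for j
    proof -
      define q where "q = sqrt (n j)"
      have q: "0 < q" "real (n j) = q ^ 2" using that by (auto simp: q_def)
      show ?thesis
        unfolding err_def q_def[symmetric] using q
        by (simp add: abs_divide power_divide field_simps power2_eq_square power3_eq_cube)
    qed
    have "(\<lambda>j. \<bar>s j\<bar> ^ 3 * c ^ 3 / 6 * (1 / sqrt (n j)) + ((s j)\<^sup>2 * \<sigma>2 / 2)\<^sup>2 * (1 / n j))
        \<longlonglongrightarrow> \<bar>s0\<bar> ^ 3 * c ^ 3 / 6 * 0 + (s0\<^sup>2 * \<sigma>2 / 2)\<^sup>2 * 0"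
      by (intro tendsto_intros s tendsto_divide_0[OF tendsto_const] filterlim_at_top_imp_at_infinity
          n_real filterlim_compose[OF sqrt_at_top n_real]) auto
    then have "(\<lambda>j. \<bar>s j\<bar> ^ 3 * c ^ 3 / 6 * (1 / sqrt (n j)) + ((s j)\<^sup>2 * \<sigma>2 / 2)\<^sup>2 * (1 / n j)) \<longlonglongrightarrow> 0"
      by simp
    then show ?thesis
      by (rule Lim_transform_eventually) (use n_pos in \<open>eventually_elim, simp add: *\<close>)
  qed
  have "\<forall>\<^sub>F j in sequentially. norm (\<phi> (s j / sqrt (n j)) ^ n j - complex_of_real (exp (- ((s j)\<^sup>2 * \<sigma>2 / 2))))
      \<le> n j * err (s j / sqrt (n j))"
    using n_pos
  proof eventually_elim
    case (elim j)
    let ?t = "s j / sqrt (n j)"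
    have "- ((s j)\<^sup>2 * \<sigma>2 / 2) = n j * (- (?t\<^sup>2 * \<sigma>2 / 2))"
      using elim by (simp add: power_divide)
    then have e: "exp (- ((s j)\<^sup>2 * \<sigma>2 / 2)) = exp (- (?t\<^sup>2 * \<sigma>2 / 2)) ^ n j"
      by (simp only: exp_of_nat_mult)
    have "norm (\<phi> ?t ^ n j - complex_of_real (exp (- (?t\<^sup>2 * \<sigma>2 / 2))) ^ n j)
        \<le> n j * norm (\<phi> ?t - complex_of_real (exp (- (?t\<^sup>2 * \<sigma>2 / 2))))"
      using \<sigma>2 by (intro norm_power_diff \<phi>_le) (simp del: of_real_exp)
    also have "\<dots> \<le> n j * err ?t"
      by (intro mult_left_mono \<phi>_approx) simp
    finally show ?case unfolding e of_real_power .
  qed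
  then have "(\<lambda>j. \<phi> (s j / sqrt (n j)) ^ n j - complex_of_real (exp (- ((s j)\<^sup>2 * \<sigma>2 / 2)))) \<longlonglongrightarrow> 0"
    by (rule Lim_null_comparison) (rule lim_err)
  moreover have "(\<lambda>j. complex_of_real (exp (- ((s j)\<^sup>2 * \<sigma>2 / 2)))) \<longlonglongrightarrow> complex_of_real (exp (- (s0\<^sup>2 * \<sigma>2 / 2)))"
    by (intro tendsto_intros s) auto
  ultimately show ?thesis
    unfolding \<phi>_def[symmetric] \<sigma>2_def[symmetric] by (rule Lim_transform[rotated])
qed

text \<open>For continuous \<open>f\<close> the function \<open>iexp (t * f x)\<close> is a bounded
  continuous test function, so the characteristic functions of the images converge and Levy's
  theorem applies.\<close>

lemma weak_conv_m_continuous_map: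
  fixes \<mu> :: "nat \<Rightarrow> real measure" and f :: "real \<Rightarrow> real"
  assumes "\<And>n. real_distribution (\<mu> n)" "real_distribution \<nu>" "weak_conv_m \<mu> \<nu>"
    and f: "continuous_on UNIV f"
  shows "weak_conv_m (\<lambda>n. distr (\<mu> n) borel f) (distr \<nu> borel f)"
proof -
  interpret \<nu>: real_distribution \<nu> by fact
  have [measurable]: "f \<in> borel_measurable borel"
    using f by (rule borel_measurable_continuous_onI)
  have rd: "real_distribution (distr \<rho> borel f)" if "real_distribution \<rho>" for \<rho>
  proof -
    interpret \<rho>: real_distribution \<rho> by fact
    show ?thesis by (rule \<rho>.real_distribution_distr) simp
  qed
  have char_eq: "char (distr \<rho> borel f) t = (CLINT x|\<rho>. iexp (t * f x))" if "real_distribution \<rho>" for \<rho> t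
  proof -
    interpret \<rho>: real_distribution \<rho> by fact
    show ?thesis unfolding char_def by (subst integral_distr) auto
  qed
  show ?thesis
  proof (rule levy_continuity)
    fix t
    have "(\<lambda>n. CLINT x|\<mu> n. iexp (t * f x)) \<longlonglongrightarrow> (CLINT x|\<nu>. iexp (t * f x))"
    proof (rule weak_conv_imp_integral_bdd_continuous_conv[OF assms(1-3), where B = 1])
      fix x
      have "isCont f x" using f by (simp add: continuous_on_eq_continuous_at)
      then show "isCont (\<lambda>x. iexp (t * f x)) x" by (intro continuous_intros)
    qed simp
    then show "(\<lambda>n. char (distr (\<mu> n) borel f) t) \<longlonglongrightarrow> char (distr \<nu> borel f) t"
      by (simp add: char_eq assms)
  qed (intro rd assms)+
qed

text \<open>A Gaussian process comes with unnamed parameters for each linear combination. They are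
  eliminated here in favour of mean and second moment, which the covariance determines. Point masses
  are a separate case, having no density.\<close>

lemma (in prob_space) normal_law_char:
  assumes [measurable]: "T \<in> borel_measurable M" and \<sigma>: "0 \<le> \<sigma>"
    and D: "distr M borel T = normal_law \<mu> \<sigma>"
  shows "integrable M T" "integrable M (\<lambda>\<omega>. (T \<omega>)\<^sup>2)"
    and "expectation T = 0 \<Longrightarrow> expectation (\<lambda>\<omega>. cis (T \<omega>)) = complex_of_real (exp (- (expectation (\<lambda>\<omega>. (T \<omega>)\<^sup>2) / 2)))"
proof -
  have "integrable M T \<and> integrable M (\<lambda>\<omega>. (T \<omega>)\<^sup>2) \<and>
    (expectation T = 0 \<longrightarrow> expectation (\<lambda>\<omega>. cis (T \<omega>)) = complex_of_real (exp (- (expectation (\<lambda>\<omega>. (T \<omega>)\<^sup>2) / 2))))"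
  proof (cases "\<sigma> = 0")
    case True
    have "AE x in distr M borel T. x = \<mu>"
      unfolding D normal_law_def using True by (simp add: AE_return)
    then have ae: "AE \<omega> in M. T \<omega> = \<mu>"
      by (subst (asm) AE_distr_iff) auto
    have i1: "integrable M T" and e1: "expectation T = \<mu>"
      using ae integrable_cong_AE[of T M "\<lambda>_. \<mu>"] integral_cong_AE[of T M "\<lambda>_. \<mu>"] by (auto simp: prob_space)
    have ae2: "AE \<omega> in M. (T \<omega>)\<^sup>2 = \<mu>\<^sup>2" using ae by eventually_elim simp
    have i2: "integrable M (\<lambda>\<omega>. (T \<omega>)\<^sup>2)" and e2: "expectation (\<lambda>\<omega>. (T \<omega>)\<^sup>2) = \<mu>\<^sup>2"
      using ae2 integrable_cong_AE[of "\<lambda>\<omega>. (T \<omega>)\<^sup>2" M "\<lambda>_. \<mu>\<^sup>2"] integral_cong_AE[of "\<lambda>\<omega>. (T \<omega>)\<^sup>2" M "\<lambda>_. \<mu>\<^sup>2"]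
      by (auto simp: prob_space)
    have ae3: "AE \<omega> in M. cis (T \<omega>) = cis \<mu>" using ae by eventually_elim simp
    have [measurable]: "cis \<in> borel_measurable borel"
      by (intro borel_measurable_continuous_onI continuous_intros)
    have e3: "expectation (\<lambda>\<omega>. cis (T \<omega>)) = cis \<mu>"
      using ae3 integral_cong_AE[of "\<lambda>\<omega>. cis (T \<omega>)" M "\<lambda>_. cis \<mu>"] by (auto simp: prob_space)
    show ?thesis using i1 i2 e1 e2 e3 by auto
  next
    case False
    then have pos: "0 < \<sigma>" using \<sigma> by simp
    have "distr M lborel T = distr M borel T" by (rule distr_cong) auto
    then have dist: "distributed M lborel T (normal_density \<mu> \<sigma>)"
      unfolding distributed_def using D False by (auto simp: normal_law_def)
    have std: "distributed M lborel (\<lambda>x. (T x - \<mu>) / \<sigma>) std_normal_density"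
      using dist normal_standard_normal_convert[OF pos, of T \<mu>] by simp
    have i1: "integrable M T"
      using integrable_normal_moment_nz_1[OF pos, of \<mu>] distributed_integrable[OF dist, of "\<lambda>x. x"] by simp
    have "integrable M (\<lambda>\<omega>. (T \<omega> - \<mu>)\<^sup>2)"
      using integrable_normal_moment[OF pos, of \<mu> 2] distributed_integrable[OF dist, of "\<lambda>x. (x - \<mu>)\<^sup>2"] by simp
    then have "integrable M (\<lambda>\<omega>. (T \<omega> - \<mu>)\<^sup>2 + 2 * \<mu> * T \<omega> - \<mu>\<^sup>2)"
      using i1 by auto
    then have i2: "integrable M (\<lambda>\<omega>. (T \<omega>)\<^sup>2)"
      by (simp add: power2_eq_square algebra_simps)
    have "expectation (\<lambda>\<omega>. cis (T \<omega>)) = complex_of_real (exp (- (expectation (\<lambda>\<omega>. (T \<omega>)\<^sup>2) / 2)))"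
      if z: "expectation T = 0"
    proof -
      have \<mu>: "\<mu> = 0" using normal_distributed_expectation[OF pos dist] z by simp
      have v: "expectation (\<lambda>\<omega>. (T \<omega>)\<^sup>2) = \<sigma>\<^sup>2"
        using normal_distributed_variance[OF pos dist] z by simp
      have "distr M borel (\<lambda>x. T x / \<sigma>) = distr M lborel (\<lambda>x. T x / \<sigma>)" by (rule distr_cong) auto
      then have "distr M borel (\<lambda>x. T x / \<sigma>) = std_normal_distribution"
        using std \<mu> unfolding distributed_def by simp
      then have "char (distr M borel (\<lambda>x. T x / \<sigma>)) \<sigma> = complex_of_real (exp (- (\<sigma>\<^sup>2) / 2))"
        by (simp add: char_std_normal_distribution)
      moreover have "char (distr M borel (\<lambda>x. T x / \<sigma>)) \<sigma> = expectation (\<lambda>\<omega>. cis (T \<omega>))"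
        unfolding char_def using pos by (subst integral_distr) (auto simp: cis_conv_exp)
      ultimately show ?thesis using v by simp
    qed
    then show ?thesis using i1 i2 by blast
  qed
  then show "integrable M T" "integrable M (\<lambda>\<omega>. (T \<omega>)\<^sup>2)"
    "expectation T = 0 \<Longrightarrow> expectation (\<lambda>\<omega>. cis (T \<omega>)) = complex_of_real (exp (- (expectation (\<lambda>\<omega>. (T \<omega>)\<^sup>2) / 2)))"
    by blast+
qed

text \<open>The variance of \<open>\<bar>T\<bar>\<close> is nonnegative.\<close>

lemma (in prob_space) expectation_abs_le_sqrt:
  assumes "integrable M T" "integrable M (\<lambda>\<omega>. (T \<omega>)\<^sup>2)"
  shows "expectation (\<lambda>\<omega>. \<bar>T \<omega>\<bar>) \<le> sqrt (expectation (\<lambda>\<omega>. (T \<omega>)\<^sup>2))"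
proof -
  have "0 \<le> variance (\<lambda>\<omega>. \<bar>T \<omega>\<bar>)" by (rule variance_positive)
  also have "\<dots> = expectation (\<lambda>\<omega>. (T \<omega>)\<^sup>2) - (expectation (\<lambda>\<omega>. \<bar>T \<omega>\<bar>))\<^sup>2"
    using assms by (subst variance_eq) auto
  finally show ?thesis by (intro real_le_rsqrt) simp
qed

section \<open>Centred Gaussian processes\<close>

context
  fixes N :: "'v measure" and G :: "'a \<Rightarrow> 'v \<Rightarrow> real" and C
  assumes gaussian: "centred_gaussian_process N G C"
begin

lemma gaussian_prob_space: "prob_space N"
  using gaussian by (simp add: centred_gaussian_process_def)

lemma gaussian_measurable [measurable]: "G x \<in> borel_measurable N"
  using gaussian by (simp add: centred_gaussian_process_def)

lemma gaussian_linear: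
  assumes "finite A"
  obtains \<mu> \<sigma> where "0 \<le> \<sigma>" "distr N borel (\<lambda>\<omega>. \<Sum>x\<in>A. t x * G x \<omega>) = normal_law \<mu> \<sigma>"
proof -
  have "\<forall>A t. finite A \<longrightarrow> (\<exists>\<mu> \<sigma>. 0 \<le> \<sigma> \<and> distr N borel (\<lambda>\<omega>. \<Sum>x\<in>A. t x * G x \<omega>) = normal_law \<mu> \<sigma>)"
    using gaussian unfolding centred_gaussian_process_def by (elim conjE)
  from this[rule_format, OF assms, of t] that show ?thesis by blast
qed

lemma gaussian_integrable: "integrable N (G x)" "integrable N (\<lambda>\<omega>. (G x \<omega>)\<^sup>2)"
proof -
  interpret N: prob_space N by (rule gaussian_prob_space)
  have "finite {x}" by simp
  then obtain \<mu> \<sigma> where "0 \<le> \<sigma>" "distr N borel (\<lambda>\<omega>. \<Sum>y\<in>{x}. 1 * G y \<omega>) = normal_law \<mu> \<sigma>"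
    by (rule gaussian_linear)
  then have "0 \<le> \<sigma>" "distr N borel (G x) = normal_law \<mu> \<sigma>" by simp_all
  from N.normal_law_char(1,2)[OF _ this] show "integrable N (G x)" "integrable N (\<lambda>\<omega>. (G x \<omega>)\<^sup>2)"
    by auto
qed

text \<open>For \<open>multinomial_cov r\<close> the right-hand side is at most
  \<open>sqrt (pmf r x)\<close>, the same order as for the rescaled frequencies.\<close>

lemma gaussian_abs_le: "(\<integral>\<omega>. \<bar>G x \<omega>\<bar> \<partial>N) \<le> sqrt (C x x)"
proof -
  interpret N: prob_space N by (rule gaussian_prob_space)
  have "(\<integral>\<omega>. (G x \<omega>)\<^sup>2 \<partial>N) = C x x"
    using gaussian by (simp add: centred_gaussian_process_def power2_eq_square)
  then show ?thesis using N.expectation_abs_le_sqrt[OF gaussian_integrable] by metis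
qed

lemma gaussian_cis:
  assumes "finite A"
  shows "(\<integral>\<omega>. cis (\<Sum>x\<in>A. t x * G x \<omega>) \<partial>N)
    = complex_of_real (exp (- ((\<Sum>x\<in>A. \<Sum>y\<in>A. t x * t y * C x y) / 2)))"
proof -
  interpret N: prob_space N by (rule gaussian_prob_space)
  obtain \<mu> \<sigma> where ms: "0 \<le> \<sigma>" "distr N borel (\<lambda>\<omega>. \<Sum>x\<in>A. t x * G x \<omega>) = normal_law \<mu> \<sigma>"
    using gaussian_linear[OF assms] .
  have abs_mult_le: "\<bar>a * b\<bar> \<le> a\<^sup>2 + b\<^sup>2" for a b :: real
  proof -
    have "0 \<le> \<bar>a\<bar> * \<bar>b\<bar>" by simp
    then show ?thesis
      using sum_squares_bound[of "\<bar>a\<bar>" "\<bar>b\<bar>"] unfolding abs_mult power2_abs by linarith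
  qed
  \<comment> \<open>Cross products are integrable because the squares are; only then may the second
    moment be expanded term by term.\<close>
  have prod_int: "integrable N (\<lambda>\<omega>. G x \<omega> * G y \<omega>)" for x y
    by (rule Bochner_Integration.integrable_bound[OF
          Bochner_Integration.integrable_add[OF gaussian_integrable(2)[of x] gaussian_integrable(2)[of y]]])
       (auto intro!: AE_I2 intro: abs_mult_le)
  have "(\<integral>\<omega>. (\<Sum>x\<in>A. t x * G x \<omega>) \<partial>N) = 0"
    using gaussian gaussian_integrable by (subst Bochner_Integration.integral_sum) (auto simp: centred_gaussian_process_def)
  moreover have "(\<integral>\<omega>. (\<Sum>x\<in>A. t x * G x \<omega>)\<^sup>2 \<partial>N) = (\<Sum>x\<in>A. \<Sum>y\<in>A. t x * t y * C x y)"
  proof -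
    have "(\<Sum>x\<in>A. t x * G x \<omega>)\<^sup>2 = (\<Sum>x\<in>A. \<Sum>y\<in>A. t x * t y * (G x \<omega> * G y \<omega>))" for \<omega>
      unfolding power2_eq_square sum_product by (simp add: mult_ac)
    then show ?thesis
      using gaussian prod_int by (simp add: Bochner_Integration.integral_sum centred_gaussian_process_def)
  qed
  ultimately show ?thesis
    using N.normal_law_char(3)[OF _ ms] by (simp del: of_real_exp)
qed

end

section \<open>Independent samples\<close>

lemma borel_measurable_cis [measurable]: "cis \<in> borel_measurable borel"
  by (intro borel_measurable_continuous_onI continuous_intros)

lemma norm_cis_diff_le: "norm (cis x - cis y) \<le> \<bar>x - y\<bar>"
proof -
  have "cis x = cis y * cis (x - y)" by (simp add: cis_mult)
  then have "cis x - cis y = cis y * (cis (x - y) - 1)" by (simp add: algebra_simps)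
  then have "norm (cis x - cis y) = norm (iexp (x - y) - 1)"
    by (simp only: norm_mult norm_cis mult_1 cis_conv_exp[of "x - y"])
  also have "\<dots> \<le> \<bar>x - y\<bar>" using iexp_approx1[of "x - y" 0] by simp
  finally show ?thesis .
qed

lemma norm_cis_diff_le_2: "norm (cis x - cis y) \<le> 2"
  using norm_triangle_ineq4[of "cis x" "cis y"] by simp

lemma trig_poly_integral_tendsto:
  fixes U :: "nat \<Rightarrow> 'a \<Rightarrow> 'w \<Rightarrow> real" and V :: "'a \<Rightarrow> 'v \<Rightarrow> real"
  assumes M: "prob_space M" and N: "prob_space N"
    and [measurable]: "\<And>j x. U j x \<in> borel_measurable M" "\<And>x. V x \<in> borel_measurable N"
    and cis: "\<And>t. (\<lambda>j. \<integral>\<omega>. cis (\<Sum>x\<in>A. t x * U j x \<omega>) \<partial>M) \<longlonglongrightarrow> (\<integral>\<omega>. cis (\<Sum>x\<in>A. t x * V x \<omega>) \<partial>N)"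
    and "trig_poly A f"
  shows "(\<lambda>j. \<integral>\<omega>. f (\<lambda>x. U j x \<omega>) \<partial>M) \<longlonglongrightarrow> (\<integral>\<omega>. f (\<lambda>x. V x \<omega>) \<partial>N)"
  using assms(6)
proof induction
  case (cis z t)
  then show ?case using tendsto_mult[OF tendsto_const assms(5)] by simp
next
  case (add f g)
  interpret M: prob_space M by fact
  interpret N: prob_space N by fact
  have iM: "integrable M (\<lambda>\<omega>. h (\<lambda>x. U j x \<omega>))" if "trig_poly A h" for h j
    using trig_poly_bounded[OF that] trig_poly_measurable[OF that, of "U j" M]
    by (auto intro: M.integrable_const_bound)
  have iN: "integrable N (\<lambda>\<omega>. h (\<lambda>x. V x \<omega>))" if "trig_poly A h" for h
    using trig_poly_bounded[OF that] trig_poly_measurable[OF that, of V N]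
    by (auto intro: N.integrable_const_bound)
  show ?case
    using tendsto_add[OF add.IH] by (simp add: iM iN add.hyps)
qed

lemma integral_diff_le_approx:
  fixes F f :: "'b \<Rightarrow> complex"
  assumes "prob_space M" and [measurable]: "F \<in> borel_measurable M" "f \<in> borel_measurable M"
    and "\<And>\<omega>. norm (F \<omega>) \<le> b" "\<And>\<omega>. norm (f \<omega>) \<le> b'" "integrable M k"
    and "\<And>\<omega>. norm (f \<omega> - F \<omega>) \<le> k \<omega>"
  shows "norm ((\<integral>\<omega>. f \<omega> \<partial>M) - (\<integral>\<omega>. F \<omega> \<partial>M)) \<le> (\<integral>\<omega>. k \<omega> \<partial>M)"
proof -
  interpret prob_space M by fact
  have iF: "integrable M F"
    by (rule integrable_const_bound[where B = b]) (simp_all add: assms(4))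
  have if': "integrable M f"
    by (rule integrable_const_bound[where B = b']) (simp_all add: assms(5))
  note iF if'
  then have "norm ((\<integral>\<omega>. f \<omega> \<partial>M) - (\<integral>\<omega>. F \<omega> \<partial>M)) = norm (\<integral>\<omega>. f \<omega> - F \<omega> \<partial>M)"
    by simp
  also have "\<dots> \<le> (\<integral>\<omega>. norm (f \<omega> - F \<omega>) \<partial>M)"
    by (rule integral_norm_bound)
  also have "\<dots> \<le> (\<integral>\<omega>. k \<omega> \<partial>M)"
    using iF if' assms(6,7) by (intro integral_mono) auto
  finally show ?thesis .
qed

text \<open>A Cramer-Wold argument: products of functions \<open>cis (\<beta> * \<bar>s\<bar>)\<close> of linear forms
  are approximated by trigonometric polynomials.\<close>

lemma cis_sum_abs_tendsto:
  fixes U :: "nat \<Rightarrow> 'a \<Rightarrow> 'w \<Rightarrow> real" and V :: "'a \<Rightarrow> 'v \<Rightarrow> real" and \<beta> :: "'b \<Rightarrow> real"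
  assumes M: "prob_space M" and N: "prob_space N" and fin: "finite A" "finite B"
    and U: "\<And>j x. integrable M (U j x)" and V: "\<And>x. integrable N (V x)"
    and U_le: "\<forall>\<^sub>F j in sequentially. \<forall>x\<in>A. (\<integral>\<omega>. \<bar>U j x \<omega>\<bar> \<partial>M) \<le> c"
    and V_le: "\<And>x. x \<in> A \<Longrightarrow> (\<integral>\<omega>. \<bar>V x \<omega>\<bar> \<partial>N) \<le> c"
    and cis: "\<And>t. (\<lambda>j. \<integral>\<omega>. cis (\<Sum>x\<in>A. t x * U j x \<omega>) \<partial>M) \<longlonglongrightarrow> (\<integral>\<omega>. cis (\<Sum>x\<in>A. t x * V x \<omega>) \<partial>N)"
  shows "(\<lambda>j. \<integral>\<omega>. cis (\<Sum>z\<in>B. \<beta> z * \<bar>\<Sum>x\<in>A. t z x * U j x \<omega>\<bar>) \<partial>M)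
    \<longlonglongrightarrow> (\<integral>\<omega>. cis (\<Sum>z\<in>B. \<beta> z * \<bar>\<Sum>x\<in>A. t z x * V x \<omega>\<bar>) \<partial>N)"
proof (rule LIMSEQ_I)
  interpret M: prob_space M by fact
  interpret N: prob_space N by fact
  have [measurable]: "U j x \<in> borel_measurable M" "V x \<in> borel_measurable N" for j x
    using U V by auto
  fix e :: real assume e: "0 < e"
  \<comment> \<open>Bounds the mean of the error weight in the trigonometric approximation, for
    \<open>V\<close> and for all large \<open>j\<close>. With \<epsilon> as below, each of the two
    approximations costs at most \<open>e / 3\<close>.\<close>
  define K where "K = (\<Sum>z\<in>B. 1 + (\<Sum>x\<in>A. \<bar>t z x\<bar> * c))"
  define F where "F u = cis (\<Sum>z\<in>B. \<beta> z * \<bar>\<Sum>x\<in>A. t z x * u x\<bar>)" for u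
  define \<epsilon> where "\<epsilon> = e / (3 * (\<bar>K\<bar> + 1))"
  have \<epsilon>: "0 < \<epsilon>" using e by (auto simp: \<epsilon>_def)
  have \<epsilon>K: "\<epsilon> * K \<le> e / 3"
  proof -
    have "\<epsilon> * K \<le> \<epsilon> * (\<bar>K\<bar> + 1)" using \<epsilon> by (intro mult_left_mono) auto
    also have "\<dots> = e / 3" by (simp add: \<epsilon>_def field_simps)
    finally show ?thesis .
  qed
  obtain f where f: "trig_poly A f"
    "\<And>u. norm (f u - F u) \<le> \<epsilon> * (\<Sum>z\<in>B. 1 + \<bar>\<Sum>x\<in>A. t z x * u x\<bar>)"
    using trig_poly_cis_sum_abs_approx[OF \<epsilon> fin(2), of A \<beta> t] unfolding F_def by blast
  obtain b where b: "\<And>u. norm (f u) \<le> b" using trig_poly_bounded[OF f(1)] by blast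
  \<comment> \<open>Stated for an arbitrary probability space, so that it serves both
    \<open>U j\<close> and the limit \<open>V\<close>.\<close>
  have approx: "norm ((\<integral>\<omega>. f (\<lambda>x. W x \<omega>) \<partial>L) - (\<integral>\<omega>. F (\<lambda>x. W x \<omega>) \<partial>L)) \<le> e / 3"
    if L: "prob_space L" and W: "\<And>x. integrable L (W x)" "\<And>x. x \<in> A \<Longrightarrow> (\<integral>\<omega>. \<bar>W x \<omega>\<bar> \<partial>L) \<le> c"
    for L :: "'c measure" and W
  proof -
    interpret L: prob_space L by fact
    have [measurable]: "W x \<in> borel_measurable L" for x using W by auto
    have [measurable]: "(\<lambda>\<omega>. F (\<lambda>x. W x \<omega>)) \<in> borel_measurable L"
      unfolding F_def by measurable
    have [measurable]: "(\<lambda>\<omega>. f (\<lambda>x. W x \<omega>)) \<in> borel_measurable L"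
      by (rule trig_poly_measurable[OF f(1)]) simp
    define k where "k \<omega> = \<epsilon> * (\<Sum>z\<in>B. 1 + (\<Sum>x\<in>A. \<bar>t z x\<bar> * \<bar>W x \<omega>\<bar>))" for \<omega>
    have k: "norm (f (\<lambda>x. W x \<omega>) - F (\<lambda>x. W x \<omega>)) \<le> k \<omega>" for \<omega>
    proof -
      have "norm (f (\<lambda>x. W x \<omega>) - F (\<lambda>x. W x \<omega>)) \<le> \<epsilon> * (\<Sum>z\<in>B. 1 + \<bar>\<Sum>x\<in>A. t z x * W x \<omega>\<bar>)"
        by (rule f(2))
      also have "\<dots> \<le> k \<omega>"
        unfolding k_def using \<epsilon>
        by (intro mult_left_mono sum_mono add_left_mono order_trans[OF sum_abs]) (auto simp: abs_mult)
      finally show ?thesis .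
    qed
    have "norm ((\<integral>\<omega>. f (\<lambda>x. W x \<omega>) \<partial>L) - (\<integral>\<omega>. F (\<lambda>x. W x \<omega>) \<partial>L)) \<le> (\<integral>\<omega>. k \<omega> \<partial>L)"
      by (rule integral_diff_le_approx[where b = 1 and b' = b]) (use L b k W in \<open>auto simp: k_def F_def\<close>)
    also have "\<dots> = \<epsilon> * (\<Sum>z\<in>B. 1 + (\<Sum>x\<in>A. \<bar>t z x\<bar> * (\<integral>\<omega>. \<bar>W x \<omega>\<bar> \<partial>L)))"
      unfolding k_def using W by (simp add: L.prob_space)
    also have "\<dots> \<le> \<epsilon> * K"
      unfolding K_def using W \<epsilon> by (intro mult_left_mono sum_mono add_left_mono) auto
    finally show ?thesis using \<epsilon>K by linarith
  qed
  have "(\<lambda>j. \<integral>\<omega>. f (\<lambda>x. U j x \<omega>) \<partial>M) \<longlonglongrightarrow> (\<integral>\<omega>. f (\<lambda>x. V x \<omega>) \<partial>N)"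
    by (rule trig_poly_integral_tendsto[OF M N _ _ cis f(1)]) auto
  then have "\<forall>\<^sub>F j in sequentially. norm ((\<integral>\<omega>. f (\<lambda>x. U j x \<omega>) \<partial>M) - (\<integral>\<omega>. f (\<lambda>x. V x \<omega>) \<partial>N)) < e / 3"
    using e unfolding dist_norm[symmetric] by (intro tendstoD) auto
  with U_le have "\<forall>\<^sub>F j in sequentially.
      norm ((\<integral>\<omega>. F (\<lambda>x. U j x \<omega>) \<partial>M) - (\<integral>\<omega>. F (\<lambda>x. V x \<omega>) \<partial>N)) < e"
  proof eventually_elim
    case (elim j)
    have 1: "norm ((\<integral>\<omega>. f (\<lambda>x. U j x \<omega>) \<partial>M) - (\<integral>\<omega>. F (\<lambda>x. U j x \<omega>) \<partial>M)) \<le> e / 3"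
      using approx[OF M, of "U j"] U elim by auto
    have 2: "norm ((\<integral>\<omega>. f (\<lambda>x. V x \<omega>) \<partial>N) - (\<integral>\<omega>. F (\<lambda>x. V x \<omega>) \<partial>N)) \<le> e / 3"
      using approx[OF N, of V] V V_le by auto
    have eq: "(\<integral>\<omega>. F (\<lambda>x. U j x \<omega>) \<partial>M) - (\<integral>\<omega>. F (\<lambda>x. V x \<omega>) \<partial>N)
      = ((\<integral>\<omega>. f (\<lambda>x. U j x \<omega>) \<partial>M) - (\<integral>\<omega>. f (\<lambda>x. V x \<omega>) \<partial>N))
        - ((\<integral>\<omega>. f (\<lambda>x. U j x \<omega>) \<partial>M) - (\<integral>\<omega>. F (\<lambda>x. U j x \<omega>) \<partial>M))
        + ((\<integral>\<omega>. f (\<lambda>x. V x \<omega>) \<partial>N) - (\<integral>\<omega>. F (\<lambda>x. V x \<omega>) \<partial>N))"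
      by simp
    have tri: "norm (a - b + c) \<le> norm a + norm b + norm c" for a b c :: complex
      using norm_triangle_ineq[of "a - b" c] norm_triangle_ineq4[of a b] by linarith
    have "norm ((\<integral>\<omega>. F (\<lambda>x. U j x \<omega>) \<partial>M) - (\<integral>\<omega>. F (\<lambda>x. V x \<omega>) \<partial>N))
      \<le> norm ((\<integral>\<omega>. f (\<lambda>x. U j x \<omega>) \<partial>M) - (\<integral>\<omega>. f (\<lambda>x. V x \<omega>) \<partial>N))
        + norm ((\<integral>\<omega>. f (\<lambda>x. U j x \<omega>) \<partial>M) - (\<integral>\<omega>. F (\<lambda>x. U j x \<omega>) \<partial>M))
        + norm ((\<integral>\<omega>. f (\<lambda>x. V x \<omega>) \<partial>N) - (\<integral>\<omega>. F (\<lambda>x. V x \<omega>) \<partial>N))"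
      unfolding eq by (rule tri)
    then show ?case using 1 2 elim(2) by linarith
  qed
  then show "\<exists>no. \<forall>n\<ge>no. norm ((\<integral>\<omega>. cis (\<Sum>z\<in>B. \<beta> z * \<bar>\<Sum>x\<in>A. t z x * U n x \<omega>\<bar>) \<partial>M)
     - (\<integral>\<omega>. cis (\<Sum>z\<in>B. \<beta> z * \<bar>\<Sum>x\<in>A. t z x * V x \<omega>\<bar>) \<partial>N)) < e"
    by (simp add: eventually_sequentially F_def)
qed

text \<open>The index type is left open: the two samples are later joined into one independent
  family over \<open>nat + nat\<close> and told apart by index sets.\<close>

locale iid_sample = prob_space M
  for M :: "'w measure" and Z :: "'i \<Rightarrow> 'w \<Rightarrow> 'a :: countable" and r :: "'a pmf" +
  assumes indep: "indep_vars (\<lambda>_. count_space UNIV) Z UNIV"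
    and law: "\<And>i. distr M (count_space UNIV) (Z i) = measure_pmf r"
begin

lemma sample_measurable [measurable]: "Z i \<in> measurable M (count_space UNIV)"
  using indep by (simp add: indep_vars_def2)

lemma sample_borel_measurable [measurable]: "(\<lambda>\<omega>. g (Z i \<omega>)) \<in> borel_measurable M"
  for g :: "'a \<Rightarrow> 'b :: topological_space"
  by (rule measurable_compose[OF sample_measurable]) simp

lemma sample_integral:
  fixes g :: "'a \<Rightarrow> 'b :: {banach, second_countable_topology}"
  shows "(\<integral>\<omega>. g (Z i \<omega>) \<partial>M) = (\<integral>x. g x \<partial>measure_pmf r)"
  using integral_distr[OF sample_measurable[of i], of g] by (simp add: law)

lemma sample_indep: "indep_vars (\<lambda>_. borel) (\<lambda>i \<omega>. g i (Z i \<omega>)) I"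
  for g :: "'i \<Rightarrow> 'a \<Rightarrow> 'b :: topological_space"
  by (rule indep_vars_compose2[where M' = "\<lambda>_. count_space UNIV"])
     (auto intro: indep_vars_subset[OF indep])

lemma sample_cis:
  fixes g :: "'a \<Rightarrow> real"
  assumes "finite I"
  shows "expectation (\<lambda>\<omega>. cis (\<Sum>i\<in>I. s i * g (Z i \<omega>))) = (\<Prod>i\<in>I. \<integral>x. cis (s i * g x) \<partial>measure_pmf r)"
proof -
  have cis_sum: "cis (\<Sum>i\<in>I. k i) = (\<Prod>i\<in>I. cis (k i))" for k :: "'i \<Rightarrow> real"
    using assms by (induction I rule: finite_induct) (auto simp: cis_mult[symmetric])
  have "expectation (\<lambda>\<omega>. cis (\<Sum>i\<in>I. s i * g (Z i \<omega>))) = expectation (\<lambda>\<omega>. \<Prod>i\<in>I. cis (s i * g (Z i \<omega>)))"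
    by (simp add: cis_sum)
  also have "\<dots> = (\<Prod>i\<in>I. expectation (\<lambda>\<omega>. cis (s i * g (Z i \<omega>))))"
    using sample_indep[of "\<lambda>i x. cis (s i * g x)" I] assms
    by (intro indep_vars_lebesgue_integral) (auto intro!: integrable_const_bound[where B = 1] sample_borel_measurable)
  also have "\<dots> = (\<Prod>i\<in>I. \<integral>x. cis (s i * g x) \<partial>measure_pmf r)"
    using sample_integral[of "\<lambda>x. cis (s _ * g x)"] by simp
  finally show ?thesis .
qed

definition freq :: "'i set \<Rightarrow> 'w \<Rightarrow> 'a \<Rightarrow> real" where
  "freq I \<omega> x = (\<Sum>i\<in>I. indicator {Z i \<omega>} x) / card I"

lemma indicator_sample: "indicator {Z i \<omega>} x = (indicator {x} (Z i \<omega>) :: real)"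
  by (auto simp: indicator_def)

lemma freq_measurable [measurable]: "(\<lambda>\<omega>. freq I \<omega> x) \<in> borel_measurable M"
  unfolding freq_def indicator_sample by measurable

lemma freq_nonneg: "0 \<le> freq I \<omega> x"
  unfolding freq_def by (intro divide_nonneg_nonneg sum_nonneg) auto

lemma freq_integrable: "integrable M (\<lambda>\<omega>. freq I \<omega> x)"
  unfolding freq_def indicator_sample
  by (intro integrable_divide Bochner_Integration.integrable_sum integrable_const_bound[where B = 1]) auto

lemma expectation_freq:
  assumes "finite I" "I \<noteq> {}"
  shows "expectation (\<lambda>\<omega>. freq I \<omega> x) = pmf r x"
proof -
  have "expectation (\<lambda>\<omega>. indicator {x} (Z i \<omega>) :: real) = pmf r x" for i
    using sample_integral[of "indicator {x} :: 'a \<Rightarrow> real" i] by (simp add: measure_pmf_single)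
  moreover have "integrable M (\<lambda>\<omega>. indicator {x} (Z i \<omega>) :: real)" for i
    by (intro integrable_const_bound[where B = 1]) auto
  ultimately show ?thesis
    using assms by (simp add: freq_def indicator_sample Bochner_Integration.integral_sum)
qed

text \<open>The first bound is summable in \<open>x\<close> and serves as a dominating function. The
  second carries the rate; it holds because the centred indicators are pairwise uncorrelated with
  variance at most \<open>pmf r x\<close>.\<close>

lemma expectation_abs_freq_le:
  assumes "finite I" "I \<noteq> {}"
  shows "expectation (\<lambda>\<omega>. \<bar>freq I \<omega> x - pmf r x\<bar>) \<le> 2 * pmf r x"
    and "expectation (\<lambda>\<omega>. \<bar>freq I \<omega> x - pmf r x\<bar>) \<le> sqrt (pmf r x / card I)"
proof -
  have "expectation (\<lambda>\<omega>. \<bar>freq I \<omega> x - pmf r x\<bar>) \<le> expectation (\<lambda>\<omega>. freq I \<omega> x + pmf r x)"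
  proof (rule integral_mono)
    show "\<bar>freq I \<omega> x - pmf r x\<bar> \<le> freq I \<omega> x + pmf r x" for \<omega>
      using freq_nonneg[of I \<omega> x] pmf_nonneg[of r x] by linarith
  qed (auto simp: freq_integrable)
  also have "\<dots> = 2 * pmf r x"
    using expectation_freq[OF assms] by (simp add: freq_integrable prob_space)
  finally show "expectation (\<lambda>\<omega>. \<bar>freq I \<omega> x - pmf r x\<bar>) \<le> 2 * pmf r x" .
  define \<xi> where "\<xi> i \<omega> = indicator {x} (Z i \<omega>) - pmf r x" for i \<omega>
  have [measurable]: "\<xi> i \<in> borel_measurable M" for i
    unfolding \<xi>_def by measurable
  have \<xi>_le: "\<bar>\<xi> i \<omega>\<bar> \<le> 1" for i \<omega>
  proof -
    have "- 1 \<le> pmf r x" using pmf_nonneg[of r x] by linarith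
    then show ?thesis using pmf_le_1[of r x] by (simp add: \<xi>_def indicator_def abs_le_iff)
  qed
  have \<xi>_prod_le: "\<bar>\<xi> i \<omega> * \<xi> k \<omega>\<bar> \<le> 1" for i k \<omega>
    unfolding abs_mult using \<xi>_le by (intro mult_le_one) auto
  have int1: "integrable M (\<xi> i)" for i
    using \<xi>_le by (intro integrable_const_bound[where B = 1]) auto
  have int2: "integrable M (\<lambda>\<omega>. \<xi> i \<omega> * \<xi> k \<omega>)" for i k
    using \<xi>_prod_le by (intro integrable_const_bound[where B = 1]) auto
  have int3: "integrable M (\<lambda>\<omega>. indicator {x} (Z i \<omega>) :: real)" for i
    by (intro integrable_const_bound[where B = 1]) auto
  have ind: "expectation (\<lambda>\<omega>. indicator {x} (Z i \<omega>)) = pmf r x" for i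
    using sample_integral[of "indicator {x} :: 'a \<Rightarrow> real" i] by (simp add: measure_pmf_single)
  have mean: "expectation (\<xi> i) = 0" for i
    unfolding \<xi>_def using int3 ind[of i] by (simp add: prob_space)
  have var: "expectation (\<lambda>\<omega>. \<xi> i \<omega> * \<xi> i \<omega>) \<le> pmf r x" for i
  proof -
    have "\<xi> i \<omega> * \<xi> i \<omega> = (1 - 2 * pmf r x) * indicator {x} (Z i \<omega>) + (pmf r x)\<^sup>2" for \<omega>
      by (auto simp: \<xi>_def indicator_def power2_eq_square algebra_simps)
    then have "expectation (\<lambda>\<omega>. \<xi> i \<omega> * \<xi> i \<omega>) = (1 - 2 * pmf r x) * pmf r x + (pmf r x)\<^sup>2"
      using int3 ind[of i] by (simp add: prob_space)
    also have "\<dots> \<le> pmf r x" by (simp add: power2_eq_square algebra_simps)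
    finally show ?thesis .
  qed
  have cov: "expectation (\<lambda>\<omega>. \<xi> i \<omega> * \<xi> k \<omega>) = 0" if "i \<noteq> k" for i k
  proof -
    have "expectation (\<lambda>\<omega>. \<Prod>l\<in>{i, k}. \<xi> l \<omega>) = (\<Prod>l\<in>{i, k}. expectation (\<xi> l))"
      using sample_indep[of "\<lambda>_ y. indicator {x} y - pmf r x" "{i, k}"] int1
      unfolding \<xi>_def by (intro indep_vars_lebesgue_integral) simp_all
    then show ?thesis using that mean by simp
  qed
  let ?T = "\<lambda>\<omega>. \<Sum>i\<in>I. \<xi> i \<omega>"
  have sq: "(?T \<omega>)\<^sup>2 = (\<Sum>i\<in>I. \<Sum>k\<in>I. \<xi> i \<omega> * \<xi> k \<omega>)" for \<omega>
    unfolding power2_eq_square sum_product ..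
  have intT: "integrable M ?T" "integrable M (\<lambda>\<omega>. (?T \<omega>)\<^sup>2)"
    unfolding sq using int1 int2 by auto
  have "expectation (\<lambda>\<omega>. (?T \<omega>)\<^sup>2) = (\<Sum>i\<in>I. \<Sum>k\<in>I. expectation (\<lambda>\<omega>. \<xi> i \<omega> * \<xi> k \<omega>))"
    unfolding sq using int2 by (simp add: Bochner_Integration.integral_sum)
  also have "\<dots> = (\<Sum>i\<in>I. expectation (\<lambda>\<omega>. \<xi> i \<omega> * \<xi> i \<omega>))"
  proof (rule sum.cong[OF refl])
    fix i assume "i \<in> I"
    moreover have "(\<Sum>k\<in>I - {i}. expectation (\<lambda>\<omega>. \<xi> i \<omega> * \<xi> k \<omega>)) = 0"
      by (intro sum.neutral ballI cov) auto
    ultimately show "(\<Sum>k\<in>I. expectation (\<lambda>\<omega>. \<xi> i \<omega> * \<xi> k \<omega>)) = expectation (\<lambda>\<omega>. \<xi> i \<omega> * \<xi> i \<omega>)"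
      using sum.remove[OF assms(1), of i "\<lambda>k. expectation (\<lambda>\<omega>. \<xi> i \<omega> * \<xi> k \<omega>)"] by simp
  qed
  also have "\<dots> \<le> (\<Sum>i\<in>I. pmf r x)" by (intro sum_mono var)
  finally have T2: "expectation (\<lambda>\<omega>. (?T \<omega>)\<^sup>2) \<le> card I * pmf r x" by simp
  have card: "0 < card I" using assms by (simp add: card_gt_0_iff)
  have eq: "freq I \<omega> x - pmf r x = ?T \<omega> / card I" for \<omega>
    using card by (simp add: freq_def indicator_sample \<xi>_def sum_subtractf diff_divide_distrib)
  have "expectation (\<lambda>\<omega>. \<bar>freq I \<omega> x - pmf r x\<bar>) = expectation (\<lambda>\<omega>. \<bar>?T \<omega>\<bar>) / card I"
    unfolding eq by (simp add: abs_divide)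
  also have "\<dots> \<le> sqrt (card I * pmf r x) / card I"
    using expectation_abs_le_sqrt[OF intT] T2 by (intro divide_right_mono) (auto intro: order_trans)
  also have "\<dots> = sqrt (pmf r x / card I)"
  proof -
    have "card I * pmf r x = pmf r x / card I * (real (card I))\<^sup>2"
      using card by (simp add: power2_eq_square)
    then have "sqrt (card I * pmf r x) = sqrt (pmf r x / card I) * card I"
      by (simp only: real_sqrt_mult real_sqrt_abs abs_of_nat)
    then show ?thesis using card by simp
  qed
  finally show "expectation (\<lambda>\<omega>. \<bar>freq I \<omega> x - pmf r x\<bar>) \<le> sqrt (pmf r x / card I)" .
qed

end

section \<open>Reduction to finite subtrees\<close>

text \<open>The integrand restricted to \<open>- A n\<close> vanishes pointwise in the end and is
  dominated by \<open>f\<close> itself.\<close>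

lemma nn_integral_tail_tendsto:
  fixes f :: "'a \<Rightarrow> ennreal" and A :: "nat \<Rightarrow> 'a set"
  assumes "(\<integral>\<^sup>+x. f x \<partial>count_space UNIV) < \<top>" "\<And>x. \<forall>\<^sub>F n in sequentially. x \<in> A n"
  shows "(\<lambda>n. \<integral>\<^sup>+x. f x \<partial>count_space (- A n)) \<longlonglongrightarrow> 0"
proof -
  have "(\<lambda>n. \<integral>\<^sup>+x. f x * indicator (- A n) x \<partial>count_space UNIV) \<longlonglongrightarrow> (\<integral>\<^sup>+x. 0 \<partial>count_space (UNIV :: 'a set))"
  proof (rule nn_integral_dominated_convergence[where w = f])
    show "AE x in count_space UNIV. (\<lambda>n. f x * indicator (- A n) x) \<longlonglongrightarrow> 0"
    proof (rule AE_I2)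
      fix x
      have "\<forall>\<^sub>F n in sequentially. f x * indicator (- A n) x = 0"
        using assms(2)[of x] by eventually_elim simp
      then show "(\<lambda>n. f x * indicator (- A n) x) \<longlonglongrightarrow> 0" by (rule tendsto_eventually)
    qed
  qed (use assms(1) in \<open>auto simp: indicator_def\<close>)
  then show ?thesis by (simp add: nn_integral_count_space_indicator)
qed

lemma summable_on_imp_nn_integral_finite:
  fixes f :: "'a \<Rightarrow> real"
  assumes "f summable_on UNIV" "\<And>x. 0 \<le> f x"
  shows "(\<integral>\<^sup>+x. ennreal (f x) \<partial>count_space UNIV) < \<top>"
proof -
  have "Infinite_Sum.abs_summable_on f UNIV" using assms by simp
  then have "integrable (count_space UNIV) f"
    unfolding abs_summable_equivalent abs_summable_on_def .
  then show ?thesis using assms(2) by (simp add: integrable_iff_bounded)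
qed

lemma infsum_eq_integral:
  fixes f :: "'a \<Rightarrow> real"
  assumes "integrable (count_space A) f"
  shows "infsum f A = (\<integral>x. f x \<partial>count_space A)"
  using infsetsum_infsum[of f A] assms by (simp add: abs_summable_on_def infsetsum_def)

context wtree
begin

text \<open>Takes all ancestors of the first vertices in an enumeration. Such sets are finite by
  \<open>finite_ancestors\<close>, whereas balls around the root can be infinite when degrees
  are.\<close>

lemma exhausting_rooted_parts:
  assumes "countable (UNIV :: 'a set)"
  obtains A :: "nat \<Rightarrow> 'a set"
  where "\<And>n. rooted_part (A n)" "\<And>x. \<forall>\<^sub>F n in sequentially. x \<in> A n"
proof
  let ?A = "\<lambda>n. {rt} \<union> (\<Union>i\<le>n. {z. from_nat_into UNIV i \<in> ch z})"
  show "rooted_part (?A n)" for n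
  proof -
    have "v \<in> ch (par z)" if "v \<in> ch z" for v z
      using children_trans[OF that] children_rec[of z "par z"] by simp
    then show ?thesis unfolding rooted_part_def by (auto simp: finite_ancestors)
  qed
  show "\<forall>\<^sub>F n in sequentially. x \<in> ?A n" for x
  proof (rule eventually_sequentiallyI)
    fix n assume "to_nat_on UNIV x \<le> n"
    then show "x \<in> ?A n"
      using assms by (auto intro!: bexI[of _ "to_nat_on UNIV x"])
  qed
qed

text \<open>\<open>tree_Z\<close> before the root is taken, the scale on which
  \<open>trunc_Z\<close> approximates it.\<close>

definition Zsum :: "real \<Rightarrow> ('a \<Rightarrow> real) \<Rightarrow> real" where
  "Zsum p u = (\<Sum>\<^sub>\<infinity>x. \<bar>tree_S E rt u x\<bar> * td x (par x) powr p)"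

lemma ecost_pos:
  assumes "z \<noteq> rt"
  shows "0 < ecost p z"
proof -
  have "0 < td z (par z)"
    using dist_adj[OF parent_adj[OF assms]] weight_pos[OF parent_adj[OF assms]] by simp
  then show ?thesis by (simp add: ecost_def)
qed

lemma nn_integral_ancestors_le:
  assumes "1 \<le> p"
  shows "(\<integral>\<^sup>+z. ennreal (ecost p z) * indicator (ch z) x \<partial>count_space UNIV) \<le> ennreal (td x rt powr p)"
proof -
  let ?B = "{z. x \<in> ch z}"
  have "(\<integral>\<^sup>+z. ennreal (ecost p z) * indicator (ch z) x \<partial>count_space UNIV)
      = (\<Sum>z\<in>?B. ennreal (ecost p z) * indicator (ch z) x)"
    by (rule nn_integral_count_space') (auto simp: finite_ancestors)
  also have "\<dots> = (\<Sum>z\<in>?B. ennreal (ecost p z * indicator (ch z) x))"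
    by (intro sum.cong) auto
  also have "\<dots> = ennreal (\<Sum>z\<in>?B. ecost p z * indicator (ch z) x)"
    by (intro sum_ennreal) auto
  also have "\<dots> \<le> ennreal (td x rt powr p)"
    by (intro ennreal_leI sum_ecost_ancestors_le finite_ancestors assms)
  finally show ?thesis .
qed

text \<open>Cutting \<open>u\<close> off outside \<open>A\<close> changes the sum below
  \<open>z\<close> by at most the mass of \<open>\<bar>u\<bar>\<close> outside \<open>A\<close> and
  below \<open>z\<close>. Weighting with \<open>ecost p z\<close> and summing over \<open>z\<close>
  charges each outside vertex \<open>y\<close> for all edges above it, together at most
  \<open>td y rt powr p\<close>.\<close>

lemma Zsum_trunc_Z:
  assumes p: "1 \<le> p" and u: "u \<in> weighted_l1 td p rt" and A: "rooted_part A"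
  shows "ennreal \<bar>Zsum p u - trunc_Z p A u\<bar> \<le> tail p A u"
proof -
  let ?cs = "count_space (UNIV :: 'a set)"
  note fin = rooted_partD(1)[OF A]
  have nn: "(\<integral>\<^sup>+x. ennreal (td x rt powr p * \<bar>u x\<bar>) \<partial>?cs) < \<top>"
    using u by (intro summable_on_imp_nn_integral_finite) (auto simp: weighted_l1_def)
  have tail_fin: "tail p A u < \<top>"
  proof -
    have "tail p A u \<le> (\<integral>\<^sup>+x. ennreal (td x rt powr p * \<bar>u x\<bar>) \<partial>?cs)"
      unfolding tail_def by (simp add: nn_integral_count_space_indicator)
        (intro nn_integral_mono, auto simp: indicator_def)
    then show ?thesis using nn by (rule le_less_trans)
  qed
  \<comment> \<open>\<open>infsum\<close> is 0 for a series that is not summable, so summability has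
    to be checked. Away from the root \<open>ecost p z\<close> is positive and at most
    \<open>td y rt powr p\<close> for every \<open>y\<close> below \<open>z\<close>, which lets the
    weighted norm dominate.\<close>
  have int_u: "integrable ?cs (\<lambda>y. indicator (ch z) y * u y)" if "z \<noteq> rt" for z
  proof (rule integrableI_bounded)
    have pos: "0 < ecost p z" using that by (rule ecost_pos)
    have le: "\<bar>indicator (ch z) y * u y\<bar> \<le> 1 / ecost p z * (td y rt powr p * \<bar>u y\<bar>)" for y
    proof -
      have "ecost p z * indicator (ch z) y \<le> td y rt powr p"
        using sum_ecost_ancestors_le[OF _ p, of "{z}" y]
        by (simp only: sum.insert finite.intros empty_iff not_False_eq_True sum.empty add_0_right)
      then have "ecost p z * indicator (ch z) y * \<bar>u y\<bar> \<le> td y rt powr p * \<bar>u y\<bar>"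
        by (intro mult_right_mono) auto
      then show ?thesis using pos by (simp add: field_simps abs_mult)
    qed
    have "(\<integral>\<^sup>+y. ennreal (norm (indicator (ch z) y * u y)) \<partial>?cs)
        \<le> (\<integral>\<^sup>+y. ennreal (1 / ecost p z) * ennreal (td y rt powr p * \<bar>u y\<bar>) \<partial>?cs)"
      using le pos by (intro nn_integral_mono) (simp add: ennreal_mult[symmetric] ennreal_leI)
    also have "\<dots> = ennreal (1 / ecost p z) * (\<integral>\<^sup>+y. ennreal (td y rt powr p * \<bar>u y\<bar>) \<partial>?cs)"
      by (rule nn_integral_cmult) simp
    also have "\<dots> < \<top>" using nn by (simp add: ennreal_mult_less_top)
    finally show "(\<integral>\<^sup>+y. ennreal (norm (indicator (ch z) y * u y)) \<partial>?cs) < \<infinity>" by simp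
  qed simp
  define e where "e z = (\<integral>\<^sup>+y. ennreal (\<bar>u y\<bar> * indicator (- A) y) * (ennreal (ecost p z) * indicator (ch z) y) \<partial>?cs)" for z
  have diff: "ennreal \<bar>\<bar>tree_S E rt u z\<bar> * ecost p z - ecost p z * \<bar>trunc_S A u z\<bar>\<bar> \<le> e z" for z
  proof (cases "z = rt")
    case True
    then show ?thesis by simp
  next
    case False
    have "Infinite_Set_Sum.abs_summable_on u (ch z)"
      using int_u[OF False] by (simp add: abs_summable_on_altdef set_integrable_def)
    then have "integrable (count_space (ch z)) u"
      by (simp add: abs_summable_on_def)
    then have "tree_S E rt u z = (\<integral>y. u y \<partial>count_space (ch z))"
      unfolding tree_S_def by (rule infsum_eq_integral)
    also have "\<dots> = (\<integral>y. indicator (ch z) y * u y \<partial>?cs)"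
      using infsetsum_altdef[of u "ch z"] by (simp add: infsetsum_def set_lebesgue_integral_def)
    finally have S: "tree_S E rt u z = (\<integral>y. indicator (ch z) y * u y \<partial>?cs)" .
    have T: "trunc_S A u z = (\<integral>y. indicator (A \<inter> ch z) y * u y \<partial>?cs)"
      using count_space_indicator_finite(2)[of "A \<inter> ch z" u] fin by (simp add: trunc_S_def)
    have iT: "integrable ?cs (\<lambda>y. indicator (A \<inter> ch z) y * u y)"
      using fin by (intro count_space_indicator_finite) auto
    have ST: "tree_S E rt u z - trunc_S A u z = (\<integral>y. indicator (ch z) y * u y - indicator (A \<inter> ch z) y * u y \<partial>?cs)"
      unfolding S T using int_u[OF False] iT by simp
    have "ennreal \<bar>tree_S E rt u z - trunc_S A u z\<bar>
        \<le> (\<integral>\<^sup>+y. ennreal (norm (indicator (ch z) y * u y - indicator (A \<inter> ch z) y * u y)) \<partial>?cs)"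
      unfolding ST using integral_norm_bound_ennreal[OF Bochner_Integration.integrable_diff[OF int_u[OF False] iT]] by simp
    also have "\<dots> = (\<integral>\<^sup>+y. ennreal (\<bar>u y\<bar> * indicator (- A) y) * indicator (ch z) y \<partial>?cs)"
      by (intro nn_integral_cong) (auto simp: indicator_def)
    finally have 1: "ennreal \<bar>tree_S E rt u z - trunc_S A u z\<bar> \<le> (\<integral>\<^sup>+y. ennreal (\<bar>u y\<bar> * indicator (- A) y) * indicator (ch z) y \<partial>?cs)" .
    have "\<bar>\<bar>tree_S E rt u z\<bar> * ecost p z - ecost p z * \<bar>trunc_S A u z\<bar>\<bar> = ecost p z * \<bar>\<bar>tree_S E rt u z\<bar> - \<bar>trunc_S A u z\<bar>\<bar>"
    proof -
      have "\<bar>tree_S E rt u z\<bar> * ecost p z - ecost p z * \<bar>trunc_S A u z\<bar>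
          = ecost p z * (\<bar>tree_S E rt u z\<bar> - \<bar>trunc_S A u z\<bar>)"
        by (simp add: algebra_simps)
      then show ?thesis by (simp add: abs_mult)
    qed
    also have "\<dots> \<le> ecost p z * \<bar>tree_S E rt u z - trunc_S A u z\<bar>"
      by (intro mult_left_mono abs_triangle_ineq3) simp
    finally have "ennreal \<bar>\<bar>tree_S E rt u z\<bar> * ecost p z - ecost p z * \<bar>trunc_S A u z\<bar>\<bar>
        \<le> ennreal (ecost p z) * ennreal \<bar>tree_S E rt u z - trunc_S A u z\<bar>"
      by (simp add: ennreal_mult[symmetric] ennreal_leI)
    also have "\<dots> \<le> ennreal (ecost p z) * (\<integral>\<^sup>+y. ennreal (\<bar>u y\<bar> * indicator (- A) y) * indicator (ch z) y \<partial>?cs)"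
      using 1 by (rule mult_left_mono) simp
    also have "\<dots> = e z"
      unfolding e_def by (subst nn_integral_cmult[symmetric]) (auto simp: mult_ac)
    finally show ?thesis .
  qed
  have "(\<integral>\<^sup>+z. e z \<partial>?cs) = (\<integral>\<^sup>+y. \<integral>\<^sup>+z. ennreal (\<bar>u y\<bar> * indicator (- A) y) * (ennreal (ecost p z) * indicator (ch z) y) \<partial>?cs \<partial>?cs)"
    unfolding e_def
    using nn_integral_fst_count_space[of "\<lambda>(z, y). ennreal (\<bar>u y\<bar> * indicator (- A) y) * (ennreal (ecost p z) * indicator (ch z) y)"]
      nn_integral_snd_count_space[of "\<lambda>(z, y). ennreal (\<bar>u y\<bar> * indicator (- A) y) * (ennreal (ecost p z) * indicator (ch z) y)"]
    by simp
  also have "\<dots> = (\<integral>\<^sup>+y. ennreal (\<bar>u y\<bar> * indicator (- A) y) * (\<integral>\<^sup>+z. ennreal (ecost p z) * indicator (ch z) y \<partial>?cs) \<partial>?cs)"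
    by (intro nn_integral_cong nn_integral_cmult) simp
  also have "\<dots> \<le> (\<integral>\<^sup>+y. ennreal (\<bar>u y\<bar> * indicator (- A) y) * ennreal (td y rt powr p) \<partial>?cs)"
    by (intro nn_integral_mono mult_left_mono nn_integral_ancestors_le p) auto
  also have "\<dots> = (\<integral>\<^sup>+y. ennreal (td y rt powr p * \<bar>u y\<bar>) * indicator (- A) y \<partial>?cs)"
    by (intro nn_integral_cong) (auto simp: indicator_def ennreal_mult[symmetric] mult.commute)
  also have "\<dots> = tail p A u"
    by (simp add: tail_def nn_integral_count_space_indicator)
  finally have e_le: "(\<integral>\<^sup>+z. e z \<partial>?cs) \<le> tail p A u" .
  \<comment> \<open>A vertex outside \<open>A\<close> has no descendant in \<open>A\<close>, so the
    sum in \<open>trunc_Z\<close> extends to all vertices.\<close>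
  have S0: "trunc_S A u z = 0" if "z \<notin> A" for z
  proof -
    have "A \<inter> ch z = {}" using rooted_part_ancestor[OF A] that by blast
    then show ?thesis by (simp add: trunc_S_def)
  qed
  have Teq: "ecost p z * \<bar>trunc_S A u z\<bar> = indicator A z * (ecost p z * \<bar>trunc_S A u z\<bar>)" for z
    using S0 by (auto simp: indicator_def)
  have iT: "integrable ?cs (\<lambda>z. ecost p z * \<bar>trunc_S A u z\<bar>)"
    by (subst Teq) (rule count_space_indicator_finite(1)[OF fin])
  have vT: "(\<integral>z. ecost p z * \<bar>trunc_S A u z\<bar> \<partial>?cs) = trunc_Z p A u"
    unfolding trunc_Z_def by (subst Teq) (rule count_space_indicator_finite(2)[OF fin])
  have iD: "integrable ?cs (\<lambda>z. \<bar>tree_S E rt u z\<bar> * ecost p z - ecost p z * \<bar>trunc_S A u z\<bar>)"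
  proof (rule integrableI_bounded)
    have "(\<integral>\<^sup>+z. ennreal (norm (\<bar>tree_S E rt u z\<bar> * ecost p z - ecost p z * \<bar>trunc_S A u z\<bar>)) \<partial>?cs) \<le> (\<integral>\<^sup>+z. e z \<partial>?cs)"
      using diff by (intro nn_integral_mono) simp
    then show "(\<integral>\<^sup>+z. ennreal (norm (\<bar>tree_S E rt u z\<bar> * ecost p z - ecost p z * \<bar>trunc_S A u z\<bar>)) \<partial>?cs) < \<infinity>"
      using e_le tail_fin by (simp add: le_less_trans)
  qed simp
  have iZ: "integrable ?cs (\<lambda>z. \<bar>tree_S E rt u z\<bar> * ecost p z)"
    using Bochner_Integration.integrable_add[OF iD iT] by simp
  have "Zsum p u = (\<integral>z. \<bar>tree_S E rt u z\<bar> * ecost p z \<partial>?cs)"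
    unfolding Zsum_def ecost_def[symmetric] by (rule infsum_eq_integral[OF iZ])
  then have "Zsum p u - trunc_Z p A u = (\<integral>z. \<bar>tree_S E rt u z\<bar> * ecost p z - ecost p z * \<bar>trunc_S A u z\<bar> \<partial>?cs)"
    using iZ iT vT by simp
  then have "ennreal \<bar>Zsum p u - trunc_Z p A u\<bar> \<le> (\<integral>\<^sup>+z. ennreal (norm (\<bar>tree_S E rt u z\<bar> * ecost p z - ecost p z * \<bar>trunc_S A u z\<bar>)) \<partial>?cs)"
    using integral_norm_bound_ennreal[OF iD] by simp
  also have "\<dots> \<le> (\<integral>\<^sup>+z. e z \<partial>?cs)"
    using diff by (intro nn_integral_mono) simp
  also note e_le
  finally show ?thesis .
qed

section \<open>From deterministic bounds to characteristic functions\<close>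

lemma trunc_Z_cmult: "0 \<le> a \<Longrightarrow> trunc_Z p A (\<lambda>x. a * u x) = a * trunc_Z p A u"
  by (simp add: trunc_Z_def trunc_S_def sum_distrib_left[symmetric] abs_mult mult_ac)

lemma tail_cmult: "0 \<le> a \<Longrightarrow> tail p A (\<lambda>x. a * u x) = ennreal a * tail p A u"
  unfolding tail_def
  by (subst nn_integral_cmult[symmetric]) (auto simp: abs_mult ennreal_mult[symmetric] mult_ac)

text \<open>If the tail is finite, the upper bound makes the cost finite and \<open>enn2real\<close>
  loses nothing; if it is infinite, either \<open>a = 0\<close> or the right-hand side is
  infinite.\<close>

lemma wcost_trunc_Z_close:
  assumes A: "rooted_part A" and p: "1 \<le> p" and a: "0 \<le> a"
    and close: "\<And>x. x \<in> A \<Longrightarrow> of_nat (card A + 2) * l1dist \<eta> \<theta> \<le> ennreal (pmf \<eta> x)"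
  shows "ennreal \<bar>a * enn2real (wcost p \<eta> \<theta>) - trunc_Z p A (\<lambda>x. a * (pmf \<eta> x - pmf \<theta> x))\<bar>
    \<le> tail p A (\<lambda>x. a * (pmf \<eta> x - pmf \<theta> x))"
proof -
  define u where "u x = pmf \<eta> x - pmf \<theta> x" for x
  have up: "wcost p \<eta> \<theta> \<le> ennreal (trunc_Z p A u) + tail p A u"
    using wcost_le_trunc_Z[OF A p close] by (simp add: u_def[abs_def])
  have lo: "ennreal (trunc_Z p A u) \<le> wcost p \<eta> \<theta> + tail p A u"
    using trunc_Z_le_wcost[OF A p] by (simp add: u_def[abs_def])
  show ?thesis
    unfolding u_def[symmetric] trunc_Z_cmult[OF a] tail_cmult[OF a]
  proof (cases "tail p A u = \<top>")
    case True
    then show "ennreal \<bar>a * enn2real (wcost p \<eta> \<theta>) - a * trunc_Z p A u\<bar> \<le> ennreal a * tail p A u"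
      using a by (cases "a = 0") (auto simp: ennreal_mult_top)
  next
    case False
    then obtain T where T: "tail p A u = ennreal T" "0 \<le> T" by (cases "tail p A u") auto
    then have "wcost p \<eta> \<theta> < \<top>" using up by (auto intro: le_less_trans)
    then obtain W where W: "wcost p \<eta> \<theta> = ennreal W" "0 \<le> W" by (cases "wcost p \<eta> \<theta>") auto
    have "W \<le> trunc_Z p A u + T" "trunc_Z p A u \<le> W + T"
      using up lo T W trunc_Z_nonneg[of p A u] by (simp_all add: ennreal_plus[symmetric] del: ennreal_plus)
    then have "\<bar>a * W - a * trunc_Z p A u\<bar> \<le> a * T"
      using a by (simp add: right_diff_distrib[symmetric] abs_mult mult_left_mono)
    then show "ennreal \<bar>a * enn2real (wcost p \<eta> \<theta>) - a * trunc_Z p A u\<bar> \<le> ennreal a * tail p A u"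
      using a T W by (simp add: ennreal_mult[symmetric] ennreal_leI)
  qed
qed

lemma l1dist_triangle: "l1dist \<eta> \<theta> \<le> l1dist \<eta> r + l1dist \<theta> r"
proof -
  have "l1dist \<eta> \<theta> \<le> (\<integral>\<^sup>+x. ennreal \<bar>pmf \<eta> x - pmf r x\<bar> + ennreal \<bar>pmf \<theta> x - pmf r x\<bar> \<partial>count_space UNIV)"
    unfolding l1dist_def by (intro nn_integral_mono) (auto simp: ennreal_plus[symmetric] simp del: ennreal_plus intro!: ennreal_leI)
  then show ?thesis unfolding l1dist_def by (simp add: nn_integral_add)
qed

text \<open>If \<eta> and \<theta> are within \<delta> of \<open>r\<close>, the coupling bound
  applies. Otherwise the trivial bound 2 is at most \<open>2 / \<delta>\<close> times the l1
  distances, as in Markov's inequality, so that after integration only mean l1 distances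
  matter.\<close>

lemma cis_wcost_approx:
  assumes A: "rooted_part A" and p: "1 \<le> p" and full: "\<And>x. 0 < pmf r x"
  obtains \<delta> where "0 < \<delta>"
    "\<And>\<eta> \<theta> a \<tau>. 0 \<le> a \<Longrightarrow>
      ennreal (norm (cis (\<tau> * (a * enn2real (wcost p \<eta> \<theta>))) - cis (\<tau> * trunc_Z p A (\<lambda>x. a * (pmf \<eta> x - pmf \<theta> x)))))
      \<le> ennreal \<bar>\<tau>\<bar> * tail p A (\<lambda>x. a * (pmf \<eta> x - pmf \<theta> x)) + ennreal (2 / \<delta>) * (l1dist \<eta> r + l1dist \<theta> r)"
proof
  note fin = rooted_partD(1)[OF A]
  define m where "m = Min (pmf r ` A)"
  have ne: "A \<noteq> {}" using rooted_partD(2)[OF A] by auto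
  have m: "0 < m" "\<And>x. x \<in> A \<Longrightarrow> m \<le> pmf r x"
    using fin ne full by (auto simp: m_def)
  \<comment> \<open>With \<open>card A + 3\<close> in the denominator,
    \<open>(card A + 2) * \<delta> = m - \<delta>\<close>; the remaining \<delta> pays for replacing
    \<open>pmf r x\<close> by \<open>pmf \<eta> x\<close>.\<close>
  define \<delta> where "\<delta> = m / (card A + 3)"
  show "0 < \<delta>" using m by (simp add: \<delta>_def)
  fix \<eta> \<theta> and a \<tau> :: real assume a: "0 \<le> a"
  let ?L = "l1dist \<eta> r + l1dist \<theta> r"
  let ?U = "\<lambda>x. a * (pmf \<eta> x - pmf \<theta> x)"
  let ?d = "norm (cis (\<tau> * (a * enn2real (wcost p \<eta> \<theta>))) - cis (\<tau> * trunc_Z p A ?U))"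
  show "ennreal ?d \<le> ennreal \<bar>\<tau>\<bar> * tail p A ?U + ennreal (2 / \<delta>) * ?L"
  proof (cases "?L \<le> ennreal \<delta>")
    case True
    have "of_nat (card A + 2) * l1dist \<eta> \<theta> \<le> ennreal (pmf \<eta> x)" if "x \<in> A" for x
    proof -
      have "ennreal \<bar>pmf \<eta> x - pmf r x\<bar> \<le> l1dist \<eta> r"
        unfolding l1dist_def by (rule nn_integral_ge_point) simp
      also have "\<dots> \<le> ?L" by (simp add: add_increasing2)
      also note True
      finally have "\<bar>pmf \<eta> x - pmf r x\<bar> \<le> \<delta>" using \<open>0 < \<delta>\<close> by simp
      then have "pmf r x - \<delta> \<le> pmf \<eta> x" by linarith
      moreover have "real (card A + 2) * \<delta> = m - \<delta>" by (simp add: \<delta>_def field_simps)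
      ultimately have le: "real (card A + 2) * \<delta> \<le> pmf \<eta> x" using m(2)[OF that] by linarith
      have "of_nat (card A + 2) * l1dist \<eta> \<theta> \<le> of_nat (card A + 2) * ennreal \<delta>"
        using order_trans[OF l1dist_triangle True] by (intro mult_left_mono) auto
      also have "\<dots> = ennreal (real (card A + 2) * \<delta>)"
        using \<open>0 < \<delta>\<close> by (simp add: ennreal_mult ennreal_of_nat_eq_real_of_nat del: of_nat_add)
      also have "\<dots> \<le> ennreal (pmf \<eta> x)" using le by (rule ennreal_leI)
      finally show ?thesis .
    qed
    then have c: "ennreal \<bar>a * enn2real (wcost p \<eta> \<theta>) - trunc_Z p A ?U\<bar> \<le> tail p A ?U"
      by (rule wcost_trunc_Z_close[OF A p a])
    have "?d \<le> \<bar>\<tau> * (a * enn2real (wcost p \<eta> \<theta>)) - \<tau> * trunc_Z p A ?U\<bar>"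
      by (rule norm_cis_diff_le)
    also have "\<dots> = \<bar>\<tau>\<bar> * \<bar>a * enn2real (wcost p \<eta> \<theta>) - trunc_Z p A ?U\<bar>"
      by (simp add: abs_mult[symmetric] right_diff_distrib)
    finally have "ennreal ?d \<le> ennreal \<bar>\<tau>\<bar> * ennreal \<bar>a * enn2real (wcost p \<eta> \<theta>) - trunc_Z p A ?U\<bar>"
      by (simp add: ennreal_mult[symmetric] ennreal_leI)
    also have "\<dots> \<le> ennreal \<bar>\<tau>\<bar> * tail p A ?U"
      using c by (rule mult_left_mono) simp
    finally show ?thesis by (rule order_trans) simp
  next
    case False
    have "ennreal ?d \<le> ennreal 2" by (intro ennreal_leI norm_cis_diff_le_2)
    also have "\<dots> = ennreal (2 / \<delta>) * ennreal \<delta>"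
      using \<open>0 < \<delta>\<close> by (subst ennreal_mult[symmetric]) auto
    also have "\<dots> \<le> ennreal (2 / \<delta>) * ?L" using False by (intro mult_left_mono) auto
    finally show ?thesis by (rule order_trans) simp
  qed
qed

text \<open>Tonelli over countably many coordinates reduces the mean tail to the means of single
  coordinates.\<close>

lemma nn_integral_tail_le:
  assumes cnt: "countable (UNIV :: 'a set)" and W: "\<And>x. integrable L (W x)"
    and b: "\<And>x. (\<integral>\<omega>. \<bar>W x \<omega>\<bar> \<partial>L) \<le> b x"
  shows "(\<integral>\<^sup>+\<omega>. tail p A (\<lambda>x. W x \<omega>) \<partial>L) \<le> (\<integral>\<^sup>+x. ennreal (td x rt powr p * b x) \<partial>count_space (- A))"
proof -
  have [measurable]: "W x \<in> borel_measurable L" for x using W by auto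
  have "countable (- A)" using cnt by (rule countable_subset[rotated]) simp
  then have "(\<integral>\<^sup>+\<omega>. tail p A (\<lambda>x. W x \<omega>) \<partial>L)
      = (\<integral>\<^sup>+x. \<integral>\<^sup>+\<omega>. ennreal (td x rt powr p * \<bar>W x \<omega>\<bar>) \<partial>L \<partial>count_space (- A))"
    unfolding tail_def by (rule nn_integral_count_space_nn_integral) measurable
  also have "\<dots> \<le> (\<integral>\<^sup>+x. ennreal (td x rt powr p * b x) \<partial>count_space (- A))"
  proof (rule nn_integral_mono)
    fix x
    have "(\<integral>\<^sup>+\<omega>. ennreal (td x rt powr p * \<bar>W x \<omega>\<bar>) \<partial>L) = ennreal (td x rt powr p * (\<integral>\<omega>. \<bar>W x \<omega>\<bar> \<partial>L))"
      using W by (subst nn_integral_eq_integral) auto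
    also have "\<dots> \<le> ennreal (td x rt powr p * b x)"
      by (intro ennreal_leI mult_left_mono b) simp
    finally show "(\<integral>\<^sup>+\<omega>. ennreal (td x rt powr p * \<bar>W x \<omega>\<bar>) \<partial>L) \<le> ennreal (td x rt powr p * b x)" .
  qed
  finally show ?thesis .
qed

end

section \<open>The weak limit\<close>

context wtree
begin

lemma wasserstein_wcost: "wasserstein td p \<eta> \<theta> = enn2real (wcost p \<eta> \<theta>) powr (1 / p)"
  by (simp add: wasserstein_def wcost_def)

text \<open>Serves both parts of the theorem; the one-sample case has \<theta> constantly equal to
  \<open>r\<close>. The scale \<open>a j\<close> belongs to the p-th power of the distance and so
  gets the exponent \<open>1 / p\<close>. The l1 hypotheses make the coupling available,
  \<open>bound\<close> controls the tails, and \<open>clt\<close> gives the finite-dimensional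
  limits.\<close>

lemma wasserstein_weak_limit:
  fixes r :: "'a pmf" and M :: "'w measure" and N :: "'v measure" and G :: "'a \<Rightarrow> 'v \<Rightarrow> real"
    and \<eta> \<theta> :: "nat \<Rightarrow> 'w \<Rightarrow> 'a pmf" and a :: "nat \<Rightarrow> real"
  assumes cnt: "countable (UNIV :: 'a set)" and p: "1 \<le> p" and full: "\<And>x. 0 < pmf r x"
    and sm: "(\<lambda>x. td x rt powr p * sqrt (pmf r x)) summable_on UNIV"
    and M: "prob_space M" and gp: "centred_gaussian_process N G (multinomial_cov r)"
    and Gl1: "\<And>\<omega>. \<omega> \<in> space N \<Longrightarrow> (\<lambda>x. G x \<omega>) \<in> weighted_l1 td p rt"
    and a: "\<And>j. 0 \<le> a j"
    and meas: "\<And>j. (\<lambda>\<omega>. (\<eta> j \<omega>, \<theta> j \<omega>)) \<in> measurable M (count_space UNIV)"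
    and l1_\<eta>: "(\<lambda>j. \<integral>\<^sup>+\<omega>. l1dist (\<eta> j \<omega>) r \<partial>M) \<longlonglongrightarrow> 0"
    and l1_\<theta>: "(\<lambda>j. \<integral>\<^sup>+\<omega>. l1dist (\<theta> j \<omega>) r \<partial>M) \<longlonglongrightarrow> 0"
    and bound: "\<forall>\<^sub>F j in sequentially. \<forall>x. (\<integral>\<omega>. \<bar>a j * (pmf (\<eta> j \<omega>) x - pmf (\<theta> j \<omega>) x)\<bar> \<partial>M) \<le> 2 * sqrt (pmf r x)"
    and clt: "\<And>A t. finite A \<Longrightarrow>
      (\<lambda>j. \<integral>\<omega>. cis (\<Sum>x\<in>A. t x * (a j * (pmf (\<eta> j \<omega>) x - pmf (\<theta> j \<omega>) x))) \<partial>M)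
      \<longlonglongrightarrow> complex_of_real (exp (- ((\<Sum>x\<in>A. \<Sum>y\<in>A. t x * t y * multinomial_cov r x y) / 2)))"
  shows "weak_conv_m (\<lambda>j. distr M borel (\<lambda>\<omega>. a j powr (1 / p) * wasserstein td p (\<eta> j \<omega>) (\<theta> j \<omega>)))
    (distr N borel (\<lambda>\<omega>. tree_Z E w rt p (\<lambda>x. G x \<omega>)))"
proof -
  interpret M: prob_space M by fact
  interpret N: prob_space N using gp by (rule gaussian_prob_space)
  note [measurable] = gaussian_measurable[OF gp]
  define U where "U j x \<omega> = a j * (pmf (\<eta> j \<omega>) x - pmf (\<theta> j \<omega>) x)" for j x \<omega>
  define Q where "Q j \<omega> = a j * enn2real (wcost p (\<eta> j \<omega>) (\<theta> j \<omega>))" for j \<omega>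
  define QG where "QG \<omega> = Zsum p (\<lambda>x. G x \<omega>)" for \<omega>
  \<comment> \<open>By \<open>meas\<close> the pair is measurable for the discrete sigma-algebra, so
    every function of the two measures is measurable, including \<open>wcost\<close>, an infimum
    over couplings.\<close>
  have mF: "(\<lambda>\<omega>. F (\<eta> j \<omega>) (\<theta> j \<omega>)) \<in> borel_measurable M" for j and F :: "'a pmf \<Rightarrow> 'a pmf \<Rightarrow> 'c :: topological_space"
    using measurable_compose[OF meas[of j], of "\<lambda>z. F (fst z) (snd z)" borel] by simp
  have [measurable]: "U j x \<in> borel_measurable M" for j x
    unfolding U_def using mF[of "\<lambda>e t. a j * (pmf e x - pmf t x)"] .
  have [measurable]: "Q j \<in> borel_measurable M" for j
    unfolding Q_def using mF[of "\<lambda>e t. a j * enn2real (wcost p e t)"] .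
  have intU: "integrable M (U j x)" for j x
  proof (rule M.integrable_const_bound[where B = "a j"])
    have "\<bar>pmf (\<eta> j \<omega>) x - pmf (\<theta> j \<omega>) x\<bar> \<le> 1" for \<omega>
      using pmf_le_1[of "\<eta> j \<omega>" x] pmf_le_1[of "\<theta> j \<omega>" x] pmf_nonneg[of "\<eta> j \<omega>" x] pmf_nonneg[of "\<theta> j \<omega>" x]
      by linarith
    then show "AE \<omega> in M. norm (U j x \<omega>) \<le> a j"
      using mult_left_mono[OF _ a[of j]] a[of j] by (fastforce simp: U_def abs_mult)
  qed simp
  note intG = gaussian_integrable(1)[OF gp]
  have G_le: "(\<integral>\<omega>. \<bar>G x \<omega>\<bar> \<partial>N) \<le> 2 * sqrt (pmf r x)" for x
  proof -
    have "(\<integral>\<omega>. \<bar>G x \<omega>\<bar> \<partial>N) \<le> sqrt (pmf r x * (1 - pmf r x))"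
      using gaussian_abs_le[OF gp, of x] by (simp add: multinomial_cov_def)
    also have "\<dots> \<le> sqrt (pmf r x * 1)"
      by (intro real_sqrt_le_mono mult_left_mono) auto
    also have "\<dots> \<le> 2 * sqrt (pmf r x)" by simp
    finally show ?thesis .
  qed
  \<comment> \<open>One bound for the mean tails of both \<open>U j\<close> and \<open>G\<close>, by
    \<open>bound\<close> and \<open>G_le\<close>.\<close>
  define \<rho> where "\<rho> A = (\<integral>\<^sup>+x. ennreal (td x rt powr p * (2 * sqrt (pmf r x))) \<partial>count_space (- A))" for A
  obtain A where A: "\<And>n. rooted_part (A n)" "\<And>x. \<forall>\<^sub>F n in sequentially. x \<in> A n"
    using exhausting_rooted_parts[OF cnt] by blast
  have \<rho>: "(\<lambda>n. \<rho> (A n)) \<longlonglongrightarrow> 0"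
  proof -
    have "(\<lambda>x. 2 * (td x rt powr p * sqrt (pmf r x))) summable_on UNIV"
      using sm by (rule summable_on_cmult_right)
    then have "(\<integral>\<^sup>+x. ennreal (td x rt powr p * (2 * sqrt (pmf r x))) \<partial>count_space UNIV) < \<top>"
      by (intro summable_on_imp_nn_integral_finite) (auto simp: mult_ac)
    then show ?thesis unfolding \<rho>_def using A(2) by (rule nn_integral_tail_tendsto)
  qed
  \<comment> \<open>Measurability comes from the finite truncations, which converge at every point
    since the sample paths of \<open>G\<close> lie in the weighted l1 space.\<close>
  have [measurable]: "QG \<in> borel_measurable N"
  proof (rule borel_measurable_LIMSEQ_real)
    show "(\<lambda>\<omega>. trunc_Z p (A n) (\<lambda>x. G x \<omega>)) \<in> borel_measurable N" for n
      unfolding trunc_Z_def trunc_S_def by measurable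
    fix \<omega> assume \<omega>: "\<omega> \<in> space N"
    have tail0: "(\<lambda>n. tail p (A n) (\<lambda>x. G x \<omega>)) \<longlonglongrightarrow> 0"
      unfolding tail_def using Gl1[OF \<omega>]
      by (intro nn_integral_tail_tendsto A summable_on_imp_nn_integral_finite) (auto simp: weighted_l1_def)
    have "(\<lambda>n. ennreal \<bar>QG \<omega> - trunc_Z p (A n) (\<lambda>x. G x \<omega>)\<bar>) \<longlonglongrightarrow> 0"
    proof (rule tendsto_sandwich[OF _ _ tendsto_const tail0])
      show "\<forall>\<^sub>F n in sequentially. ennreal \<bar>QG \<omega> - trunc_Z p (A n) (\<lambda>x. G x \<omega>)\<bar> \<le> tail p (A n) (\<lambda>x. G x \<omega>)"
        unfolding QG_def by (intro always_eventually allI Zsum_trunc_Z[OF p Gl1[OF \<omega>] A(1)])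
    qed simp
    then have "(\<lambda>n. \<bar>QG \<omega> - trunc_Z p (A n) (\<lambda>x. G x \<omega>)\<bar>) \<longlonglongrightarrow> 0"
      by (subst (asm) ennreal_tendsto_0_iff) auto
    then have "(\<lambda>n. QG \<omega> - trunc_Z p (A n) (\<lambda>x. G x \<omega>)) \<longlonglongrightarrow> 0"
      by (rule tendsto_rabs_zero_cancel)
    from tendsto_diff[OF tendsto_const[of "QG \<omega>"] this]
    show "(\<lambda>n. trunc_Z p (A n) (\<lambda>x. G x \<omega>)) \<longlonglongrightarrow> QG \<omega>" by simp
  qed
  have weak: "weak_conv_m (\<lambda>j. distr M borel (Q j)) (distr N borel QG)"
  proof (rule levy_continuity)
    show "real_distribution (distr M borel (Q j))" for j by simp
    show "real_distribution (distr N borel QG)" by simp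
    fix \<tau> :: real
    have charM: "char (distr M borel (Q j)) \<tau> = (\<integral>\<omega>. cis (\<tau> * Q j \<omega>) \<partial>M)" for j
      unfolding char_def by (subst integral_distr) (auto simp: cis_conv_exp)
    have charN: "char (distr N borel QG) \<tau> = (\<integral>\<omega>. cis (\<tau> * QG \<omega>) \<partial>N)"
      unfolding char_def by (subst integral_distr) (auto simp: cis_conv_exp)
    have tendsto_ennreal_norm: "(\<lambda>j. ennreal (norm (char (distr M borel (Q j)) \<tau> - char (distr N borel QG) \<tau>))) \<longlonglongrightarrow> 0"
    proof (rule order_tendstoI)
      fix e :: ennreal assume e: "0 < e"
      \<comment> \<open>The subtree is chosen here, before \<open>j\<close>, and \<delta> below
        depends on it. The factor 2 counts one truncation error for the samples and one for the
        limit.\<close>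
      have "(\<lambda>n. 2 * ennreal \<bar>\<tau>\<bar> * \<rho> (A n)) \<longlonglongrightarrow> 2 * ennreal \<bar>\<tau>\<bar> * 0"
        by (intro ennreal_tendsto_cmult \<rho>) (simp add: ennreal_mult_less_top)
      then have "\<forall>\<^sub>F n in sequentially. 2 * ennreal \<bar>\<tau>\<bar> * \<rho> (A n) < e"
        using e by (intro order_tendstoD(2)) auto
      then obtain n where n: "2 * ennreal \<bar>\<tau>\<bar> * \<rho> (A n) < e"
        by (auto simp: eventually_sequentially)
      define B where "B = A n"
      have B: "rooted_part B" using A(1) by (simp add: B_def)
      note finB = rooted_partD(1)[OF B]
      define cU where "cU j = (\<integral>\<omega>. cis (\<tau> * trunc_Z p B (\<lambda>x. U j x \<omega>)) \<partial>M)" for j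
      define cG where "cG = (\<integral>\<omega>. cis (\<tau> * trunc_Z p B (\<lambda>x. G x \<omega>)) \<partial>N)"
      have [measurable]: "(\<lambda>\<omega>. trunc_Z p B (\<lambda>x. U j x \<omega>)) \<in> borel_measurable M" for j
        unfolding trunc_Z_def trunc_S_def by measurable
      have [measurable]: "(\<lambda>\<omega>. trunc_Z p B (\<lambda>x. G x \<omega>)) \<in> borel_measurable N"
        unfolding trunc_Z_def trunc_S_def by measurable
      have cUG: "cU \<longlonglongrightarrow> cG"
      proof -
        have tZ: "\<tau> * trunc_Z p B u = (\<Sum>z\<in>B. (\<tau> * ecost p z) * \<bar>\<Sum>x\<in>B. indicator (ch z) x * u x\<bar>)" for u
          by (simp add: trunc_Z_def trunc_S_indicator[OF finB] sum_distrib_left mult.assoc)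
        have two: "2 * sqrt (pmf r x) \<le> 2" for x by (simp add: pmf_le_1)
        show ?thesis
          unfolding cU_def cG_def tZ
        proof (rule cis_sum_abs_tendsto[OF M N.prob_space_axioms finB finB, where c = 2])
          show "\<forall>\<^sub>F j in sequentially. \<forall>x\<in>B. (\<integral>\<omega>. \<bar>U j x \<omega>\<bar> \<partial>M) \<le> 2"
            using bound unfolding U_def by eventually_elim (use two order_trans in blast)
          show "(\<integral>\<omega>. \<bar>G x \<omega>\<bar> \<partial>N) \<le> 2" for x
            using G_le two order_trans by blast
          show "(\<lambda>j. \<integral>\<omega>. cis (\<Sum>x\<in>B. t x * U j x \<omega>) \<partial>M) \<longlonglongrightarrow> (\<integral>\<omega>. cis (\<Sum>x\<in>B. t x * G x \<omega>) \<partial>N)" for t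
            unfolding gaussian_cis[OF gp finB] U_def by (rule clt[OF finB])
        qed (rule intU intG)+
      qed
      obtain \<delta> where \<delta>: "0 < \<delta>"
        "\<And>\<eta> \<theta> a \<tau>. 0 \<le> a \<Longrightarrow>
          ennreal (norm (cis (\<tau> * (a * enn2real (wcost p \<eta> \<theta>))) - cis (\<tau> * trunc_Z p B (\<lambda>x. a * (pmf \<eta> x - pmf \<theta> x)))))
          \<le> ennreal \<bar>\<tau>\<bar> * tail p B (\<lambda>x. a * (pmf \<eta> x - pmf \<theta> x)) + ennreal (2 / \<delta>) * (l1dist \<eta> r + l1dist \<theta> r)"
        by (rule cis_wcost_approx[OF B p full], rule that)
      define L where "L j = (\<integral>\<^sup>+\<omega>. l1dist (\<eta> j \<omega>) r \<partial>M) + (\<integral>\<^sup>+\<omega>. l1dist (\<theta> j \<omega>) r \<partial>M)" for j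
      have dM: "\<forall>\<^sub>F j in sequentially. ennreal (norm ((\<integral>\<omega>. cis (\<tau> * Q j \<omega>) \<partial>M) - cU j))
          \<le> ennreal \<bar>\<tau>\<bar> * \<rho> B + ennreal (2 / \<delta>) * L j"
        using bound
      proof eventually_elim
        case (elim j)
        have i: "integrable M (\<lambda>\<omega>. cis (\<tau> * Q j \<omega>) - cis (\<tau> * trunc_Z p B (\<lambda>x. U j x \<omega>)))"
          by (intro M.integrable_const_bound[where B = 2]) (auto simp: norm_cis_diff_le_2)
        have "(\<integral>\<omega>. cis (\<tau> * Q j \<omega>) \<partial>M) - cU j = (\<integral>\<omega>. cis (\<tau> * Q j \<omega>) - cis (\<tau> * trunc_Z p B (\<lambda>x. U j x \<omega>)) \<partial>M)"
          unfolding cU_def by (subst Bochner_Integration.integral_diff) (auto intro!: M.integrable_const_bound[where B = 1])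
        then have "ennreal (norm ((\<integral>\<omega>. cis (\<tau> * Q j \<omega>) \<partial>M) - cU j))
            \<le> (\<integral>\<^sup>+\<omega>. ennreal (norm (cis (\<tau> * Q j \<omega>) - cis (\<tau> * trunc_Z p B (\<lambda>x. U j x \<omega>)))) \<partial>M)"
          using integral_norm_bound_ennreal[OF i] by simp
        also have "\<dots> \<le> (\<integral>\<^sup>+\<omega>. ennreal \<bar>\<tau>\<bar> * tail p B (\<lambda>x. U j x \<omega>) + ennreal (2 / \<delta>) * (l1dist (\<eta> j \<omega>) r + l1dist (\<theta> j \<omega>) r) \<partial>M)"
          unfolding Q_def U_def by (intro nn_integral_mono \<delta>(2) a)
        also have "\<dots> = ennreal \<bar>\<tau>\<bar> * (\<integral>\<^sup>+\<omega>. tail p B (\<lambda>x. U j x \<omega>) \<partial>M) + ennreal (2 / \<delta>) * L j"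
        proof -
          have [measurable]: "(\<lambda>\<omega>. tail p B (\<lambda>x. U j x \<omega>)) \<in> borel_measurable M"
            unfolding U_def by (rule mF)
          have [measurable]: "(\<lambda>\<omega>. l1dist (\<eta> j \<omega>) r) \<in> borel_measurable M" "(\<lambda>\<omega>. l1dist (\<theta> j \<omega>) r) \<in> borel_measurable M"
            by (rule mF)+
          show ?thesis by (simp add: nn_integral_add nn_integral_cmult L_def)
        qed
        also have "\<dots> \<le> ennreal \<bar>\<tau>\<bar> * \<rho> B + ennreal (2 / \<delta>) * L j"
          unfolding \<rho>_def using elim
          by (intro add_right_mono mult_left_mono nn_integral_tail_le[OF cnt intU]) (auto simp: U_def)
        finally show ?case .
      qed
      have dN: "ennreal (norm ((\<integral>\<omega>. cis (\<tau> * QG \<omega>) \<partial>N) - cG)) \<le> ennreal \<bar>\<tau>\<bar> * \<rho> B"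
      proof -
        have i: "integrable N (\<lambda>\<omega>. cis (\<tau> * QG \<omega>) - cis (\<tau> * trunc_Z p B (\<lambda>x. G x \<omega>)))"
          by (intro N.integrable_const_bound[where B = 2]) (auto simp: norm_cis_diff_le_2)
        have "(\<integral>\<omega>. cis (\<tau> * QG \<omega>) \<partial>N) - cG = (\<integral>\<omega>. cis (\<tau> * QG \<omega>) - cis (\<tau> * trunc_Z p B (\<lambda>x. G x \<omega>)) \<partial>N)"
          unfolding cG_def by (subst Bochner_Integration.integral_diff) (auto intro!: N.integrable_const_bound[where B = 1])
        then have "ennreal (norm ((\<integral>\<omega>. cis (\<tau> * QG \<omega>) \<partial>N) - cG))
            \<le> (\<integral>\<^sup>+\<omega>. ennreal (norm (cis (\<tau> * QG \<omega>) - cis (\<tau> * trunc_Z p B (\<lambda>x. G x \<omega>)))) \<partial>N)"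
          using integral_norm_bound_ennreal[OF i] by simp
        also have "\<dots> \<le> (\<integral>\<^sup>+\<omega>. tail p B (\<lambda>x. \<bar>\<tau>\<bar> * G x \<omega>) \<partial>N)"
        proof (rule nn_integral_mono)
          fix \<omega> assume \<omega>: "\<omega> \<in> space N"
          have "norm (cis (\<tau> * QG \<omega>) - cis (\<tau> * trunc_Z p B (\<lambda>x. G x \<omega>))) \<le> \<bar>\<tau>\<bar> * \<bar>QG \<omega> - trunc_Z p B (\<lambda>x. G x \<omega>)\<bar>"
            using norm_cis_diff_le[of "\<tau> * QG \<omega>" "\<tau> * trunc_Z p B (\<lambda>x. G x \<omega>)"]
            by (simp add: abs_mult[symmetric] right_diff_distrib)
          then have "ennreal (norm (cis (\<tau> * QG \<omega>) - cis (\<tau> * trunc_Z p B (\<lambda>x. G x \<omega>))))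
              \<le> ennreal \<bar>\<tau>\<bar> * ennreal \<bar>QG \<omega> - trunc_Z p B (\<lambda>x. G x \<omega>)\<bar>"
            by (simp add: ennreal_mult[symmetric] ennreal_leI)
          also have "\<dots> \<le> ennreal \<bar>\<tau>\<bar> * tail p B (\<lambda>x. G x \<omega>)"
            unfolding QG_def by (intro mult_left_mono Zsum_trunc_Z[OF p Gl1[OF \<omega>] B]) simp
          also have "\<dots> = tail p B (\<lambda>x. \<bar>\<tau>\<bar> * G x \<omega>)" by (simp add: tail_cmult)
          finally show "ennreal (norm (cis (\<tau> * QG \<omega>) - cis (\<tau> * trunc_Z p B (\<lambda>x. G x \<omega>)))) \<le> tail p B (\<lambda>x. \<bar>\<tau>\<bar> * G x \<omega>)" .
        qed
        also have "\<dots> \<le> (\<integral>\<^sup>+x. ennreal (td x rt powr p * (\<bar>\<tau>\<bar> * (2 * sqrt (pmf r x)))) \<partial>count_space (- B))"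
          using G_le by (intro nn_integral_tail_le[OF cnt]) (auto simp: abs_mult intro!: mult_left_mono Bochner_Integration.integrable_mult_right intG)
        also have "\<dots> = ennreal \<bar>\<tau>\<bar> * \<rho> B"
          unfolding \<rho>_def by (subst nn_integral_cmult[symmetric]) (auto simp: ennreal_mult[symmetric] mult_ac)
        finally show ?thesis .
      qed
      \<comment> \<open>As \<open>j\<close> grows only the truncation error survives, and it is
        already below \<open>e\<close>: for fixed \<delta> the mean l1 distances vanish, and the
        truncated characteristic functions converge.\<close>
      have lim: "(\<lambda>j. 2 * ennreal \<bar>\<tau>\<bar> * \<rho> B + (ennreal (2 / \<delta>) * L j + ennreal (norm (cU j - cG))))
          \<longlonglongrightarrow> 2 * ennreal \<bar>\<tau>\<bar> * \<rho> B + (ennreal (2 / \<delta>) * (0 + 0) + ennreal 0)"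
        unfolding L_def
        by (intro tendsto_add tendsto_const ennreal_tendsto_cmult l1_\<eta> l1_\<theta> tendsto_ennrealI
            tendsto_norm_zero LIM_zero cUG) simp
      have "\<forall>\<^sub>F j in sequentially. 2 * ennreal \<bar>\<tau>\<bar> * \<rho> B + (ennreal (2 / \<delta>) * L j + ennreal (norm (cU j - cG))) < e"
        using n by (intro order_tendstoD(2)[OF lim]) (simp add: B_def)
      with dM show "\<forall>\<^sub>F j in sequentially. ennreal (norm (char (distr M borel (Q j)) \<tau> - char (distr N borel QG) \<tau>)) < e"
      proof eventually_elim
        case (elim j)
        let ?a = "(\<integral>\<omega>. cis (\<tau> * Q j \<omega>) \<partial>M)" and ?b = "(\<integral>\<omega>. cis (\<tau> * QG \<omega>) \<partial>N)"
        have "norm (?a - ?b) \<le> norm (?a - cU j) + norm (cU j - cG) + norm (?b - cG)"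
          using norm_triangle_ineq[of "?a - cU j" "cU j - cG"] norm_triangle_ineq4[of "?a - cU j + (cU j - cG)" "?b - cG"]
          by simp
        then have "ennreal (norm (?a - ?b)) \<le> ennreal (norm (?a - cU j)) + ennreal (norm (cU j - cG)) + ennreal (norm (?b - cG))"
          by (simp add: ennreal_plus[symmetric] ennreal_leI del: ennreal_plus)
        also have "\<dots> \<le> (ennreal \<bar>\<tau>\<bar> * \<rho> B + ennreal (2 / \<delta>) * L j) + ennreal (norm (cU j - cG)) + ennreal \<bar>\<tau>\<bar> * \<rho> B"
          using elim dN by (intro add_mono) auto
        also have "\<dots> = 2 * ennreal \<bar>\<tau>\<bar> * \<rho> B + (ennreal (2 / \<delta>) * L j + ennreal (norm (cU j - cG)))"
          by (simp add: mult_2 distrib_right add_ac)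
        also note elim(2)
        finally show ?case by (simp only: charM charN)
      qed
    qed simp
    then have "(\<lambda>j. norm (char (distr M borel (Q j)) \<tau> - char (distr N borel QG) \<tau>)) \<longlonglongrightarrow> 0"
      by (subst (asm) ennreal_tendsto_0_iff) auto
    then show "(\<lambda>j. char (distr M borel (Q j)) \<tau>) \<longlonglongrightarrow> char (distr N borel QG) \<tau>"
      by (rule LIM_zero_cancel[OF tendsto_norm_zero_cancel])
  qed
  \<comment> \<open>The absolute value makes the map continuous on the whole line;
    \<open>Q j\<close> and \<open>QG\<close> take nonnegative values only.\<close>
  define f where "f s = \<bar>s\<bar> powr (1 / p)" for s :: real
  have cont: "continuous_on UNIV f"
    unfolding f_def using p by (intro continuous_intros continuous_on_powr') auto
  have [measurable]: "f \<in> borel_measurable borel" using cont by (rule borel_measurable_continuous_onI)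
  have "weak_conv_m (\<lambda>j. distr (distr M borel (Q j)) borel f) (distr (distr N borel QG) borel f)"
    by (rule weak_conv_m_continuous_map[OF _ _ weak cont]) simp_all
  then have "weak_conv_m (\<lambda>j. distr M borel (f \<circ> Q j)) (distr N borel (f \<circ> QG))"
    by (simp add: distr_distr)
  moreover have "f \<circ> Q j = (\<lambda>\<omega>. a j powr (1 / p) * wasserstein td p (\<eta> j \<omega>) (\<theta> j \<omega>))" for j
    using a[of j] by (simp add: fun_eq_iff f_def Q_def wasserstein_wcost powr_mult abs_mult)
  moreover have "f \<circ> QG = (\<lambda>\<omega>. tree_Z E w rt p (\<lambda>x. G x \<omega>))"
  proof -
    have "0 \<le> Zsum p u" for u unfolding Zsum_def by (rule infsum_nonneg) simp
    then show ?thesis by (simp add: fun_eq_iff f_def QG_def tree_Z_def Zsum_def[symmetric])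
  qed
  ultimately show ?thesis by simp
qed

end

section \<open>Empirical measures\<close>

lemma empirical_cong:
  assumes "\<And>k. k < n \<Longrightarrow> xs k = ys k"
  shows "empirical n xs = empirical n ys"
proof -
  have "(\<lambda>x. (\<Sum>k<n. indicator {xs k} x) / real n) = (\<lambda>x. (\<Sum>k<n. indicator {ys k} x) / real n)"
    using assms by simp
  then show ?thesis unfolding empirical_def by metis
qed

context iid_sample
begin

text \<open>Lists over a countable type are countable, so preimages of single lists suffice, and
  these are finite intersections.\<close>

lemma sample_list_measurable: "(\<lambda>\<omega>. map (\<lambda>i. Z i \<omega>) is) \<in> measurable M (count_space UNIV)"
proof (subst measurable_count_space_eq2_countable, intro conjI ballI)
  fix l :: "'a list"
  show "(\<lambda>\<omega>. map (\<lambda>i. Z i \<omega>) is) -` {l} \<inter> space M \<in> sets M"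
  proof (induction "is" arbitrary: l)
    case Nil
    then show ?case by (cases l) auto
  next
    case (Cons i "is")
    show ?case
    proof (cases l)
      case Nil
      then have "(\<lambda>\<omega>. map (\<lambda>i. Z i \<omega>) (i # is)) -` {l} \<inter> space M = {}" by auto
      then show ?thesis by simp
    next
      case (Cons x xs)
      have "(\<lambda>\<omega>. map (\<lambda>i. Z i \<omega>) (i # is)) -` {l} \<inter> space M
        = (Z i -` {x} \<inter> space M) \<inter> ((\<lambda>\<omega>. map (\<lambda>i. Z i \<omega>) is) -` {xs} \<inter> space M)"
        using Cons by auto
      then show ?thesis
        using Cons.IH[of xs] measurable_sets[OF sample_measurable[of i], of "{x}"] by auto
    qed
  qed
qed auto

text \<open>Both measures are functions of one finite list of observations, and every function on
  that discrete space is measurable. For sample size 0 the unspecified measure is constant, so this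
  case is covered.\<close>

lemma empirical_pair_measurable:
  "(\<lambda>\<omega>. (empirical n (\<lambda>k. Z (f k) \<omega>), empirical m (\<lambda>k. Z (g k) \<omega>))) \<in> measurable M (count_space UNIV)"
proof -
  let ?is = "map f [0..<n] @ map g [0..<m]"
  have "(\<lambda>\<omega>. (\<lambda>l. (empirical n (\<lambda>k. l ! k), empirical m (\<lambda>k. l ! (n + k)))) (map (\<lambda>i. Z i \<omega>) ?is))
      \<in> measurable M (count_space UNIV)"
    by (rule measurable_compose[OF sample_list_measurable]) simp
  moreover have "(\<lambda>\<omega>. (empirical n (\<lambda>k. Z (f k) \<omega>), empirical m (\<lambda>k. Z (g k) \<omega>)))
      = (\<lambda>\<omega>. (\<lambda>l. (empirical n (\<lambda>k. l ! k), empirical m (\<lambda>k. l ! (n + k)))) (map (\<lambda>i. Z i \<omega>) ?is))"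
    by (auto simp: fun_eq_iff nth_append intro!: empirical_cong)
  ultimately show ?thesis by simp
qed

lemma pmf_empirical_freq:
  assumes "0 < n" "inj f"
  shows "pmf (empirical n (\<lambda>k. Z (f k) \<omega>)) x = freq (f ` {..<n}) \<omega> x"
  using assms by (simp add: pmf_empirical freq_def sum.reindex card_image inj_on_subset)

text \<open>Dominated convergence over the coordinates: \<open>2 * pmf r x\<close> is summable, and
  \<open>sqrt (pmf r x / n)\<close> tends to 0 for each \<open>x\<close>. Summing the second bound
  directly could fail, as the square roots without the distance factor may have an infinite
  sum.\<close>

lemma l1dist_freq_tendsto:
  fixes \<eta> :: "nat \<Rightarrow> 'w \<Rightarrow> 'a pmf" and I :: "nat \<Rightarrow> 'i set"
  assumes \<eta>: "\<forall>\<^sub>F j in sequentially. \<forall>\<omega> x. pmf (\<eta> j \<omega>) x = freq (I j) \<omega> x"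
    and card: "filterlim (\<lambda>j. card (I j)) at_top sequentially"
  shows "(\<lambda>j. \<integral>\<^sup>+\<omega>. l1dist (\<eta> j \<omega>) r \<partial>M) \<longlonglongrightarrow> 0"
proof -
  define g where "g j x = ennreal (min (2 * pmf r x) (sqrt (pmf r x / card (I j))))" for j x
  have card_pos: "\<forall>\<^sub>F j in sequentially. 0 < card (I j)"
    using eventually_compose_filterlim[OF eventually_gt_at_top card] .
  have upper: "\<forall>\<^sub>F j in sequentially. (\<integral>\<^sup>+\<omega>. l1dist (\<eta> j \<omega>) r \<partial>M) \<le> (\<integral>\<^sup>+x. g j x \<partial>count_space UNIV)"
    using \<eta> card_pos
  proof eventually_elim
    case (elim j)
    then have I: "finite (I j)" "I j \<noteq> {}" by (auto simp: card_gt_0_iff)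
    have "(\<integral>\<^sup>+\<omega>. l1dist (\<eta> j \<omega>) r \<partial>M)
        = (\<integral>\<^sup>+\<omega>. \<integral>\<^sup>+x. ennreal \<bar>freq (I j) \<omega> x - pmf r x\<bar> \<partial>count_space UNIV \<partial>M)"
      using elim by (simp add: l1dist_def)
    also have "\<dots> = (\<integral>\<^sup>+x. \<integral>\<^sup>+\<omega>. ennreal \<bar>freq (I j) \<omega> x - pmf r x\<bar> \<partial>M \<partial>count_space UNIV)"
      by (rule nn_integral_count_space_nn_integral) auto
    also have "\<dots> \<le> (\<integral>\<^sup>+x. g j x \<partial>count_space UNIV)"
    proof (rule nn_integral_mono)
      fix x
      have "(\<integral>\<^sup>+\<omega>. ennreal \<bar>freq (I j) \<omega> x - pmf r x\<bar> \<partial>M) = ennreal (expectation (\<lambda>\<omega>. \<bar>freq (I j) \<omega> x - pmf r x\<bar>))"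
        by (rule nn_integral_eq_integral) (auto simp: freq_integrable)
      also have "\<dots> \<le> g j x"
        unfolding g_def using expectation_abs_freq_le[OF I, of x] by (intro ennreal_leI) simp
      finally show "(\<integral>\<^sup>+\<omega>. ennreal \<bar>freq (I j) \<omega> x - pmf r x\<bar> \<partial>M) \<le> g j x" .
    qed
    finally show ?case .
  qed
  have "(\<lambda>j. \<integral>\<^sup>+x. g j x \<partial>count_space UNIV) \<longlonglongrightarrow> (\<integral>\<^sup>+x. 0 \<partial>count_space (UNIV :: 'a set))"
  proof (rule nn_integral_dominated_convergence[where w = "\<lambda>x. ennreal 2 * ennreal (pmf r x)"])
    show "AE x in count_space UNIV. g j x \<le> ennreal 2 * ennreal (pmf r x)" for j
      by (intro AE_I2) (auto simp: g_def ennreal_mult[symmetric] intro!: ennreal_leI simp del: ennreal_numeral)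
    show "(\<integral>\<^sup>+x. ennreal 2 * ennreal (pmf r x) \<partial>count_space UNIV) < \<infinity>"
      by (simp add: nn_integral_cmult nn_integral_pmf del: ennreal_numeral)
    show "AE x in count_space UNIV. (\<lambda>j. g j x) \<longlonglongrightarrow> 0"
    proof (rule AE_I2)
      fix x
      have "filterlim (\<lambda>j. real (card (I j))) at_top sequentially"
        by (rule filterlim_compose[OF filterlim_real_sequentially card])
      then have "(\<lambda>j. pmf r x / card (I j)) \<longlonglongrightarrow> 0"
        by (intro tendsto_divide_0[OF tendsto_const] filterlim_at_top_imp_at_infinity)
      then have "(\<lambda>j. min (2 * pmf r x) (sqrt (pmf r x / card (I j)))) \<longlonglongrightarrow> min (2 * pmf r x) (sqrt 0)"
        by (intro tendsto_min tendsto_const tendsto_real_sqrt)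
      then have "(\<lambda>j. min (2 * pmf r x) (sqrt (pmf r x / card (I j)))) \<longlonglongrightarrow> 0" by simp
      then show "(\<lambda>j. g j x) \<longlonglongrightarrow> 0"
        unfolding g_def by (metis tendsto_ennrealI ennreal_0)
    qed
  qed auto
  then have lim: "(\<lambda>j. \<integral>\<^sup>+x. g j x \<partial>count_space UNIV) \<longlonglongrightarrow> 0" by simp
  show ?thesis
    by (rule tendsto_sandwich[OF _ upper tendsto_const lim]) simp
qed

text \<open>A linear combination of centred frequencies is the average of this function over the
  sample, which reduces joint convergence to a one-dimensional limit theorem.\<close>

definition contrast :: "'a set \<Rightarrow> ('a \<Rightarrow> real) \<Rightarrow> 'a \<Rightarrow> real" where
  "contrast A t x = (\<Sum>y\<in>A. t y * (indicator {y} x - pmf r y))"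

lemma sum_freq_contrast:
  assumes "finite I" "I \<noteq> {}"
  shows "(\<Sum>y\<in>A. t y * (freq I \<omega> y - pmf r y)) = (\<Sum>i\<in>I. contrast A t (Z i \<omega>)) / card I"
proof -
  have card: "0 < card I" using assms by (simp add: card_gt_0_iff)
  have "freq I \<omega> y - pmf r y = (\<Sum>i\<in>I. indicator {y} (Z i \<omega>) - pmf r y) / card I" for y
    using card by (simp add: freq_def indicator_sample sum_subtractf diff_divide_distrib)
  then have "(\<Sum>y\<in>A. t y * (freq I \<omega> y - pmf r y)) = (\<Sum>y\<in>A. \<Sum>i\<in>I. t y * (indicator {y} (Z i \<omega>) - pmf r y)) / card I"
    by (simp add: sum_divide_distrib sum_distrib_left)
  also have "\<dots> = (\<Sum>i\<in>I. contrast A t (Z i \<omega>)) / card I"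
    unfolding contrast_def by (subst sum.swap) simp
  finally show ?thesis .
qed

lemma contrast_bounded: "\<bar>contrast A t x\<bar> \<le> (\<Sum>y\<in>A. \<bar>t y\<bar>)"
proof -
  have "\<bar>contrast A t x\<bar> \<le> (\<Sum>y\<in>A. \<bar>t y * (indicator {y} x - pmf r y)\<bar>)"
    unfolding contrast_def by (rule sum_abs)
  also have "\<dots> \<le> (\<Sum>y\<in>A. \<bar>t y\<bar> * 1)"
  proof (rule sum_mono)
    fix y
    have "- 1 \<le> pmf r y" using pmf_nonneg[of r y] by linarith
    then have "\<bar>indicator {y} x - pmf r y\<bar> \<le> 1"
      using pmf_le_1[of r y] by (simp add: indicator_def abs_le_iff)
    then show "\<bar>t y * (indicator {y} x - pmf r y)\<bar> \<le> \<bar>t y\<bar> * 1"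
      unfolding abs_mult by (intro mult_left_mono) auto
  qed
  finally show ?thesis by simp
qed

lemma pmf_bounded_integrable: "integrable (measure_pmf r) h" if "\<And>x. \<bar>h x\<bar> \<le> b" for h :: "'a \<Rightarrow> real"
  by (rule measure_pmf.integrable_const_bound[where B = b]) (simp_all add: that)

lemma integral_indicator_singleton: "(\<integral>x. indicator {y} x \<partial>measure_pmf r) = pmf r y"
  by (simp add: measure_pmf_single)

lemma contrast_mean: "(\<integral>x. contrast A t x \<partial>measure_pmf r) = 0"
proof -
  have i: "integrable (measure_pmf r) (indicator {y} :: 'a \<Rightarrow> real)" for y
    by (rule pmf_bounded_integrable[where b = 1]) simp
  show ?thesis
    unfolding contrast_def using i integral_indicator_singleton
    by (subst Bochner_Integration.integral_sum) simp_all
qed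

text \<open>Indicators of distinct points have product 0, which leaves minus the product of the two
  masses off the diagonal.\<close>

lemma contrast_variance:
  "(\<integral>x. (contrast A t x)\<^sup>2 \<partial>measure_pmf r) = (\<Sum>x\<in>A. \<Sum>y\<in>A. t x * t y * multinomial_cov r x y)"
proof -
  have i: "integrable (measure_pmf r) (indicator {y} :: 'a \<Rightarrow> real)" for y
    by (rule pmf_bounded_integrable[where b = 1]) simp
  have prod: "(indicator {y} x - pmf r y) * (indicator {z} x - pmf r z)
      = (if y = z then 1 else 0) * indicator {y} x - pmf r z * indicator {y} x - pmf r y * indicator {z} x + pmf r y * pmf r z" for x y z
    by (auto simp: indicator_def algebra_simps)
  have cov: "integrable (measure_pmf r) (\<lambda>x. (indicator {y} x - pmf r y) * (indicator {z} x - pmf r z))"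
    "(\<integral>x. (indicator {y} x - pmf r y) * (indicator {z} x - pmf r z) \<partial>measure_pmf r) = multinomial_cov r y z" for y z
    unfolding prod using i integral_indicator_singleton
    by (simp_all add: multinomial_cov_def algebra_simps)
  have sq: "(contrast A t x)\<^sup>2 = (\<Sum>y\<in>A. \<Sum>z\<in>A. t y * t z * ((indicator {y} x - pmf r y) * (indicator {z} x - pmf r z)))" for x
    unfolding contrast_def power2_eq_square sum_product by (simp add: mult_ac)
  show ?thesis
    unfolding sq using cov by (simp add: Bochner_Integration.integral_sum)
qed

definition contrast_char :: "'a set \<Rightarrow> ('a \<Rightarrow> real) \<Rightarrow> real \<Rightarrow> complex" where
  "contrast_char A t s = (\<integral>x. cis (s * contrast A t x) \<partial>measure_pmf r)"

lemma contrast_char_tendsto: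
  fixes s :: "nat \<Rightarrow> real" and n :: "nat \<Rightarrow> nat"
  assumes "s \<longlonglongrightarrow> s0" "filterlim n at_top sequentially"
  shows "(\<lambda>j. contrast_char A t (s j / sqrt (n j)) ^ n j)
    \<longlonglongrightarrow> complex_of_real (exp (- (s0\<^sup>2 * (\<Sum>x\<in>A. \<Sum>y\<in>A. t x * t y * multinomial_cov r x y) / 2)))"
  using measure_pmf.clt_power[OF _ contrast_bounded contrast_mean assms, of A t]
  unfolding contrast_char_def contrast_variance by simp

text \<open>The two samples are disjoint index sets of one independent family, so everything
  factorises at once; an empty \<open>J\<close> gives the one-sample case.\<close>

lemma expectation_cis_contrast:
  assumes "finite I" "finite J" "I \<inter> J = {}"
  shows "expectation (\<lambda>\<omega>. cis (b * (\<Sum>i\<in>I. contrast A t (Z i \<omega>)) + c * (\<Sum>i\<in>J. contrast A t (Z i \<omega>))))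
    = contrast_char A t b ^ card I * contrast_char A t c ^ card J"
proof -
  define s where "s i = (if i \<in> I then b else c)" for i
  have "b * (\<Sum>i\<in>I. contrast A t (Z i \<omega>)) + c * (\<Sum>i\<in>J. contrast A t (Z i \<omega>))
      = (\<Sum>i\<in>I \<union> J. s i * contrast A t (Z i \<omega>))" for \<omega>
  proof -
    have "(\<Sum>i\<in>J. s i * contrast A t (Z i \<omega>)) = (\<Sum>i\<in>J. c * contrast A t (Z i \<omega>))"
      using assms(3) by (intro sum.cong) (auto simp: s_def)
    then show ?thesis
      using assms by (simp add: sum.union_disjoint sum_distrib_left) (simp add: s_def)
  qed
  then have "expectation (\<lambda>\<omega>. cis (b * (\<Sum>i\<in>I. contrast A t (Z i \<omega>)) + c * (\<Sum>i\<in>J. contrast A t (Z i \<omega>))))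
      = (\<Prod>i\<in>I \<union> J. contrast_char A t (s i))"
    using sample_cis[of "I \<union> J" s "contrast A t"] assms by (simp add: contrast_char_def)
  also have "\<dots> = (\<Prod>i\<in>I. contrast_char A t (s i)) * (\<Prod>i\<in>J. contrast_char A t (s i))"
    using assms by (intro prod.union_disjoint) auto
  also have "(\<Prod>i\<in>I. contrast_char A t (s i)) = contrast_char A t b ^ card I"
    by (simp add: s_def)
  also have "(\<Prod>i\<in>J. contrast_char A t (s i)) = (\<Prod>i\<in>J. contrast_char A t c)"
    using assms(3) by (intro prod.cong) (auto simp: s_def)
  finally show ?thesis by simp
qed

end

section \<open>The one-sample and two-sample limits\<close>

lemma sqrt_powr: "0 \<le> x \<Longrightarrow> sqrt x powr (1 / p) = x powr (1 / (2 * p))"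
  by (simp add: powr_half_sqrt[symmetric] powr_powr)

theorem theorem3p1:
  fixes E :: "'a :: countable set set" and w :: "'a set \<Rightarrow> real" and rt :: 'a
    and p :: real and r :: "'a pmf"
    and M :: "'w measure" and X Y :: "nat \<Rightarrow> 'w \<Rightarrow> 'a"
    and N :: "'v measure" and G :: "'a \<Rightarrow> 'v \<Rightarrow> real"
  assumes "weighted_tree E w"
    and "1 \<le> p"
    and "r \<in> pmf_moment (tree_dist E w) p rt"
    and "\<forall>x. 0 < pmf r x"
    and "(\<lambda>x. tree_dist E w x rt powr p * sqrt (pmf r x)) summable_on UNIV"
    and "prob_space M"
    and "prob_space.indep_vars M (\<lambda>_. count_space UNIV) (case_sum X Y) UNIV"
    and "\<forall>k. distr M (count_space UNIV) (X k) = measure_pmf r"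
    and "\<forall>k. distr M (count_space UNIV) (Y k) = measure_pmf r"
    and "centred_gaussian_process N G (multinomial_cov r)"
    and "\<forall>\<omega>\<in>space N. (\<lambda>x. G x \<omega>) \<in> weighted_l1 (tree_dist E w) p rt"
  shows
    "weak_conv_m
       (\<lambda>n. distr M borel (\<lambda>\<omega>. real n powr (1 / (2 * p)) *
              wasserstein (tree_dist E w) p (empirical n (\<lambda>k. X k \<omega>)) r))
       (distr N borel (\<lambda>\<omega>. tree_Z E w rt p (\<lambda>x. G x \<omega>)))
     \<and>
     (\<forall>(n :: nat \<Rightarrow> nat) (m :: nat \<Rightarrow> nat) (\<alpha> :: real).
        filterlim (\<lambda>j. min (n j) (m j)) at_top sequentially \<longrightarrow>
        \<alpha> \<in> {0..1} \<longrightarrow>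
        (\<lambda>j. real (n j) / (real (n j) + real (m j))) \<longlonglongrightarrow> \<alpha> \<longrightarrow>
        weak_conv_m
          (\<lambda>j. distr M borel (\<lambda>\<omega>.
                 (real (n j) * real (m j) / (real (n j) + real (m j))) powr (1 / (2 * p)) *
                 wasserstein (tree_dist E w) p (empirical (n j) (\<lambda>k. X k \<omega>)) (empirical (m j) (\<lambda>k. Y k \<omega>))))
          (distr N borel (\<lambda>\<omega>. tree_Z E w rt p (\<lambda>x. G x \<omega>))))"
proof -
  interpret wtree E w rt by unfold_locales (rule assms(1))
  \<comment> \<open>Joining the samples puts their mutual independence into
    \<open>iid_sample\<close>.\<close>
  define Z where "Z = case_sum X Y"
  interpret prob_space M by fact
  interpret iid_sample M Z r
  proof
    show "indep_vars (\<lambda>_. count_space UNIV) Z UNIV" unfolding Z_def by (rule assms(7))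
    show "distr M (count_space UNIV) (Z i) = measure_pmf r" for i
      using assms(8,9) by (cases i) (auto simp: Z_def)
  qed
  define I where "I n = (Inl :: nat \<Rightarrow> nat + nat) ` {..<n}" for n
  define J where "J n = (Inr :: nat \<Rightarrow> nat + nat) ` {..<n}" for n
  have IJ: "finite (I n)" "finite (J n)" "card (I n) = n" "card (J n) = n" "I n \<inter> J m = {}"
    "0 < n \<Longrightarrow> I n \<noteq> {}" "0 < n \<Longrightarrow> J n \<noteq> {}" for n m
    by (auto simp: I_def J_def card_image)
  have X: "X k \<omega> = Z (Inl k) \<omega>" and Y: "Y k \<omega> = Z (Inr k) \<omega>" for k \<omega>
    by (auto simp: Z_def)
  have emp_X: "pmf (empirical n (\<lambda>k. X k \<omega>)) x = freq (I n) \<omega> x" if "0 < n" for n \<omega> x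
    unfolding X I_def using that by (intro pmf_empirical_freq) auto
  have emp_Y: "pmf (empirical n (\<lambda>k. Y k \<omega>)) x = freq (J n) \<omega> x" if "0 < n" for n \<omega> x
    unfolding Y J_def using that by (intro pmf_empirical_freq) auto
  note limit = wasserstein_weak_limit[OF countableI_type assms(2) assms(4)[rule_format] assms(5,6,10) assms(11)[rule_format]]
  have one: "weak_conv_m
       (\<lambda>n. distr M borel (\<lambda>\<omega>. sqrt (real n) powr (1 / p) * wasserstein td p (empirical n (\<lambda>k. X k \<omega>)) r))
       (distr N borel (\<lambda>\<omega>. tree_Z E w rt p (\<lambda>x. G x \<omega>)))"
  proof (rule limit)
    show "0 \<le> sqrt (real n)" for n by simp
    show "(\<lambda>\<omega>. (empirical n (\<lambda>k. X k \<omega>), r)) \<in> measurable M (count_space UNIV)" for n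
      using measurable_compose[OF empirical_pair_measurable[of n Inl 0 Inr], of "\<lambda>z. (fst z, r)" "count_space UNIV"]
      by (simp add: X)
    show "(\<lambda>n. \<integral>\<^sup>+\<omega>. l1dist (empirical n (\<lambda>k. X k \<omega>)) r \<partial>M) \<longlonglongrightarrow> 0"
      by (rule l1dist_freq_tendsto[where I = I])
        (auto simp: IJ intro: eventually_mono[OF eventually_gt_at_top[of 0]] emp_X filterlim_ident)
    show "(\<lambda>n. \<integral>\<^sup>+\<omega>. l1dist r r \<partial>M) \<longlonglongrightarrow> 0" by (simp add: l1dist_def)
    show "\<forall>\<^sub>F n in sequentially. \<forall>x. (\<integral>\<omega>. \<bar>sqrt (real n) * (pmf (empirical n (\<lambda>k. X k \<omega>)) x - pmf r x)\<bar> \<partial>M) \<le> 2 * sqrt (pmf r x)"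
      using eventually_gt_at_top[of "0::nat"]
    proof eventually_elim
      case (elim n)
      show ?case
      proof
        fix x
        have "(\<integral>\<omega>. \<bar>sqrt (real n) * (pmf (empirical n (\<lambda>k. X k \<omega>)) x - pmf r x)\<bar> \<partial>M)
            = sqrt n * expectation (\<lambda>\<omega>. \<bar>freq (I n) \<omega> x - pmf r x\<bar>)"
          using elim by (simp add: emp_X abs_mult)
        also have "\<dots> \<le> sqrt n * sqrt (pmf r x / n)"
          using expectation_abs_freq_le(2)[OF IJ(1) IJ(6)[OF elim], of x] by (intro mult_left_mono) (auto simp: IJ)
        also have "\<dots> = sqrt (pmf r x)"
          using elim by (simp add: real_sqrt_mult[symmetric])
        also have "\<dots> \<le> 2 * sqrt (pmf r x)" by simp
        finally show "(\<integral>\<omega>. \<bar>sqrt (real n) * (pmf (empirical n (\<lambda>k. X k \<omega>)) x - pmf r x)\<bar> \<partial>M) \<le> 2 * sqrt (pmf r x)" .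
      qed
    qed
    fix A :: "'a set" and t :: "'a \<Rightarrow> real" assume "finite A"
    let ?v = "\<Sum>x\<in>A. \<Sum>y\<in>A. t x * t y * multinomial_cov r x y"
    have "(\<lambda>n. contrast_char A t (1 / sqrt n) ^ n) \<longlonglongrightarrow> complex_of_real (exp (- (1\<^sup>2 * ?v / 2)))"
      by (rule contrast_char_tendsto) (auto intro: filterlim_ident)
    moreover have "\<forall>\<^sub>F n in sequentially. contrast_char A t (1 / sqrt n) ^ n
        = (\<integral>\<omega>. cis (\<Sum>x\<in>A. t x * (sqrt n * (pmf (empirical n (\<lambda>k. X k \<omega>)) x - pmf r x))) \<partial>M)"
      using eventually_gt_at_top[of "0::nat"]
    proof eventually_elim
      case (elim n)
      \<comment> \<open>The empty second sum fits the expression to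
        \<open>expectation_cis_contrast\<close>.\<close>
      have "(\<Sum>x\<in>A. t x * (sqrt n * (pmf (empirical n (\<lambda>k. X k \<omega>)) x - pmf r x)))
          = 1 / sqrt n * (\<Sum>i\<in>I n. contrast A t (Z i \<omega>)) + 0 * (\<Sum>i\<in>{}. contrast A t (Z i \<omega>))" for \<omega>
      proof -
        have "(\<Sum>x\<in>A. t x * (sqrt n * (pmf (empirical n (\<lambda>k. X k \<omega>)) x - pmf r x)))
            = sqrt n * (\<Sum>x\<in>A. t x * (freq (I n) \<omega> x - pmf r x))"
          using elim by (simp add: emp_X sum_distrib_left mult_ac)
        also have "\<dots> = sqrt n / n * (\<Sum>i\<in>I n. contrast A t (Z i \<omega>))"
          unfolding sum_freq_contrast[OF IJ(1) IJ(6)[OF elim]] by (simp add: IJ)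
        also have "sqrt n / n = 1 / sqrt n"
          using elim by (simp add: field_simps)
        finally show ?thesis by simp
      qed
      then show ?case
        using expectation_cis_contrast[of "I n" "{}" "1 / sqrt n" A t 0] by (simp add: IJ)
    qed
    ultimately have "(\<lambda>n. \<integral>\<omega>. cis (\<Sum>x\<in>A. t x * (sqrt n * (pmf (empirical n (\<lambda>k. X k \<omega>)) x - pmf r x))) \<partial>M)
        \<longlonglongrightarrow> complex_of_real (exp (- (1\<^sup>2 * ?v / 2)))"
      by (rule Lim_transform_eventually)
    then show "(\<lambda>n. \<integral>\<omega>. cis (\<Sum>x\<in>A. t x * (sqrt n * (pmf (empirical n (\<lambda>k. X k \<omega>)) x - pmf r x))) \<partial>M)
        \<longlonglongrightarrow> complex_of_real (exp (- (?v / 2)))"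
      by simp
  qed
  have two: "weak_conv_m
       (\<lambda>j. distr M borel (\<lambda>\<omega>. sqrt (real (n j) * real (m j) / (real (n j) + real (m j))) powr (1 / p) *
          wasserstein td p (empirical (n j) (\<lambda>k. X k \<omega>)) (empirical (m j) (\<lambda>k. Y k \<omega>))))
       (distr N borel (\<lambda>\<omega>. tree_Z E w rt p (\<lambda>x. G x \<omega>)))"
    if nm: "filterlim (\<lambda>j. min (n j) (m j)) at_top sequentially" and \<alpha>: "\<alpha> \<in> {0..1}"
      and ratio: "(\<lambda>j. real (n j) / (real (n j) + real (m j))) \<longlonglongrightarrow> \<alpha>"
    for n m :: "nat \<Rightarrow> nat" and \<alpha> :: real
  proof (rule limit)
    have n: "filterlim n at_top sequentially" and m: "filterlim m at_top sequentially"
      by (rule filterlim_at_top_mono[OF nm], simp)+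
    have n0: "\<forall>\<^sub>F j in sequentially. 0 < n j" and m0: "\<forall>\<^sub>F j in sequentially. 0 < m j"
      using eventually_compose_filterlim[OF eventually_gt_at_top n] eventually_compose_filterlim[OF eventually_gt_at_top m] .
    \<comment> \<open>\<open>b j\<close> and \<open>c j\<close> are the weights of the two samples
      after each is normalised by the square root of its size; their squares add up to 1 once the
      samples are nonempty.\<close>
    define a where "a j = sqrt (real (n j) * real (m j) / (real (n j) + real (m j)))" for j
    define b where "b j = sqrt (real (m j) / (real (n j) + real (m j)))" for j
    define c where "c j = sqrt (real (n j) / (real (n j) + real (m j)))" for j
    have ab: "a j / n j = b j / sqrt (n j)" "a j = b j * sqrt (n j)"
      and ac: "a j / m j = c j / sqrt (m j)" "a j = c j * sqrt (m j)" if "0 < n j" "0 < m j" for j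
    proof -
      show 1: "a j = b j * sqrt (n j)" "a j = c j * sqrt (m j)"
        unfolding a_def b_def c_def real_sqrt_mult[symmetric] by (simp_all add: mult.commute)
      show "a j / n j = b j / sqrt (n j)" using that unfolding 1(1) by (simp add: field_simps)
      show "a j / m j = c j / sqrt (m j)" using that unfolding 1(2) by (simp add: field_simps)
    qed
    show "0 \<le> sqrt (real (n j) * real (m j) / (real (n j) + real (m j)))" for j by simp
    show "(\<lambda>\<omega>. (empirical (n j) (\<lambda>k. X k \<omega>), empirical (m j) (\<lambda>k. Y k \<omega>))) \<in> measurable M (count_space UNIV)" for j
      unfolding X Y by (rule empirical_pair_measurable)
    show "(\<lambda>j. \<integral>\<^sup>+\<omega>. l1dist (empirical (n j) (\<lambda>k. X k \<omega>)) r \<partial>M) \<longlonglongrightarrow> 0"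
      by (rule l1dist_freq_tendsto[where I = "\<lambda>j. I (n j)"])
        (auto simp: IJ n intro: eventually_mono[OF n0] emp_X)
    show "(\<lambda>j. \<integral>\<^sup>+\<omega>. l1dist (empirical (m j) (\<lambda>k. Y k \<omega>)) r \<partial>M) \<longlonglongrightarrow> 0"
      by (rule l1dist_freq_tendsto[where I = "\<lambda>j. J (m j)"])
        (auto simp: IJ m intro: eventually_mono[OF m0] emp_Y)
    \<comment> \<open>Each sample contributes at most \<open>sqrt (pmf r x)\<close>, as both weights
      are at most 1. This explains the factor 2 in the hypothesis \<open>bound\<close>.\<close>
    show "\<forall>\<^sub>F j in sequentially. \<forall>x. (\<integral>\<omega>. \<bar>sqrt (real (n j) * real (m j) / (real (n j) + real (m j))) *
        (pmf (empirical (n j) (\<lambda>k. X k \<omega>)) x - pmf (empirical (m j) (\<lambda>k. Y k \<omega>)) x)\<bar> \<partial>M) \<le> 2 * sqrt (pmf r x)"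
      unfolding a_def[symmetric] using n0 m0
    proof eventually_elim
      case (elim j)
      have a0: "0 \<le> a j" by (simp add: a_def)
      have bc: "b j \<le> 1" "c j \<le> 1" using elim by (auto simp: b_def c_def)
      show ?case
      proof
        fix x
        let ?eX = "expectation (\<lambda>\<omega>. \<bar>freq (I (n j)) \<omega> x - pmf r x\<bar>)"
        let ?eY = "expectation (\<lambda>\<omega>. \<bar>freq (J (m j)) \<omega> x - pmf r x\<bar>)"
        have "(\<integral>\<omega>. \<bar>a j * (pmf (empirical (n j) (\<lambda>k. X k \<omega>)) x - pmf (empirical (m j) (\<lambda>k. Y k \<omega>)) x)\<bar> \<partial>M)
            = (\<integral>\<omega>. a j * \<bar>freq (I (n j)) \<omega> x - freq (J (m j)) \<omega> x\<bar> \<partial>M)"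
          using elim a0 by (simp add: emp_X emp_Y abs_mult)
        also have "\<dots> \<le> (\<integral>\<omega>. a j * (\<bar>freq (I (n j)) \<omega> x - pmf r x\<bar> + \<bar>freq (J (m j)) \<omega> x - pmf r x\<bar>) \<partial>M)"
          using a0 by (intro integral_mono mult_left_mono)
            (auto intro!: Bochner_Integration.integrable_mult_right Bochner_Integration.integrable_add integrable_abs
              Bochner_Integration.integrable_diff freq_integrable)
        also have "\<dots> = a j * ?eX + a j * ?eY"
          by (simp add: freq_integrable distrib_left)
        also have "\<dots> \<le> a j * sqrt (pmf r x / n j) + a j * sqrt (pmf r x / m j)"
          using expectation_abs_freq_le(2)[OF IJ(1) IJ(6)[OF elim(1)], of x]
            expectation_abs_freq_le(2)[OF IJ(2) IJ(7)[OF elim(2)], of x] a0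
          by (intro add_mono mult_left_mono) (auto simp: IJ)
        also have "\<dots> = b j * sqrt (pmf r x) + c j * sqrt (pmf r x)"
        proof -
          have "a j * sqrt (pmf r x / n j) = b j * sqrt (pmf r x)"
            unfolding ab(2)[OF elim] using elim by (simp add: real_sqrt_divide)
          moreover have "a j * sqrt (pmf r x / m j) = c j * sqrt (pmf r x)"
            unfolding ac(2)[OF elim] using elim by (simp add: real_sqrt_divide)
          ultimately show ?thesis by simp
        qed
        also have "\<dots> \<le> 1 * sqrt (pmf r x) + 1 * sqrt (pmf r x)"
          using bc by (intro add_mono mult_right_mono) auto
        finally show "(\<integral>\<omega>. \<bar>a j * (pmf (empirical (n j) (\<lambda>k. X k \<omega>)) x - pmf (empirical (m j) (\<lambda>k. Y k \<omega>)) x)\<bar> \<partial>M)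
            \<le> 2 * sqrt (pmf r x)" by simp
      qed
    qed
    fix A :: "'a set" and t :: "'a \<Rightarrow> real" assume "finite A"
    let ?v = "\<Sum>x\<in>A. \<Sum>y\<in>A. t x * t y * multinomial_cov r x y"
    \<comment> \<open>The second sample enters with a minus sign, which disappears in the limit,
      where only squares occur.\<close>
    have c_lim: "(\<lambda>j. - c j) \<longlonglongrightarrow> - sqrt \<alpha>"
      unfolding c_def by (intro tendsto_intros ratio)
    have b_lim: "b \<longlonglongrightarrow> sqrt (1 - \<alpha>)"
    proof -
      have "\<forall>\<^sub>F j in sequentially. sqrt (1 - real (n j) / (real (n j) + real (m j))) = b j"
        using n0 by eventually_elim (simp add: b_def field_simps)
      moreover have "(\<lambda>j. sqrt (1 - real (n j) / (real (n j) + real (m j)))) \<longlonglongrightarrow> sqrt (1 - \<alpha>)"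
        by (intro tendsto_intros ratio)
      ultimately show ?thesis by (rule Lim_transform_eventually[rotated])
    qed
    have l1: "(\<lambda>j. contrast_char A t (b j / sqrt (n j)) ^ n j * contrast_char A t (- c j / sqrt (m j)) ^ m j)
        \<longlonglongrightarrow> complex_of_real (exp (- ((sqrt (1 - \<alpha>))\<^sup>2 * ?v / 2))) * complex_of_real (exp (- ((- sqrt \<alpha>)\<^sup>2 * ?v / 2)))"
      by (intro tendsto_mult contrast_char_tendsto b_lim c_lim n m)
    \<comment> \<open>The limiting variances are split in the proportions
      \<open>1 - \<alpha>\<close> and \<open>\<alpha>\<close>, so the limit is the same for every
      ratio of the sample sizes.\<close>
    have l2: "complex_of_real (exp (- ((sqrt (1 - \<alpha>))\<^sup>2 * ?v / 2))) * complex_of_real (exp (- ((- sqrt \<alpha>)\<^sup>2 * ?v / 2)))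
        = complex_of_real (exp (- (?v / 2)))"
    proof -
      have "- ((sqrt (1 - \<alpha>))\<^sup>2 * ?v / 2) + - ((- sqrt \<alpha>)\<^sup>2 * ?v / 2) = - (?v / 2)"
        using \<alpha> by (simp add: field_simps)
      then show ?thesis by (simp only: of_real_mult[symmetric] exp_add[symmetric])
    qed
    have l3: "\<forall>\<^sub>F j in sequentially. contrast_char A t (b j / sqrt (n j)) ^ n j * contrast_char A t (- c j / sqrt (m j)) ^ m j
        = (\<integral>\<omega>. cis (\<Sum>x\<in>A. t x * (a j * (pmf (empirical (n j) (\<lambda>k. X k \<omega>)) x - pmf (empirical (m j) (\<lambda>k. Y k \<omega>)) x))) \<partial>M)"
      using n0 m0
    proof eventually_elim
      case (elim j)
      have "(\<Sum>x\<in>A. t x * (a j * (pmf (empirical (n j) (\<lambda>k. X k \<omega>)) x - pmf (empirical (m j) (\<lambda>k. Y k \<omega>)) x)))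
          = b j / sqrt (n j) * (\<Sum>i\<in>I (n j). contrast A t (Z i \<omega>)) + - c j / sqrt (m j) * (\<Sum>i\<in>J (m j). contrast A t (Z i \<omega>))" for \<omega>
      proof -
        have "(\<Sum>x\<in>A. t x * (a j * (pmf (empirical (n j) (\<lambda>k. X k \<omega>)) x - pmf (empirical (m j) (\<lambda>k. Y k \<omega>)) x)))
            = a j * (\<Sum>x\<in>A. t x * (freq (I (n j)) \<omega> x - pmf r x)) - a j * (\<Sum>x\<in>A. t x * (freq (J (m j)) \<omega> x - pmf r x))"
          using elim unfolding right_diff_distrib[symmetric] sum_subtractf[symmetric]
          by (simp add: emp_X emp_Y sum_distrib_left) (simp add: algebra_simps)
        also have "\<dots> = a j / n j * (\<Sum>i\<in>I (n j). contrast A t (Z i \<omega>)) - a j / m j * (\<Sum>i\<in>J (m j). contrast A t (Z i \<omega>))"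
          unfolding sum_freq_contrast[OF IJ(1) IJ(6)[OF elim(1)]] sum_freq_contrast[OF IJ(2) IJ(7)[OF elim(2)]] by (simp add: IJ)
        finally show ?thesis unfolding ab(1)[OF elim] ac(1)[OF elim] by simp
      qed
      then show ?case
        using expectation_cis_contrast[OF IJ(1,2,5), of "b j / sqrt (n j)" A t "n j" "- c j / sqrt (m j)" "m j"] by (simp add: IJ)
    qed
    show "(\<lambda>j. \<integral>\<omega>. cis (\<Sum>x\<in>A. t x * (sqrt (real (n j) * real (m j) / (real (n j) + real (m j))) *
        (pmf (empirical (n j) (\<lambda>k. X k \<omega>)) x - pmf (empirical (m j) (\<lambda>k. Y k \<omega>)) x))) \<partial>M)
        \<longlonglongrightarrow> complex_of_real (exp (- (?v / 2)))"
      using Lim_transform_eventually[OF l1 l3] unfolding l2 a_def .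
  qed
  have s1: "sqrt (real n) powr (1 / p) = real n powr (1 / (2 * p))" for n
    by (rule sqrt_powr) simp
  have s2: "sqrt (real n * real m / (real n + real m)) powr (1 / p)
      = (real n * real m / (real n + real m)) powr (1 / (2 * p))" for n m
    by (rule sqrt_powr) simp
  show ?thesis
  proof (intro conjI allI impI)
    show "weak_conv_m
       (\<lambda>n. distr M borel (\<lambda>\<omega>. real n powr (1 / (2 * p)) * wasserstein td p (empirical n (\<lambda>k. X k \<omega>)) r))
       (distr N borel (\<lambda>\<omega>. tree_Z E w rt p (\<lambda>x. G x \<omega>)))"
      by (rule one[unfolded s1])
  next
    fix n m :: "nat \<Rightarrow> nat" and \<alpha> :: real
    assume "filterlim (\<lambda>j. min (n j) (m j)) at_top sequentially" "\<alpha> \<in> {0..1}"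
      "(\<lambda>j. real (n j) / (real (n j) + real (m j))) \<longlonglongrightarrow> \<alpha>"
    then show "weak_conv_m
       (\<lambda>j. distr M borel (\<lambda>\<omega>. (real (n j) * real (m j) / (real (n j) + real (m j))) powr (1 / (2 * p)) *
          wasserstein td p (empirical (n j) (\<lambda>k. X k \<omega>)) (empirical (m j) (\<lambda>k. Y k \<omega>))))
       (distr N borel (\<lambda>\<omega>. tree_Z E w rt p (\<lambda>x. G x \<omega>)))"
      by (rule two[unfolded s2])
  qed
qed

end
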